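(* Assume $V$ is $C^2$ with $\nabla^2V\succeq\alpha I$ for some $\alpha>0$, and let $\mathcal T\subseteq\mathcal T_{\rm star}$ be convex. Then (i) the functional $F(T)=\mathrm{KL}(T_\#\rho\|\pi)$ is $\alpha$-convex on $\mathcal T$ with respect to $\|\cdot\|_{L^2(\rho)}$, i.e. $F((1-t)T_0+tT_1)\le(1-t)F(T_0)+tF(T_1)-\frac{\alpha}{2}t(1-t)\|T_1-T_0\|_{L^2(\rho)}^2$ for $T_0,T_1\in\mathcal T$, $t\in[0,1]$; and (ii) the problem $\inf_{T\in\mathcal T_{\rm star}}\mathrm{KL}(T_\#\rho\|\pi)$ admits a unique minimizer $T^\star$ (unique in $L^2(\rho)$), and $T^\star_\#\rho$ is the unique minimizer of $\mathrm{KL}(\cdot\|\pi)$ over $\mathcal C_{\rm star}$.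
   Context: $d\ge2$, $\pi(z)\propto e^{-V(z)}$ on $\mathbb{R}^d$, $V$ satisfying the growth condition (for every $c_2>0$ there is $c_1>0$ with $|V(z)|\le c_1e^{c_2\|z\|^2}$). $\rho=\mathcal N(0,I_d)$. A measurable $T:\mathbb{R}^d\to\mathbb{R}^d$ is star-separable if $T(x)=(T_1(x_1),T_2(x_2\mid T_1(x_1)),\dots,T_d(x_d\mid T_1(x_1)))$ with $T_1$ strictly increasing and $x_i\mapsto T_i(x_i\mid z_1)$ strictly increasing for each $z_1$; $\mathcal T_{\rm star}$ is the set of such maps. $\mathcal C_{\rm star}$ is the set of probability measures $\mu(\mathrm{d}z)=\mu_1(\mathrm{d}z_1)\prod_{j=2}^d\mu_j(\mathrm{d}z_j\mid z_1)$. $T_\#\rho$ is the pushforward; KL is relative entropy. *)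

theory Defs
  imports "HOL-Probability.Probability"
begin

text \<open>Points of R^d are vectors of type real^'n, d = CARD('n). The distinguished
  index i1 plays the role of the first coordinate z_1 in the star structure.\<close>

definition gauss :: "(real ^ 'n) measure" where
  "gauss = density lborel (\<lambda>x. ennreal (\<Prod>i\<in>UNIV. std_normal_density (x $ i)))"

definition target :: "(real ^ 'n \<Rightarrow> real) \<Rightarrow> (real ^ 'n) measure" where
  "target V = density lborel
     (\<lambda>z. ennreal (exp (- V z) / integral\<^sup>L lborel (\<lambda>y. exp (- V y))))"

text \<open>Relative entropy KL(N || M) with values in [0, infinity] (as an extended real):
  infinity unless N is absolutely continuous w.r.t. M; otherwise the integral of
  log (dN/dM) against N, split into positive and negative parts
  (the negative part is always finite for probability measures).\<close>
definition KL :: "'a measure \<Rightarrow> 'a measure \<Rightarrow> ereal" where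
  "KL N M = (if absolutely_continuous M N
     then enn2ereal (\<integral>\<^sup>+x. ennreal (ln (enn2real (RN_deriv M N x))) \<partial>N)
        - enn2ereal (\<integral>\<^sup>+x. ennreal (- ln (enn2real (RN_deriv M N x))) \<partial>N)
     else \<infinity>)"

definition star_sep :: "'n \<Rightarrow> (real ^ 'n \<Rightarrow> real ^ 'n) \<Rightarrow> bool" where
  "star_sep i1 T \<longleftrightarrow> T \<in> borel_measurable borel \<and>
     (\<exists>(T1 :: real \<Rightarrow> real) (G :: 'n \<Rightarrow> real \<Rightarrow> real \<Rightarrow> real).
        strict_mono T1 \<and>
        (\<forall>i z1. i \<noteq> i1 \<longrightarrow> strict_mono (\<lambda>s. G i s z1)) \<and>
        (\<forall>x. T x = (\<chi> i. if i = i1 then T1 (x $ i1) else G i (x $ i) (T1 (x $ i1)))))"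

definition T_star :: "'n \<Rightarrow> (real ^ 'n \<Rightarrow> real ^ 'n) set" where
  "T_star i1 = {T. star_sep i1 T}"

text \<open>C_star: probability measures mu(dz) = mu_1(dz_1) prod_{j<>1} mu_j(dz_j | z_1),
  expressed by the defining formula on measurable rectangles (which determine mu).\<close>
definition C_star :: "'n \<Rightarrow> (real ^ 'n) measure set" where
  "C_star i1 = {\<mu>. prob_space \<mu> \<and> sets \<mu> = sets borel \<and>
     (\<exists>(\<mu>1 :: real measure) (K :: 'n \<Rightarrow> real \<Rightarrow> real measure).
        prob_space \<mu>1 \<and> sets \<mu>1 = sets borel \<and>
        (\<forall>j z. prob_space (K j z) \<and> sets (K j z) = sets borel) \<and>
        (\<forall>j A. A \<in> sets borel \<longrightarrow> (\<lambda>z. emeasure (K j z) A) \<in> borel_measurable borel) \<and>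
        (\<forall>A :: 'n \<Rightarrow> real set. (\<forall>j. A j \<in> sets borel) \<longrightarrow>
            emeasure \<mu> {z. \<forall>j. z $ j \<in> A j}
            = (\<integral>\<^sup>+z1. indicator (A i1) z1 * (\<Prod>j\<in>UNIV - {i1}. emeasure (K j z1) (A j)) \<partial>\<mu>1)))}"

definition L2dist_sq :: "(real ^ 'n \<Rightarrow> real ^ 'n) \<Rightarrow> (real ^ 'n \<Rightarrow> real ^ 'n) \<Rightarrow> ennreal" where
  "L2dist_sq T0 T1 = (\<integral>\<^sup>+x. ennreal ((norm (T1 x - T0 x))\<^sup>2) \<partial>gauss)"

end

(* On triangular maps the relative entropy is the integral of V(T) minus the sum of log (d_i T_i), up to a
   constant, and each term is convex along convex combinations of maps.  To avoid differentiating monotone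
   functions, derivatives are replaced by "subderivatives": functions D >= 0 whose integral over an interval is at
   most the increment of T_i.  They form a convex class that is closed under almost everywhere limits
   (Fatou); T pushes D dx to a measure below Lebesgue measure, so Gibbs' inequality bounds the entropy by the
   functional evaluated at (T, D); and if T#rho has a density, the quotient (normal density)/(conditional
   density at T) is a subderivative that attains the bound.

   Minimizers come from strong convexity: along a minimizing sequence the midpoint gaps are summable, which
   forces almost everywhere convergence of both T and log D.  The Knothe-Rosenblatt construction by quantile
   functions identifies the absolutely continuous star-structured measures with the laws of star maps. *)

theory Submission
  imports Defs
begin

section \<open>Pushing forward along increasing functions of one variable\<close>

text \<open>Subderivatives obey one-sided inequalities only, so every use of them has to point the
  right way. Convexity requires exact quotients at the two end points alone; the combined
  subderivative in between only has to bound the entropy from above. Likewise the minimization runs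
  over pairs of a map and a subderivative. The subderivative reached in the limit is not claimed to
  be exact: a pair with the least value of the functional already gives its map the least entropy,
  because every competitor of finite entropy is represented by an exact pair.

  The passage to the limit threatens strict monotonicity, which limits of increasing functions
  usually lose. It is saved by the convergence of \<open>ln D\<close>, not just of \<open>D\<close>:
  the limiting derivative is positive almost everywhere, and increments dominate its integral. No
  compactness of the set of maps enters; convergence comes from summable gaps, which control
  distances of maps and ratios of derivatives together. In the same way finite entropy of two maps
  forces a finite distance between them.\<close>

lemma emeasure_add_measure:
  fixes M N :: "'a measure"
  assumes "sets N = sets M"
  obtains L where "sets L = sets M" "\<And>A. A \<in> sets M \<Longrightarrow> emeasure L A = emeasure M A + emeasure N A"
proof
  let ?L = "measure_of (space M) (sets M) (\<lambda>A. emeasure M A + emeasure N A)"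
  show s: "sets ?L = sets M" by simp
  fix A assume A: "A \<in> sets M"
  show "emeasure ?L A = emeasure M A + emeasure N A"
  proof (rule emeasure_measure_of_sigma)
    show "sigma_algebra (space M) (sets M)" ..
    show "positive (sets M) (\<lambda>A. emeasure M A + emeasure N A)"
      by (simp add: positive_def)
    show "countably_additive (sets M) (\<lambda>A. emeasure M A + emeasure N A)"
    proof (rule countably_additiveI)
      fix F :: "nat \<Rightarrow> 'a set"
      assume F: "range F \<subseteq> sets M" "disjoint_family F" "\<Union> (range F) \<in> sets M"
      have "(\<Sum>i. emeasure M (F i) + emeasure N (F i)) = (\<Sum>i. emeasure M (F i)) + (\<Sum>i. emeasure N (F i))"
        by (rule suminf_add[symmetric]) auto
      then show "(\<Sum>i. emeasure M (F i) + emeasure N (F i)) = emeasure M (\<Union> (range F)) + emeasure N (\<Union> (range F))"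
        using F assms by (simp add: suminf_emeasure)
    qed
  qed (fact A)
qed

text \<open>An inequality between measures does not extend from intervals by a pi-lambda argument,
  so it is turned into an equation. The distribution function \<open>N\<close> of
  \<open>\<nu>\<close> is 1-Lipschitz, hence \<open>F x = x - N x\<close> is nondecreasing and
  continuous, and \<open>\<nu>\<close> plus the Stieltjes measure of \<open>F\<close> equals
  \<open>lborel\<close> because the two agree on half-open intervals.\<close>

lemma le_lborelI:
  fixes \<nu> :: "real measure"
  assumes sets: "sets \<nu> = sets borel"
    and le: "\<And>a b. a \<le> b \<Longrightarrow> emeasure \<nu> {a<..b} \<le> ennreal (b - a)"
    and A: "A \<in> sets borel"
  shows "emeasure \<nu> A \<le> emeasure lborel A"
proof -
  have fin: "emeasure \<nu> {a<..b} \<noteq> \<infinity>" for a b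
    using le[of a b] by (cases "a \<le> b") (auto simp: top_unique)
  \<comment> \<open>The total mass of \<open>\<nu>\<close> may be infinite, so the distribution
    function is anchored at 0 and counts mass to the left of 0 negatively.\<close>
  define N where "N x = (if 0 \<le> x then measure \<nu> {0<..x} else - measure \<nu> {x<..0})" for x
  have N_diff: "N b - N a = measure \<nu> {a<..b}" if "a \<le> b" for a b
  proof -
    have U: "measure \<nu> {a<..c} = measure \<nu> {a<..b} + measure \<nu> {b<..c}" if "a \<le> b" "b \<le> c" for a b c
    proof -
      have "{a<..c} = {a<..b} \<union> {b<..c}" using that by auto
      moreover have "measure \<nu> ({a<..b} \<union> {b<..c}) = measure \<nu> {a<..b} + measure \<nu> {b<..c}"
        by (rule measure_Union) (use fin sets in auto)
      ultimately show ?thesis by simp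
    qed
    show ?thesis
      using that U[of 0 a b] U[of a 0 b] U[of a b 0] by (auto simp: N_def)
  qed
  have m_le: "measure \<nu> {a<..b} \<le> b - a" if "a \<le> b" for a b
    using le[OF that] that by (simp add: measure_def enn2real_leI)
  have N_lip: "\<bar>N b - N a\<bar> \<le> \<bar>b - a\<bar>" for a b
  proof (cases "a \<le> b")
    case True then show ?thesis using N_diff[OF True] m_le[OF True] measure_nonneg[of \<nu> "{a<..b}"] by linarith
  next
    case False then show ?thesis using N_diff[of b a] m_le[of b a] measure_nonneg[of \<nu> "{b<..a}"] by linarith
  qed
  have cont: "continuous (at x within S) N" for x S
  proof -
    have "1-lipschitz_on UNIV N"
      by (intro lipschitz_onI) (auto simp: dist_real_def abs_minus_commute intro: N_lip)
    then have "continuous_on UNIV N" by (rule lipschitz_on_continuous_on)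
    then show ?thesis
      by (meson continuous_on_eq_continuous_within continuous_within_subset UNIV_I subset_UNIV)
  qed
  define F where "F x = x - N x" for x
  have F_mono: "F x \<le> F y" if "x \<le> y" for x y
    using N_lip[of y x] that by (auto simp: F_def)
  have F_cont: "continuous (at_right x) F" for x
    unfolding F_def by (intro continuous_intros cont)
  obtain L where L: "sets L = sets \<nu>"
    "\<And>A. A \<in> sets \<nu> \<Longrightarrow> emeasure L A = emeasure \<nu> A + emeasure (interval_measure F) A"
    using emeasure_add_measure[of "interval_measure F" \<nu>] sets by auto
  have "L = lborel"
  proof (rule measure_eqI_generator_eq[where \<Omega>=UNIV and E="range (\<lambda>(a, b). {a<..b::real})" and A="\<lambda>i::nat. {-real i<..real i}"])
    show "Int_stable (range (\<lambda>(a, b). {a<..b::real}))"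
      by (auto simp: Int_stable_def)
    show "sets L = sigma_sets UNIV (range (\<lambda>(a, b). {a<..b::real}))"
      using L(1) sets by (simp add: borel_sigma_sets_Ioc)
    show "sets lborel = sigma_sets UNIV (range (\<lambda>(a, b). {a<..b::real}))"
      by (simp add: borel_sigma_sets_Ioc)
    show eq: "emeasure L X = emeasure lborel X" if XE: "X \<in> range (\<lambda>(a, b). {a<..b::real})" for X
    proof -
      obtain a b where X: "X = {a<..b}" using XE by auto
      show ?thesis
      proof (cases "a \<le> b")
        case True
        have "emeasure L X = emeasure \<nu> {a<..b} + ennreal (F b - F a)"
          using X L sets by (simp add: emeasure_interval_measure_Ioc[OF True F_mono F_cont])
        also have "emeasure \<nu> {a<..b} = ennreal (N b - N a)"
          using fin[of a b] by (simp add: N_diff[OF True] emeasure_eq_ennreal_measure)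
        also have "ennreal (N b - N a) + ennreal (F b - F a) = ennreal (b - a)"
        proof (subst ennreal_plus[symmetric])
          show "0 \<le> N b - N a" by (simp add: N_diff[OF True])
          show "0 \<le> F b - F a" using F_mono[OF True] by simp
        qed (simp add: F_def)
        finally show ?thesis using X True by simp
      qed (use X in simp)
    qed
    show "emeasure L {-real i<..real i} \<noteq> \<infinity>" for i
      by (subst eq) auto
    show "(\<Union>i. {-real i<..real i}) = UNIV"
    proof (intro set_eqI iffI UNIV_I)
      fix x :: real
      obtain n where "real n > \<bar>x\<bar>" using reals_Archimedean2 by blast
      then show "x \<in> (\<Union>i. {-real i<..real i})" by (intro UN_I[of n]) auto
    qed
  qed auto
  then have "emeasure lborel A = emeasure \<nu> A + emeasure (interval_measure F) A"
    using L(2) A sets by auto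
  then show ?thesis by simp
qed

text \<open>A set closed under betweenness is, up to its (at most two) extreme points, a countable
  directed union of intervals with endpoints in the set.\<close>
lemma emeasure_between_le:
  fixes \<nu> :: "real measure"
  assumes sets: "sets \<nu> = sets borel"
    and J: "J \<in> sets borel" "\<And>u v w. u \<in> J \<Longrightarrow> w \<in> J \<Longrightarrow> u < v \<Longrightarrow> v < w \<Longrightarrow> v \<in> J"
    and single: "\<And>x. emeasure \<nu> {x} = 0"
    and le: "\<And>u v. u \<in> J \<Longrightarrow> v \<in> J \<Longrightarrow> u < v \<Longrightarrow> emeasure \<nu> {u<..<v} \<le> c"
  shows "emeasure \<nu> J \<le> c"
proof -
  define Q where "Q = J \<inter> \<rat>"
  have "countable Q" unfolding Q_def by (simp add: countable_rat)
  \<comment> \<open>All open intervals with end points among finitely many rational members of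
    \<open>J\<close>: the union lies between a least and a greatest end point, and the hypothesis
    applies to these two. The intersection with \<open>Q\<close> guards against an empty
    \<open>Q\<close>, for which \<open>from_nat_into\<close> returns an arbitrary value.\<close>
  define A where "A n = (\<Union>u\<in>from_nat_into Q ` {..<n} \<inter> Q. \<Union>v\<in>from_nat_into Q ` {..<n} \<inter> Q. {u<..<v})" for n
  have fin: "finite (from_nat_into Q ` {..<n} \<inter> Q)" for n by simp
  have A_sets: "A n \<in> sets \<nu>" for n
    unfolding A_def sets by (intro sets.finite_UN fin) auto
  have A_le: "emeasure \<nu> (A n) \<le> c" for n
  proof (cases "from_nat_into Q ` {..<n} \<inter> Q = {}")
    case False
    let ?F = "from_nat_into Q ` {..<n} \<inter> Q"
    have sub: "A n \<subseteq> {Min ?F<..<Max ?F}"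
    proof
      fix x assume "x \<in> A n"
      then obtain u v where uv: "u \<in> ?F" "v \<in> ?F" "u < x" "x < v"
        unfolding A_def UN_iff greaterThanLessThan_iff by (elim bexE conjE)
      show "x \<in> {Min ?F<..<Max ?F}"
        unfolding greaterThanLessThan_iff
        using le_less_trans[OF Min_le[OF fin uv(1)] uv(3)] less_le_trans[OF uv(4) Max_ge[OF fin uv(2)]] by (rule conjI)
    qed
    have "Min ?F \<in> J" "Max ?F \<in> J"
      using Min_in[OF fin False] Max_in[OF fin False] by (auto simp: Q_def)
    show ?thesis
    proof (cases "Min ?F < Max ?F")
      case True
      have "emeasure \<nu> (A n) \<le> emeasure \<nu> {Min ?F<..<Max ?F}"
        using sub by (intro emeasure_mono) (auto simp: sets)
      also have "\<dots> \<le> c" by (rule le) fact+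
      finally show ?thesis .
    next
      case False
      then have "A n = {}" using sub by auto
      then show ?thesis by simp
    qed
  qed (simp add: A_def)
  have inc: "incseq A"
      proof (rule incseq_SucI)
    fix n
    have "from_nat_into Q ` {..<n} \<inter> Q \<subseteq> from_nat_into Q ` {..<Suc n} \<inter> Q" by auto
    then show "A n \<subseteq> A (Suc n)" unfolding A_def by (intro UN_mono) auto
  qed
  define J' where "J' = (\<Union>n. A n)"
  have J'_sets: "J' \<in> sets \<nu>" unfolding J'_def using A_sets by auto
  have J'_le: "emeasure \<nu> J' \<le> c"
    unfolding J'_def by (subst SUP_emeasure_incseq[symmetric]) (use A_sets inc A_le in \<open>auto intro: SUP_least\<close>)
  have inJ': "x \<in> J'" if as: "u \<in> J" "w \<in> J" "u < x" "x < w" for u x w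
  proof -
    obtain q where q: "q \<in> \<rat>" "u < q" "q < x" using Rats_dense_in_real as by blast
    obtain r where r: "r \<in> \<rat>" "x < r" "r < w" using Rats_dense_in_real as by blast
    have xJ: "x \<in> J" using that J by blast
    have qQ: "q \<in> Q" using J(2)[of u x q] q that xJ by (auto simp: Q_def)
    have rQ: "r \<in> Q" using J(2)[of x w r] r that xJ by (auto simp: Q_def)
    obtain n where n: "q = from_nat_into Q n" using \<open>countable Q\<close> qQ by (metis from_nat_into_surj)
    obtain m where m: "r = from_nat_into Q m" using \<open>countable Q\<close> rQ by (metis from_nat_into_surj)
    have "x \<in> A (Suc (max n m))"
      unfolding A_def using q r qQ rQ n m
      by (intro UN_I[of q] UN_I[of r] IntI imageI) (auto simp: less_Suc_eq_le)
    then show ?thesis unfolding J'_def by blast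
  qed
  \<comment> \<open>Of three points of \<open>J\<close> outside \<open>J'\<close> the middle one
    would lie strictly between two points of \<open>J\<close>, hence in \<open>J'\<close>. So at
    most two points are missed, and they are null.\<close>
  have sub: "\<exists>x y. J - J' \<subseteq> {x, y}"
  proof (rule ccontr)
    assume H: "\<not> ?thesis"
    then have H': "\<not> J - J' \<subseteq> {x, y}" for x y by simp
    from H' obtain x where x: "x \<in> J - J'" by auto
    from H'[of x x] obtain y where y: "y \<in> J - J'" "y \<noteq> x" by auto
    from H'[of x y] obtain z where z: "z \<in> J - J'" "z \<noteq> x" "z \<noteq> y" by auto
    have no: False if "p \<in> J - J'" "q \<in> J - J'" "r \<in> J - J'" "p < q" "q < r" for p q r
      using inJ'[of p r q] that by simp
    have "x < y \<and> y < z \<or> x < z \<and> z < y \<or> y < x \<and> x < z \<or> y < z \<and> z < x \<or> z < x \<and> x < y \<or> z < y \<and> y < x"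
      using y(2) z(2,3) by linarith
    then show False using no x y(1) z(1) by (elim disjE conjE) blast+
  qed
  then obtain x y where xy: "J - J' \<subseteq> {x, y}" by blast
  have "emeasure \<nu> J \<le> emeasure \<nu> (J' \<union> ({x} \<union> {y}))"
    using xy J'_sets by (intro emeasure_mono) (auto simp: sets)
  also have "\<dots> \<le> emeasure \<nu> J' + (emeasure \<nu> {x} + emeasure \<nu> {y})"
    using J'_sets
    by (intro order_trans[OF emeasure_subadditive] add_left_mono emeasure_subadditive) (auto simp: sets)
  finally show ?thesis using J'_le single by simp
qed

text \<open>The preimage of \<open>{a<..b}\<close> under an increasing \<open>s\<close> is closed
  under betweenness, and any \<open>u < v\<close> in it satisfy
  \<open>s v - s u \<le> b - a\<close>; so \<open>s\<close> pushes \<open>D\<close> times Lebesgue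
  measure to a measure that gives each interval at most its length. Jumps and singular growth of
  \<open>s\<close> leave Lebesgue mass uncovered, hence an inequality only.\<close>

lemma nn_integral_push_le:
  fixes s :: "real \<Rightarrow> real" and D :: "real \<Rightarrow> real" and h :: "real \<Rightarrow> ennreal"
  assumes s: "strict_mono s"
    and [measurable]: "s \<in> borel_measurable borel" "D \<in> borel_measurable borel" "h \<in> borel_measurable borel"
    and le: "\<And>u v. u < v \<Longrightarrow> (\<integral>\<^sup>+w. ennreal (D w) * indicator {u<..<v} w \<partial>lborel) \<le> ennreal (s v - s u)"
  shows "(\<integral>\<^sup>+u. h (s u) * ennreal (D u) \<partial>lborel) \<le> (\<integral>\<^sup>+z. h z \<partial>lborel)"
proof -
  define \<eta> where "\<eta> = density lborel (\<lambda>w. ennreal (D w))"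
  have \<eta>_sets[simp, measurable_cong]: "sets \<eta> = sets borel" by (simp add: \<eta>_def)
  define \<nu> where "\<nu> = distr \<eta> borel s"
  have le': "emeasure \<nu> {a<..b} \<le> ennreal (b - a)" for a b
  proof -
    have "emeasure \<nu> {a<..b} = emeasure \<eta> (s -` {a<..b})"
      unfolding \<nu>_def by (subst emeasure_distr) (auto simp: \<eta>_def)
    also have "\<dots> \<le> ennreal (b - a)"
    proof (rule emeasure_between_le)
      show "s -` {a<..b} \<in> sets borel" using measurable_sets_borel[of s borel "{a<..b}"] by simp
      show "v \<in> s -` {a<..b}" if "u \<in> s -` {a<..b}" "w \<in> s -` {a<..b}" "u < v" "v < w" for u v w
        using strict_monoD[OF s that(3)] strict_monoD[OF s that(4)] that by auto
      show "emeasure \<eta> {x} = 0" for x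
      proof -
        have "{x} \<in> null_sets \<eta>"
          using absolutely_continuousI_density[of "\<lambda>w. ennreal (D w)" lborel]
            finite_imp_null_set_lborel[of "{x}"]
          by (auto simp: \<eta>_def absolutely_continuous_def)
        then show ?thesis by (rule null_setsD1)
      qed
      show "emeasure \<eta> {u<..<v} \<le> ennreal (b - a)" if "u \<in> s -` {a<..b}" "v \<in> s -` {a<..b}" "u < v" for u v
      proof -
        have "emeasure \<eta> {u<..<v} \<le> ennreal (s v - s u)"
          unfolding \<eta>_def by (subst emeasure_density) (auto intro: le that)
        also have "\<dots> \<le> ennreal (b - a)" using that by (intro ennreal_leI) auto
        finally show ?thesis .
      qed
    qed auto
    finally show ?thesis .
  qed
  have [measurable]: "s \<in> measurable \<eta> borel" by (simp add: \<eta>_def)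
  have \<nu>_sets: "sets \<nu> = sets borel" by (simp add: \<nu>_def)
  have "(\<integral>\<^sup>+u. h (s u) * ennreal (D u) \<partial>lborel) = (\<integral>\<^sup>+u. h (s u) \<partial>\<eta>)"
    unfolding \<eta>_def by (subst nn_integral_density) (auto simp: mult.commute)
  also have "\<dots> = (\<integral>\<^sup>+z. h z \<partial>\<nu>)"
    unfolding \<nu>_def by (subst nn_integral_distr) auto
  also have "\<dots> \<le> (\<integral>\<^sup>+z. h z \<partial>lborel)"
  proof (rule nn_integral_mono_measure)
    show "sets \<nu> = sets lborel" by (simp add: \<nu>_sets)
    show "\<nu> \<le> lborel"
      by (subst le_measure) (auto simp: \<nu>_sets le_fun_def intro: le_lborelI[OF \<nu>_sets le'])
  qed
  finally show ?thesis .
qed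

section \<open>The standard normal law on the line\<close>

definition stdn :: "real measure" where
  "stdn = density lborel (\<lambda>x. ennreal (std_normal_density x))"

lemma sets_stdn[simp, measurable_cong]: "sets stdn = sets borel"
  and space_stdn[simp]: "space stdn = UNIV"
  by (simp_all add: stdn_def)

interpretation stdn: prob_space stdn
  unfolding stdn_def by (rule prob_space_normal_density) simp

lemma AE_stdn_iff: "(AE x in stdn. P x) \<longleftrightarrow> (AE x in lborel. P x)"
  unfolding stdn_def by (subst AE_density) (auto simp: normal_density_pos)

lemma nn_integral_stdn: "f \<in> borel_measurable borel \<Longrightarrow>
    (\<integral>\<^sup>+x. f x \<partial>stdn) = (\<integral>\<^sup>+x. ennreal (std_normal_density x) * f x \<partial>lborel)"
  unfolding stdn_def by (simp add: nn_integral_density)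

text \<open>Formally \<open>std_normal_density u = f (s u) * s' u\<close>, so the quotient stands
  for the derivative of \<open>s\<close>. Integrated over \<open>{u<..<v}\<close> and pushed through
  \<open>s\<close>, it is at most the Lebesgue measure of the part of \<open>{s u<..<s v}\<close>
  where \<open>f\<close> is positive. Division by zero gives 0, which only helps the inequality, and
  \<open>f (s u)\<close> vanishes for a null set of \<open>u\<close> only.\<close>

lemma derivative_of_density:
  fixes s f :: "real \<Rightarrow> real"
  assumes s: "strict_mono s"
    and [measurable]: "s \<in> borel_measurable borel" "f \<in> borel_measurable borel"
    and f: "\<And>x. 0 \<le> f x"
    and eq: "distr stdn borel s = density lborel (\<lambda>z. ennreal (f z))"
  shows "AE u in lborel. 0 < std_normal_density u / f (s u)"
    and "u < v \<Longrightarrow> (\<integral>\<^sup>+w. ennreal (std_normal_density w / f (s w)) * indicator {u<..<v} w \<partial>lborel) \<le> ennreal (s v - s u)"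
proof -
  have "AE z in distr stdn borel s. 0 < f z"
    unfolding eq by (subst AE_density) (auto simp: less_le f)
  then have "AE u in lborel. 0 < f (s u)"
    by (subst (asm) AE_distr_iff) (auto simp: AE_stdn_iff)
  then show "AE u in lborel. 0 < std_normal_density u / f (s u)"
    by eventually_elim (simp add: normal_density_pos)
  assume uv: "u < v"
  have "(\<integral>\<^sup>+w. ennreal (std_normal_density w / f (s w)) * indicator {u<..<v} w \<partial>lborel)
      \<le> (\<integral>\<^sup>+w. ennreal (std_normal_density w) * (ennreal (1 / f (s w)) * indicator {s u<..<s v} (s w)) \<partial>lborel)"
    using strict_monoD[OF s]
    by (intro nn_integral_mono) (auto simp: indicator_def ennreal_mult'[symmetric] f)
  also have "\<dots> = (\<integral>\<^sup>+w. ennreal (1 / f (s w)) * indicator {s u<..<s v} (s w) \<partial>stdn)"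
    by (subst nn_integral_stdn) auto
  also have "\<dots> = (\<integral>\<^sup>+z. ennreal (1 / f z) * indicator {s u<..<s v} z \<partial>distr stdn borel s)"
    by (subst nn_integral_distr) auto
  also have "\<dots> = (\<integral>\<^sup>+z. ennreal (f z) * (ennreal (1 / f z) * indicator {s u<..<s v} z) \<partial>lborel)"
    unfolding eq by (subst nn_integral_density) auto
  also have "\<dots> \<le> (\<integral>\<^sup>+z. indicator {s u<..<s v} z \<partial>lborel)"
    by (intro nn_integral_mono) (auto simp: indicator_def ennreal_mult'[symmetric] f)
  also have "\<dots> = ennreal (s v - s u)"
    using strict_monoD[OF s uv] by simp
  finally show "(\<integral>\<^sup>+w. ennreal (std_normal_density w / f (s w)) * indicator {u<..<v} w \<partial>lborel) \<le> ennreal (s v - s u)" .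
qed

section \<open>Product measures on vectors\<close>

lemma measurable_vec_lambda[measurable]:
  assumes "\<And>i. (\<lambda>x. f x i) \<in> borel_measurable M"
  shows "(\<lambda>x. vec_lambda (f x) :: real^'n) \<in> borel_measurable M"
proof (subst borel_measurable_euclidean_space, intro ballI)
  fix b :: "real^'n" assume "b \<in> Basis"
  then obtain i where "b = axis i 1" by (auto simp: Basis_vec_def)
  then show "(\<lambda>x. vec_lambda (f x) \<bullet> b) \<in> borel_measurable M"
    using assms[of i] by (simp add: inner_axis)
qed

lemma prod_eq_insert_UNIV: "(\<Prod>i\<in>UNIV. f i) = (f i1 * (\<Prod>j\<in>UNIV - {i1::'n::finite}. f j) :: 'b::comm_monoid_mult)"
  by (simp add: prod.remove)

lemma rect_sets[measurable]:
  "(\<And>j. A j \<in> sets borel) \<Longrightarrow> {z::real^'n. \<forall>j. z $ j \<in> A j} \<in> sets borel"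
proof -
  assume A: "\<And>j. A j \<in> sets borel"
  have "{z::real^'n. \<forall>j. z $ j \<in> A j} = (\<Inter>j. (\<lambda>z. z $ j) -` A j)" by auto
  also have "\<dots> \<in> sets borel"
    using A by (intro sets.finite_INT measurable_sets_borel[of _ borel]) auto
  finally show ?thesis .
qed

lemma measure_eqI_rect:
  fixes M N :: "(real^'n) measure"
  assumes M: "prob_space M" "sets M = sets borel" and N: "sets N = sets borel"
    and eq: "\<And>A. (\<And>j. A j \<in> sets borel) \<Longrightarrow> emeasure M {z. \<forall>j. z $ j \<in> A j} = emeasure N {z. \<forall>j. z $ j \<in> A j}"
  shows "M = N"
proof -
  interpret M: prob_space M by fact
  define E where "E = {{z::real^'n. \<forall>j. z $ j \<in> A j} | A. \<forall>j. A j \<in> sets borel}"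
  have EI: "{z. \<forall>j. z $ j \<in> A j} \<in> E" if "\<And>j. A j \<in> sets borel" for A
    unfolding E_def mem_Collect_eq by (intro exI[of _ A]) (simp add: that)
  have box: "box a b \<in> E" for a b :: "real^'n"
  proof -
    have "box a b = {z. \<forall>j. z $ j \<in> {a$j <..< b$j}}" by (auto simp: mem_box_cart)
    then show ?thesis unfolding E_def mem_Collect_eq by (intro exI[of _ "\<lambda>j. {a$j <..< b$j}"]) simp
  qed
  have E_sub: "E \<subseteq> sets borel" unfolding E_def by auto
  have E_sigma: "sigma_sets UNIV E = sets borel"
  proof
    show "sigma_sets UNIV E \<subseteq> sets borel"
      using sets.sigma_sets_subset[OF E_sub] by simp
    have "sets (borel::(real^'n) measure) = sigma_sets UNIV (range (\<lambda>(a, b). box a b))"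
      unfolding borel_eq_box by simp
    also have "\<dots> \<subseteq> sigma_sets UNIV E"
      by (rule sigma_sets_mono') (use box in auto)
    finally show "sets borel \<subseteq> sigma_sets UNIV E" .
  qed
  show ?thesis
  proof (rule measure_eqI_generator_eq[where \<Omega>=UNIV and E=E and A="\<lambda>_. UNIV"])
    show "Int_stable E"
    proof (rule Int_stableI)
      fix a b assume "a \<in> E" "b \<in> E"
      then obtain A B where ab: "a = {z. \<forall>j. z $ j \<in> A j}" "b = {z. \<forall>j. z $ j \<in> B j}"
        "\<forall>j. A j \<in> sets borel" "\<forall>j. B j \<in> sets borel"
        unfolding E_def mem_Collect_eq by (elim exE conjE)
      have "{z. \<forall>j. z $ j \<in> A j \<inter> B j} \<in> E" by (rule EI) (use ab in auto)
      moreover have "a \<inter> b = {z. \<forall>j. z $ j \<in> A j \<inter> B j}" unfolding ab(1,2) by auto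
      ultimately show "a \<inter> b \<in> E" by simp
    qed
    have "UNIV \<in> E" using EI[of "\<lambda>_. UNIV"] by simp
    then show "range (\<lambda>_::nat. UNIV) \<subseteq> E" by blast
    show "emeasure M UNIV \<noteq> \<infinity>" using M.emeasure_finite by simp
    show "emeasure M X = emeasure N X" if "X \<in> E" for X
    proof -
      obtain A where "X = {z. \<forall>j. z $ j \<in> A j}" "\<forall>j. A j \<in> sets borel"
        using \<open>X \<in> E\<close> unfolding E_def mem_Collect_eq by (elim exE conjE)
      then show ?thesis using eq by simp
    qed
  qed (auto simp: E_sigma M N)
qed

text \<open>Carries a product measure from the space of functions to \<open>real^'n\<close>, so that
  the Tonelli theorems for \<open>PiM\<close> serve \<open>lborel\<close> and \<open>gauss\<close>
  alike.\<close>

definition vecM :: "real measure \<Rightarrow> (real^'n) measure" where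
  "vecM M = distr (PiM UNIV (\<lambda>_. M)) borel vec_lambda"

lemma sets_vecM[simp, measurable_cong]: "sets (vecM M) = sets borel"
  by (simp add: vecM_def)

lemma vec_lambda_measurable_PiM:
  assumes "sets M = sets borel"
  shows "vec_lambda \<in> measurable (PiM UNIV (\<lambda>_::'n. M)) (borel :: (real^'n) measure)"
proof -
  note assms[measurable_cong]
  show ?thesis by measurable
qed

lemma nn_integral_vecM:
  assumes M: "sets M = sets borel" and f: "f \<in> borel_measurable (borel :: (real^'n) measure)"
  shows "(\<integral>\<^sup>+x. f x \<partial>vecM M) = (\<integral>\<^sup>+y. f (vec_lambda y) \<partial>PiM UNIV (\<lambda>_. M))"
  unfolding vecM_def by (intro nn_integral_distr vec_lambda_measurable_PiM M) (use f in simp)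

lemma emeasure_vecM_rect:
  assumes M: "sigma_finite_measure M" "sets M = sets borel" and A: "\<And>j. A j \<in> sets borel"
  shows "emeasure (vecM M) {z::real^'n. \<forall>j. z $ j \<in> A j} = (\<Prod>j\<in>UNIV. emeasure M (A j))"
proof -
  note M(2)[measurable_cong]
  interpret M: sigma_finite_measure M by fact
  interpret product_sigma_finite "\<lambda>_::'n. M" by standard
  have sp: "space M = UNIV" using sets_eq_imp_space_eq[OF M(2)] by simp
  have "emeasure (vecM M) {z::real^'n. \<forall>j. z $ j \<in> A j}
      = emeasure (PiM UNIV (\<lambda>_::'n. M)) (vec_lambda -` {z. \<forall>j. z $ j \<in> A j} \<inter> space (PiM UNIV (\<lambda>_::'n. M)))"
    unfolding vecM_def by (intro emeasure_distr vec_lambda_measurable_PiM M rect_sets A)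
  also have "vec_lambda -` {z. \<forall>j. z $ j \<in> A j} \<inter> space (PiM UNIV (\<lambda>_::'n. M)) = (\<Pi>\<^sub>E j\<in>UNIV. A j)"
    using sp by (auto simp: space_PiM PiE_iff)
  also have "emeasure (PiM UNIV (\<lambda>_::'n. M)) (\<Pi>\<^sub>E j\<in>UNIV. A j) = (\<Prod>j\<in>UNIV. emeasure M (A j))"
    by (rule emeasure_PiM) (use A M in auto)
  finally show ?thesis .
qed

lemma lborel_eq_vecM: "(lborel :: (real^'n) measure) = vecM lborel"
proof (rule lborel_eqI)
  fix l u :: "real^'n" assume le: "\<And>b. b \<in> Basis \<Longrightarrow> l \<bullet> b \<le> u \<bullet> b"
  have le': "l $ i \<le> u $ i" for i using le[of "axis i 1"] by (auto simp: inner_axis Basis_vec_def)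
  have "emeasure (vecM lborel) (box l u) = emeasure (vecM lborel) {z. \<forall>j. z $ j \<in> {l $ j <..< u $ j}}"
    by (intro arg_cong2[where f=emeasure]) (auto simp: mem_box_cart)
  also have "\<dots> = (\<Prod>j\<in>UNIV. emeasure lborel {l $ j <..< u $ j})"
    by (intro emeasure_vecM_rect) (auto intro: lborel.sigma_finite_measure_axioms)
  also have "\<dots> = (\<Prod>j\<in>UNIV. ennreal (u $ j - l $ j))" using le' by simp
  also have "\<dots> = ennreal (\<Prod>j\<in>UNIV. u $ j - l $ j)" using le' by (simp add: prod_ennreal)
  also have "(\<Prod>j\<in>UNIV. u $ j - l $ j) = (\<Prod>b\<in>Basis. (u - l) \<bullet> b)"
  proof -
    have B: "(Basis :: (real^'n) set) = (\<lambda>i. axis i 1) ` UNIV" by (auto simp: Basis_vec_def)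
    have "inj (\<lambda>i::'n. axis i (1::real))" by (auto simp: inj_def axis_eq_axis)
    then show ?thesis unfolding B by (subst prod.reindex) (auto simp: inner_axis)
  qed
  finally show "emeasure (vecM lborel) (box l u) = (\<Prod>b\<in>Basis. (u - l) \<bullet> b)" .
qed simp

lemma nn_integral_vecM_split:
  assumes M: "sigma_finite_measure M" "sets M = sets borel"
    and f[measurable]: "f \<in> borel_measurable (borel :: (real^'n) measure)"
  shows "(\<integral>\<^sup>+x. f x \<partial>vecM M) = (\<integral>\<^sup>+p. \<integral>\<^sup>+y. f (vec_lambda (y(i1 := p))) \<partial>PiM (UNIV - {i1}) (\<lambda>_. M) \<partial>M)"
proof -
  note M(2)[measurable_cong]
  interpret M: sigma_finite_measure M by fact
  interpret product_sigma_finite "\<lambda>_::'n. M" by standard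
  have ins: "insert i1 (UNIV - {i1}) = UNIV" by auto
  have "(\<integral>\<^sup>+x. f x \<partial>vecM M) = (\<integral>\<^sup>+y. f (vec_lambda y) \<partial>PiM (insert i1 (UNIV - {i1})) (\<lambda>_. M))"
    unfolding ins by (rule nn_integral_vecM[OF M(2) f])
  also have "\<dots> = (\<integral>\<^sup>+p. \<integral>\<^sup>+y. f (vec_lambda (y(i1 := p))) \<partial>PiM (UNIV - {i1}) (\<lambda>_. M) \<partial>M)"
  proof (rule product_nn_integral_insert_rev)
    have "vec_lambda \<in> measurable (PiM UNIV (\<lambda>_::'n. M)) (borel :: (real^'n) measure)"
      by (rule vec_lambda_measurable_PiM[OF M(2)])
    then show "(\<lambda>y. f (vec_lambda y)) \<in> borel_measurable (PiM (insert i1 (UNIV - {i1})) (\<lambda>_. M))"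
      unfolding ins by measurable
  qed auto
  finally show ?thesis .
qed

text \<open>With the coordinate \<open>i1\<close> fixed, the remaining factors involve different
  coordinates, so the inner integral factorizes. This is Tonelli's theorem in the form that matches
  the rectangle formula of \<open>C_star\<close>.\<close>

lemma nn_integral_vecM_star:
  fixes k :: "real \<Rightarrow> ennreal" and g :: "'n::finite \<Rightarrow> real \<Rightarrow> real \<Rightarrow> ennreal"
  assumes M: "sigma_finite_measure M" "sets M = sets borel"
    and k[measurable]: "k \<in> borel_measurable borel"
    and g: "\<And>j. case_prod (g j) \<in> borel_measurable (borel \<Otimes>\<^sub>M borel)"
  shows "(\<integral>\<^sup>+x. k (x $ i1) * (\<Prod>j\<in>UNIV - {i1}. g j (x $ i1) (x $ j)) \<partial>vecM M)
      = (\<integral>\<^sup>+p. k p * (\<Prod>j\<in>UNIV - {i1}. \<integral>\<^sup>+u. g j p u \<partial>M) \<partial>M)"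
proof -
  note M(2)[measurable_cong]
  interpret M: sigma_finite_measure M by fact
  interpret product_sigma_finite "\<lambda>_::'n. M" by standard
  have sp: "space M = UNIV" using sets_eq_imp_space_eq[OF M(2)] by simp
  have g1: "(\<lambda>x::real^'n. g j (x $ i1) (x $ j)) \<in> borel_measurable borel" for j
    using measurable_compose[OF _ g[of j], of "\<lambda>x::real^'n. (x $ i1, x $ j)" borel] by simp
  have g2: "(\<lambda>u. g j p u) \<in> borel_measurable M" for j p
    using measurable_compose[OF _ g[of j], of "\<lambda>u. (p, u)" M] by simp
  have "(\<integral>\<^sup>+x. k (x $ i1) * (\<Prod>j\<in>UNIV - {i1}. g j (x $ i1) (x $ j)) \<partial>vecM M)
     = (\<integral>\<^sup>+p. \<integral>\<^sup>+y. k p * (\<Prod>j\<in>UNIV - {i1}. g j p (y j)) \<partial>PiM (UNIV - {i1}) (\<lambda>_. M) \<partial>M)"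
    by (subst nn_integral_vecM_split[OF M, where ?i1.0=i1])
       (auto intro!: borel_measurable_times_ennreal borel_measurable_prod_ennreal g1 nn_integral_cong prod.cong arg_cong2[where f="(*)"])
  also have "\<dots> = (\<integral>\<^sup>+p. k p * (\<Prod>j\<in>UNIV - {i1}. \<integral>\<^sup>+u. g j p u \<partial>M) \<partial>M)"
  proof (intro nn_integral_cong)
    fix p
    have "(\<lambda>y. \<Prod>j\<in>UNIV - {i1}. g j p (y j)) \<in> borel_measurable (PiM (UNIV - {i1}) (\<lambda>_. M))"
      by (intro borel_measurable_prod_ennreal measurable_compose[OF _ g2] measurable_component_singleton)
    then show "(\<integral>\<^sup>+y. k p * (\<Prod>j\<in>UNIV - {i1}. g j p (y j)) \<partial>PiM (UNIV - {i1}) (\<lambda>_. M))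
       = k p * (\<Prod>j\<in>UNIV - {i1}. \<integral>\<^sup>+u. g j p u \<partial>M)"
      using product_nn_integral_prod[of "UNIV - {i1}" "\<lambda>j. g j p", OF _ g2]
      by (simp add: nn_integral_cmult)
  qed
  finally show ?thesis .
qed

lemma gauss_eq_vecM: "(gauss :: (real^'n) measure) = vecM stdn"
proof (rule sym, rule measure_eqI_rect)
  interpret product_prob_space "\<lambda>_::'n. stdn" ..
  show "prob_space (vecM stdn :: (real^'n) measure)"
    unfolding vecM_def
    by (rule prob_space.prob_space_distr) (auto intro: prob_space_PiM stdn.prob_space_axioms vec_lambda_measurable_PiM)
  fix A :: "'n \<Rightarrow> real set" assume A[measurable]: "\<And>j. A j \<in> sets borel"
  interpret L: product_sigma_finite "\<lambda>_::'n. lborel::real measure" ..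
  have "emeasure gauss {z::real^'n. \<forall>j. z $ j \<in> A j}
     = (\<integral>\<^sup>+z. ennreal (\<Prod>i\<in>UNIV. std_normal_density (z $ i)) * indicator {z. \<forall>j. z $ j \<in> A j} z \<partial>vecM lborel)"
    unfolding gauss_def lborel_eq_vecM[symmetric] by (subst emeasure_density) auto
  also have "\<dots> = (\<integral>\<^sup>+z. (\<Prod>i\<in>UNIV. ennreal (std_normal_density (z $ i)) * indicator (A i) (z $ i)) \<partial>vecM lborel)"
    by (intro nn_integral_cong) (auto simp: prod.distrib prod_ennreal indicator_def normal_density_nonneg)
  also have "\<dots> = (\<integral>\<^sup>+y. (\<Prod>i\<in>UNIV. ennreal (std_normal_density (y i)) * indicator (A i) (y i)) \<partial>PiM UNIV (\<lambda>_. lborel))"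
    by (subst nn_integral_vecM) auto
  also have "\<dots> = (\<Prod>i\<in>UNIV. \<integral>\<^sup>+u. ennreal (std_normal_density u) * indicator (A i) u \<partial>lborel)"
    by (rule L.product_nn_integral_prod) auto
  also have "\<dots> = (\<Prod>i\<in>UNIV. emeasure stdn (A i))"
    by (simp add: stdn_def emeasure_density)
  finally show "emeasure (vecM stdn) {z. \<forall>j. z $ j \<in> A j} = emeasure gauss {z. \<forall>j. z $ j \<in> A j}"
    by (simp add: emeasure_vecM_rect stdn.sigma_finite_measure_axioms)
qed (auto simp: gauss_def)

lemma sets_gauss[simp, measurable_cong]: "sets gauss = sets borel"
  and space_gauss[simp]: "space gauss = UNIV"
  by (simp_all add: gauss_def)

lemma prob_space_gauss: "prob_space (gauss :: (real^'n) measure)"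
proof -
  interpret product_prob_space "\<lambda>_::'n. stdn" ..
  show ?thesis
  unfolding gauss_eq_vecM vecM_def
    by (rule prob_space.prob_space_distr) (auto intro: prob_space_PiM stdn.prob_space_axioms vec_lambda_measurable_PiM)
qed

interpretation gauss: prob_space "gauss :: (real^'n) measure"
  by (rule prob_space_gauss)

lemma AE_gauss_iff: "(AE x in gauss. P x) \<longleftrightarrow> (AE x in lborel. P (x::real^'n))"
  unfolding gauss_def by (subst AE_density) (auto simp: normal_density_pos prod_pos)

lemma distr_gauss_coord: "distr gauss borel (\<lambda>x::real^'n. x $ i) = stdn"
proof (rule measure_eqI)
  fix A :: "real set" assume "A \<in> sets (distr gauss borel (\<lambda>x::real^'n. x $ i))"
  then have A[measurable]: "A \<in> sets borel" by simp
  have "emeasure (distr gauss borel (\<lambda>x::real^'n. x $ i)) A = emeasure gauss {z::real^'n. \<forall>j. z $ j \<in> (if j = i then A else UNIV)}"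
    by (subst emeasure_distr) (auto intro!: arg_cong2[where f=emeasure])
  also have "\<dots> = (\<Prod>j\<in>(UNIV::'n set). emeasure stdn (if j = i then A else UNIV))"
    unfolding gauss_eq_vecM by (rule emeasure_vecM_rect) (auto intro: stdn.sigma_finite_measure_axioms)
  also have "\<dots> = emeasure stdn A"
    by (subst prod_eq_insert_UNIV[of _ i]) (auto intro!: prod.neutral simp: stdn.emeasure_space_1[simplified])
  finally show "emeasure (distr gauss borel (\<lambda>x::real^'n. x $ i)) A = emeasure stdn A" .
qed simp

lemma distr_gauss_coords:
  assumes "i1 \<noteq> i"
  shows "distr gauss (borel \<Otimes>\<^sub>M borel) (\<lambda>x::real^'n. (x $ i1, x $ i)) = stdn \<Otimes>\<^sub>M stdn"
proof (rule sym, rule pair_measure_eqI)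
  fix A B :: "real set" assume "A \<in> sets stdn" "B \<in> sets stdn"
  then have AB[measurable]: "A \<in> sets borel" "B \<in> sets borel" by simp_all
  have i: "i \<in> UNIV - {i1}" using assms by auto
  have "emeasure (distr gauss (borel \<Otimes>\<^sub>M borel) (\<lambda>x::real^'n. (x $ i1, x $ i))) (A \<times> B)
     = emeasure gauss {z::real^'n. \<forall>j. z $ j \<in> (if j = i1 then A else if j = i then B else UNIV)}"
    using assms by (subst emeasure_distr) (auto intro!: arg_cong2[where f=emeasure])
  also have "\<dots> = (\<Prod>j\<in>(UNIV::'n set). emeasure stdn (if j = i1 then A else if j = i then B else UNIV))"
    unfolding gauss_eq_vecM by (rule emeasure_vecM_rect) (auto intro: stdn.sigma_finite_measure_axioms)
  also have "\<dots> = emeasure stdn A * (\<Prod>j\<in>UNIV - {i1}. if j = i then emeasure stdn B else 1)"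
  proof -
    have "emeasure stdn UNIV = 1" using stdn.emeasure_space_1 by simp
    then have "(\<Prod>j\<in>UNIV - {i1}. emeasure stdn (if j = i1 then A else if j = i then B else UNIV))
       = (\<Prod>j\<in>UNIV - {i1}. if j = i then emeasure stdn B else 1)"
      by (intro prod.cong) auto
    then show ?thesis by (subst prod_eq_insert_UNIV[of _ i1]) simp
  qed
  also have "\<dots> = emeasure stdn A * emeasure stdn B"
    by (subst prod.remove[OF _ i]) (auto intro!: arg_cong2[where f="(*)"] prod.neutral)
  finally show "emeasure stdn A * emeasure stdn B = emeasure (distr gauss (borel \<Otimes>\<^sub>M borel) (\<lambda>x::real^'n. (x $ i1, x $ i))) (A \<times> B)" by simp
qed (auto intro: stdn.sigma_finite_measure_axioms)

text \<open>For \<open>i \<noteq> i1\<close> the pair of coordinates has the product law. For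
  \<open>i = i1\<close> its law sits on the diagonal, and the equivalence survives because
  \<open>Q\<close> then ignores its first argument; conditions on \<open>S\<close> and
  \<open>D\<close> at \<open>i1\<close>, where that argument is a dummy, are of this kind.\<close>

lemma AE_gauss_coord_iff:
  assumes Q: "Measurable.pred (borel \<Otimes>\<^sub>M borel) (case_prod Q)"
    and indep: "i = i1 \<Longrightarrow> \<forall>p q u. Q p u = Q q u"
  shows "(AE x in gauss. Q (x $ i1) ((x::real^'n) $ i)) \<longleftrightarrow> (AE p in stdn. AE u in stdn. Q p u)"
proof (cases "i = i1")
  case False
  interpret pair_sigma_finite stdn stdn ..
  have "(AE x in gauss. Q (x $ i1) ((x::real^'n) $ i))
      \<longleftrightarrow> (AE z in distr gauss (borel \<Otimes>\<^sub>M borel) (\<lambda>x::real^'n. (x $ i1, x $ i)). case_prod Q z)"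
    using Q by (subst AE_distr_iff) (auto simp: pred_def)
  also have "\<dots> \<longleftrightarrow> (AE z in stdn \<Otimes>\<^sub>M stdn. case_prod Q z)"
    by (simp only: distr_gauss_coords[OF not_sym[OF False]])
  also have "\<dots> \<longleftrightarrow> (AE p in stdn. AE u in stdn. Q p u)"
    using Q AE_pair_iff[of Q] by (simp add: pred_def space_pair_measure case_prod_unfold)
  finally show ?thesis .
next
  case True
  have Q0: "Q p u = Q 0 u" for p u using indep[OF True] by blast
  have Qm: "Measurable.pred borel (Q 0)"
    using measurable_compose[OF _ Q, of "\<lambda>u. (0, u)" borel] by simp
  have "(AE x in gauss. Q (x $ i1) ((x::real^'n) $ i)) \<longleftrightarrow> (AE x in gauss. Q 0 ((x::real^'n) $ i))"
    by (rule AE_cong) (rule Q0)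
  also have "\<dots> \<longleftrightarrow> (AE u in distr gauss borel (\<lambda>x::real^'n. x $ i). Q 0 u)"
    using Qm by (subst AE_distr_iff) (auto simp: pred_def)
  also have "\<dots> \<longleftrightarrow> (AE u in stdn. Q 0 u)" by (simp only: distr_gauss_coord)
  also have "\<dots> \<longleftrightarrow> (AE p in stdn. AE u in stdn. Q 0 u)" by simp
  also have "\<dots> \<longleftrightarrow> (AE p in stdn. AE u in stdn. Q p u)"
    by (intro AE_cong) (rule Q0[symmetric])
  finally show ?thesis .
qed

text \<open>Induction over the coordinates: the one-dimensional bound is applied to the newest
  coordinate with the others fixed, and the induction hypothesis to \<open>H\<close>, the integral
  of \<open>h\<close> over that coordinate. Hence \<open>h\<close> is kept arbitrary.\<close>

lemma nn_integral_PiM_push_le: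
  fixes s d :: "'i \<Rightarrow> real \<Rightarrow> real"
  assumes "finite I"
    and s: "\<And>i. i \<in> I \<Longrightarrow> s i \<in> borel_measurable borel"
    and d: "\<And>i. i \<in> I \<Longrightarrow> d i \<in> borel_measurable borel"
    and push: "\<And>i h. i \<in> I \<Longrightarrow> h \<in> borel_measurable borel \<Longrightarrow>
      (\<integral>\<^sup>+u. h (s i u) * ennreal (d i u) \<partial>lborel) \<le> (\<integral>\<^sup>+z. h z \<partial>lborel)"
    and h: "h \<in> borel_measurable (PiM I (\<lambda>_. lborel))"
  shows "(\<integral>\<^sup>+x. h (\<lambda>i\<in>I. s i (x i)) * (\<Prod>i\<in>I. ennreal (d i (x i))) \<partial>PiM I (\<lambda>_. lborel))
    \<le> (\<integral>\<^sup>+z. h z \<partial>PiM I (\<lambda>_. lborel))"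
  using assms
proof (induction I arbitrary: h)
  case empty
  interpret product_sigma_finite "\<lambda>_::'i. lborel::real measure" ..
  show ?case by (simp add: nn_integral_empty restrict_def PiM_empty nn_integral_count_space_finite)
next
  case (insert i I)
  interpret product_sigma_finite "\<lambda>_::'i. lborel::real measure" ..
  interpret I: finite_product_sigma_finite "\<lambda>_::'i. lborel::real measure" I by standard fact
  note [measurable] = insert.prems(4)
  have sm[measurable]: "s j \<in> borel_measurable borel" if "j \<in> insert i I" for j using insert.prems that by blast
  have dm[measurable]: "d j \<in> borel_measurable borel" if "j \<in> insert i I" for j using insert.prems that by blast
  have si[measurable]: "s i \<in> borel_measurable borel" "d i \<in> borel_measurable borel" by (auto intro: sm dm)
  have hm: "(\<lambda>(x, y). h (x(i := y))) \<in> borel_measurable (PiM I (\<lambda>_. lborel) \<Otimes>\<^sub>M lborel)"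
    by measurable
  define H where "H x = (\<integral>\<^sup>+y. h (x(i := y)) \<partial>lborel)" for x
  have Hm: "H \<in> borel_measurable (PiM I (\<lambda>_. lborel))"
    unfolding H_def using hm by (rule lborel.borel_measurable_nn_integral)
  have sI: "(\<lambda>x. \<lambda>j\<in>I. s j (x j)) \<in> measurable (PiM I (\<lambda>_. lborel)) (PiM I (\<lambda>_. lborel))"
    by (rule measurable_restrict) (use sm in \<open>auto intro!: measurable_compose[OF measurable_component_singleton]\<close>)
  have dI: "(\<lambda>x. \<Prod>j\<in>I. ennreal (d j (x j))) \<in> borel_measurable (PiM I (\<lambda>_. lborel))"
    by (intro borel_measurable_prod_ennreal measurable_compose[OF _ measurable_ennreal]
         measurable_compose[OF measurable_component_singleton] ) (use dm in auto)
  have sI': "(\<lambda>x. \<lambda>j\<in>insert i I. s j (x j)) \<in> measurable (PiM (insert i I) (\<lambda>_. lborel)) (PiM (insert i I) (\<lambda>_. lborel))"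
    by (rule measurable_restrict) (use sm in \<open>auto intro!: measurable_compose[OF measurable_component_singleton]\<close>)
  have dI': "(\<lambda>x. \<Prod>j\<in>insert i I. ennreal (d j (x j))) \<in> borel_measurable (PiM (insert i I) (\<lambda>_. lborel))"
    by (intro borel_measurable_prod_ennreal measurable_compose[OF _ measurable_ennreal]
         measurable_compose[OF measurable_component_singleton] ) (use dm in auto)
  have "(\<integral>\<^sup>+x. h (\<lambda>i\<in>insert i I. s i (x i)) * (\<Prod>i\<in>insert i I. ennreal (d i (x i))) \<partial>PiM (insert i I) (\<lambda>_. lborel))
     = (\<integral>\<^sup>+x. \<integral>\<^sup>+y. h (\<lambda>j\<in>insert i I. s j ((x(i := y)) j)) * (\<Prod>j\<in>insert i I. ennreal (d j ((x(i := y)) j))) \<partial>lborel \<partial>PiM I (\<lambda>_. lborel))"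
    by (rule product_nn_integral_insert)
       (use insert.hyps sI' dI' insert.prems(4) in \<open>auto intro!: borel_measurable_times_ennreal measurable_compose[OF sI']\<close>)
  also have "\<dots> = (\<integral>\<^sup>+x. (\<integral>\<^sup>+y. h ((\<lambda>j\<in>I. s j (x j))(i := s i y)) * ennreal (d i y) * (\<Prod>j\<in>I. ennreal (d j (x j))) \<partial>lborel) \<partial>PiM I (\<lambda>_. lborel))"
  proof (intro nn_integral_cong)
    fix x y
    have 1: "(\<lambda>j\<in>insert i I. s j ((x(i := y)) j)) = (\<lambda>j\<in>I. s j (x j))(i := s i y)"
      using insert.hyps by (auto simp: fun_eq_iff)
    have 2: "(\<Prod>j\<in>insert i I. ennreal (d j ((x(i := y)) j))) = ennreal (d i y) * (\<Prod>j\<in>I. ennreal (d j (x j)))"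
      using insert.hyps by (auto intro!: arg_cong2[where f="(*)"] prod.cong)
    show "h (\<lambda>j\<in>insert i I. s j ((x(i := y)) j)) * (\<Prod>j\<in>insert i I. ennreal (d j ((x(i := y)) j)))
      = h ((\<lambda>j\<in>I. s j (x j))(i := s i y)) * ennreal (d i y) * (\<Prod>j\<in>I. ennreal (d j (x j)))"
      unfolding 1 2 by (simp add: mult.assoc)
  qed
  also have "\<dots> \<le> (\<integral>\<^sup>+x. H (\<lambda>j\<in>I. s j (x j)) * (\<Prod>j\<in>I. ennreal (d j (x j))) \<partial>PiM I (\<lambda>_. lborel))"
  proof (intro nn_integral_mono)
    fix x :: "'i \<Rightarrow> real" assume x: "x \<in> space (PiM I (\<lambda>_. lborel))"
    let ?z = "\<lambda>j\<in>I. s j (x j)"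
    have z: "?z \<in> space (PiM I (\<lambda>_. lborel))" by (simp add: space_PiM)
    have hz: "(\<lambda>y. h (?z(i := y))) \<in> borel_measurable borel"
      using measurable_Pair2[OF hm z] by simp
    have hz': "(\<lambda>y. h (?z(i := s i y)) * ennreal (d i y)) \<in> borel_measurable lborel"
      using measurable_compose[OF si(1) hz] si(2) by auto
    have "(\<integral>\<^sup>+y. h (?z(i := s i y)) * ennreal (d i y) * (\<Prod>j\<in>I. ennreal (d j (x j))) \<partial>lborel)
       = (\<integral>\<^sup>+y. h (?z(i := s i y)) * ennreal (d i y) \<partial>lborel) * (\<Prod>j\<in>I. ennreal (d j (x j)))"
      by (rule nn_integral_multc) (rule hz')
    also have "\<dots> \<le> H ?z * (\<Prod>j\<in>I. ennreal (d j (x j)))"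
      unfolding H_def by (intro mult_right_mono insert.prems(3) hz) auto
    finally show "(\<integral>\<^sup>+y. h (?z(i := s i y)) * ennreal (d i y) * (\<Prod>j\<in>I. ennreal (d j (x j))) \<partial>lborel)
       \<le> H ?z * (\<Prod>j\<in>I. ennreal (d j (x j)))" .
  qed
  also have "\<dots> \<le> (\<integral>\<^sup>+z. H z \<partial>PiM I (\<lambda>_. lborel))"
    by (rule insert.IH) (use insert.prems Hm in auto)
  also have "\<dots> = (\<integral>\<^sup>+z. h z \<partial>PiM (insert i I) (\<lambda>_. lborel))"
    unfolding H_def using insert.hyps insert.prems(4) by (subst product_nn_integral_insert) auto
  finally show ?case .
qed

section \<open>Relative entropy, strong convexity, and star maps\<close>

text \<open>By \<open>ln y \<le> y - 1\<close> at \<open>y = 1 / q\<close>, the product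
  \<open>q * (- ln q)\<close> is at most \<open>1 - q\<close>, so the negative part has integral at
  most 1 under \<open>N\<close>. The difference in the definition of \<open>KL\<close> is therefore
  never of the form infinity minus infinity, and finite entropy is the same as integrability of the
  logarithm.\<close>

lemma KL_density:
  assumes M: "prob_space M" and N: "prob_space N" and q[measurable]: "q \<in> borel_measurable M"
    and q0: "\<And>x. 0 \<le> q x" and eq: "N = density M (\<lambda>x. ennreal (q x))"
  shows "integrable N (\<lambda>x. ln (q x)) \<Longrightarrow> KL N M = ereal (\<integral>x. ln (q x) \<partial>N)"
    and "KL N M \<noteq> \<infinity> \<Longrightarrow> integrable N (\<lambda>x. ln (q x))"
    and "(\<integral>\<^sup>+x. ennreal (- ln (q x)) \<partial>N) \<noteq> \<infinity>"
proof -
  interpret M: prob_space M by fact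
  interpret N: prob_space N by fact
  have qN[measurable]: "q \<in> borel_measurable N" using q by (simp add: eq)
  have ac: "absolutely_continuous M N"
    unfolding eq by (rule absolutely_continuousI_density) measurable
  have setsN: "sets N = sets M" by (simp add: eq)
  have "AE x in M. ennreal (q x) = RN_deriv M N x"
    by (rule M.RN_deriv_unique) (auto simp: eq)
  then have RN: "AE x in N. enn2real (RN_deriv M N x) = q x"
  proof -
    assume "AE x in M. ennreal (q x) = RN_deriv M N x"
    then have "AE x in M. enn2real (RN_deriv M N x) = q x"
      by eventually_elim (metis enn2real_ennreal q0)
    then show ?thesis by (rule absolutely_continuous_AE[OF setsN ac])
  qed
  have KL: "KL N M = enn2ereal (\<integral>\<^sup>+x. ennreal (ln (q x)) \<partial>N) - enn2ereal (\<integral>\<^sup>+x. ennreal (- ln (q x)) \<partial>N)"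
  proof -
    have "(\<integral>\<^sup>+x. ennreal (ln (enn2real (RN_deriv M N x))) \<partial>N) = (\<integral>\<^sup>+x. ennreal (ln (q x)) \<partial>N)"
      "(\<integral>\<^sup>+x. ennreal (- ln (enn2real (RN_deriv M N x))) \<partial>N) = (\<integral>\<^sup>+x. ennreal (- ln (q x)) \<partial>N)"
      using RN by (auto intro!: nn_integral_cong_AE elim!: eventually_mono)
    then show ?thesis unfolding KL_def using ac by simp
  qed
  have bound: "ennreal (q x) * ennreal (- ln (q x)) \<le> 1" for x
  proof (cases "q x = 0")
    case False
    then have pos: "0 < q x" using q0[of x] by simp
    have "- ln (q x) \<le> 1 / q x - 1"
      using ln_le_minus_one[of "1 / q x"] pos by (simp add: ln_div)
    then have "q x * (- ln (q x)) \<le> q x * (1 / q x - 1)"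
      using pos by (intro mult_left_mono) auto
    also have "\<dots> \<le> 1" using pos by (simp add: field_simps)
    finally show ?thesis using pos
      by (simp add: ennreal_mult'[symmetric] del: mult_minus_right)
  qed simp
  have "(\<integral>\<^sup>+x. ennreal (- ln (q x)) \<partial>N) = (\<integral>\<^sup>+x. ennreal (q x) * ennreal (- ln (q x)) \<partial>M)"
    by (subst eq, subst nn_integral_density) auto
  also have "\<dots> \<le> (\<integral>\<^sup>+x. 1 \<partial>M)" by (intro nn_integral_mono bound)
  also have "\<dots> = 1" by (simp add: M.emeasure_space_1)
  finally have neg: "(\<integral>\<^sup>+x. ennreal (- ln (q x)) \<partial>N) \<noteq> \<infinity>"
    by (auto simp: top_unique)
  then show "(\<integral>\<^sup>+x. ennreal (- ln (q x)) \<partial>N) \<noteq> \<infinity>" .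
  from neg obtain b where b: "(\<integral>\<^sup>+x. ennreal (- ln (q x)) \<partial>N) = ennreal b" "0 \<le> b"
    by (cases "\<integral>\<^sup>+x. ennreal (- ln (q x)) \<partial>N") auto
  show "integrable N (\<lambda>x. ln (q x))" if "KL N M \<noteq> \<infinity>"
  proof -
    have "(\<integral>\<^sup>+x. ennreal (ln (q x)) \<partial>N) \<noteq> \<infinity>"
    proof
      assume "(\<integral>\<^sup>+x. ennreal (ln (q x)) \<partial>N) = \<infinity>"
      then have "KL N M = \<infinity>" unfolding KL b by (simp add: b(2) enn2ereal_ennreal)
      with that show False by simp
    qed
    with neg show ?thesis by (simp add: real_integrable_def)
  qed
  show "KL N M = ereal (\<integral>x. ln (q x) \<partial>N)" if int: "integrable N (\<lambda>x. ln (q x))"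
  proof -
    have "(\<integral>\<^sup>+x. ennreal (ln (q x)) \<partial>N) \<noteq> \<infinity>" using int by (simp add: real_integrable_def)
    then obtain a where a: "(\<integral>\<^sup>+x. ennreal (ln (q x)) \<partial>N) = ennreal a" "0 \<le> a"
      by (cases "\<integral>\<^sup>+x. ennreal (ln (q x)) \<partial>N") auto
    show ?thesis
      unfolding KL a b real_lebesgue_integral_def[OF int] using a(2) b(2) by (simp add: enn2ereal_ennreal)
  qed
qed

text \<open>Along the segment from \<open>a\<close> to \<open>b\<close>, subtracting
  \<open>\<alpha> / 2 * N * t\<^sup>2\<close> from \<open>V\<close> leaves a convex function
  \<open>g\<close> of one variable. Its chord inequality on the unit interval is the first claim,
  its tangent at 0 the second.\<close>

lemma strong_convexity_of_hessian:
  fixes V :: "real ^ 'n \<Rightarrow> real"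
  assumes grad: "\<And>z. (V has_derivative (\<lambda>h. gradV z \<bullet> h)) (at z)"
    and hess: "\<And>z. (gradV has_derivative (\<lambda>h. HessV z *v h)) (at z)"
    and sc: "\<And>z h. h \<bullet> (HessV z *v h) \<ge> \<alpha> * (norm h)\<^sup>2"
  shows "0 \<le> t \<Longrightarrow> t \<le> 1 \<Longrightarrow> V ((1 - t) *\<^sub>R a + t *\<^sub>R b) \<le> (1 - t) * V a + t * V b - \<alpha> / 2 * t * (1 - t) * (norm (b - a))\<^sup>2"
    and "V b \<ge> V a + gradV a \<bullet> (b - a) + \<alpha> / 2 * (norm (b - a))\<^sup>2"
proof -
  define N where "N = (norm (b - a))\<^sup>2"
  define l where "l t = a + t *\<^sub>R (b - a)" for t
  define g where "g t = V (l t) - \<alpha> / 2 * N * t\<^sup>2" for t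
  define g' where "g' t = gradV (l t) \<bullet> (b - a) - \<alpha> * N * t" for t
  have l: "(l has_derivative (\<lambda>h. h *\<^sub>R (b - a))) (at t)" for t
    unfolding l_def by (auto intro!: derivative_eq_intros)
  have g1: "DERIV g t :> g' t" for t
  proof -
    have "((\<lambda>t. V (l t)) has_derivative (\<lambda>h. gradV (l t) \<bullet> (h *\<^sub>R (b - a)))) (at t)"
      using has_derivative_compose[OF l grad] by simp
    then have "((\<lambda>t. V (l t)) has_real_derivative gradV (l t) \<bullet> (b - a)) (at t)"
      by (simp add: has_field_derivative_def mult.commute mult_commute_abs)
    then show ?thesis unfolding g_def g'_def by (auto intro!: derivative_eq_intros)
  qed
  have g2: "DERIV g' t :> (b - a) \<bullet> (HessV (l t) *v (b - a)) - \<alpha> * N" for t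
  proof -
    have "((\<lambda>t. gradV (l t)) has_derivative (\<lambda>h. HessV (l t) *v (h *\<^sub>R (b - a)))) (at t)"
      using has_derivative_compose[OF l hess] by simp
    then have "((\<lambda>t. gradV (l t) \<bullet> (b - a)) has_derivative (\<lambda>h. (HessV (l t) *v (h *\<^sub>R (b - a))) \<bullet> (b - a))) (at t)"
      by (rule has_derivative_inner_left)
    then have "((\<lambda>t. gradV (l t) \<bullet> (b - a)) has_real_derivative (b - a) \<bullet> (HessV (l t) *v (b - a))) (at t)"
      by (simp add: has_field_derivative_def mult.commute mult_commute_abs matrix_vector_mult_scaleR inner_commute)
    then show ?thesis unfolding g'_def by (auto intro!: derivative_eq_intros)
  qed
  have conv: "convex_on UNIV g"
    by (rule f''_ge0_imp_convex[OF _ g1 g2]) (use sc in \<open>auto simp: N_def\<close>)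
  show "V ((1 - t) *\<^sub>R a + t *\<^sub>R b) \<le> (1 - t) * V a + t * V b - \<alpha> / 2 * t * (1 - t) * (norm (b - a))\<^sup>2"
    if "0 \<le> t" "t \<le> 1"
  proof -
    have "g ((1 - t) *\<^sub>R 0 + t *\<^sub>R 1) \<le> (1 - t) * g 0 + t * g 1"
      using that by (intro convex_onD[OF conv]) auto
    then have "V (l t) \<le> (1 - t) * V (l 0) + t * V (l 1) - \<alpha> / 2 * t * (1 - t) * N"
      by (simp add: g_def algebra_simps power2_eq_square diff_divide_distrib)
    moreover have "l t = (1 - t) *\<^sub>R a + t *\<^sub>R b" "l 0 = a" "l 1 = b" by (auto simp: l_def algebra_simps)
    ultimately show ?thesis by (simp add: N_def)
  qed
  have "g 1 - g 0 \<ge> g' 0 * (1 - 0)"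
    by (rule convex_on_imp_above_tangent[OF conv]) (use g1[of 0] in auto)
  then show "V b \<ge> V a + gradV a \<bullet> (b - a) + \<alpha> / 2 * (norm (b - a))\<^sup>2"
    by (simp add: g_def g'_def l_def N_def)
qed

section \<open>Star maps and their subderivatives\<close>

definition starmap :: "'n \<Rightarrow> ('n \<Rightarrow> real \<Rightarrow> real \<Rightarrow> real) \<Rightarrow> real ^ 'n \<Rightarrow> real ^ 'n" where
  "starmap i1 S x = (\<chi> i. S i (x $ i1) (x $ i))"

text \<open>The second argument of \<open>S i\<close> is the source coordinate \<open>x\<^sub>1\<close> rather than its image under \<open>T\<^sub>1\<close>;
  since \<open>T\<^sub>1\<close> is injective this describes the same class of maps. For \<open>i = i1\<close> it is a dummy.\<close>
definition star_family :: "'n \<Rightarrow> ('n \<Rightarrow> real \<Rightarrow> real \<Rightarrow> real) \<Rightarrow> bool" where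
  "star_family i1 S \<longleftrightarrow> (\<forall>i. case_prod (S i) \<in> borel_measurable (borel \<Otimes>\<^sub>M borel)) \<and>
     (\<forall>p q. S i1 p = S i1 q) \<and> (\<forall>i p. strict_mono (S i p))"

lemma starmap_nth[simp]: "starmap i1 S x $ i = S i (x $ i1) (x $ i)"
  by (simp add: starmap_def)

lemma borel_measurable_coords:
  assumes "case_prod f \<in> borel_measurable (borel \<Otimes>\<^sub>M borel)"
  shows "(\<lambda>x::real^'n. f (x $ i) (x $ j)) \<in> borel_measurable borel"
  using measurable_compose[OF _ assms, of "\<lambda>x::real^'n. (x $ i, x $ j)" borel] by simp

lemma borel_measurable_section:
  assumes "case_prod f \<in> borel_measurable (borel \<Otimes>\<^sub>M borel)"
  shows "f p \<in> borel_measurable borel"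
  using measurable_compose[OF _ assms, of "\<lambda>u. (p, u)" borel] by simp

lemma borel_measurable_starmap:
  assumes "\<And>i. case_prod (S i) \<in> borel_measurable (borel \<Otimes>\<^sub>M borel)"
  shows "starmap i1 S \<in> borel_measurable (borel :: (real^'n) measure)"
  unfolding starmap_def by (intro measurable_vec_lambda borel_measurable_coords assms)

lemma T_star_iff: "T \<in> T_star i1 \<longleftrightarrow> (\<exists>S. star_family i1 S \<and> T = starmap i1 (S :: 'n::finite \<Rightarrow> real \<Rightarrow> real \<Rightarrow> real))"
proof
  assume "T \<in> T_star i1"
  then obtain T1 G where T[measurable]: "T \<in> borel_measurable borel" and T1: "strict_mono T1"
    and G: "\<And>i z1. i \<noteq> i1 \<Longrightarrow> strict_mono (\<lambda>s. G i s z1)"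
    and T_eq: "\<And>x. T x = (\<chi> i. if i = i1 then T1 (x $ i1) else G i (x $ i) (T1 (x $ i1)))"
    unfolding T_star_def star_sep_def by blast
  \<comment> \<open>Measurability is given for \<open>T\<close> as a whole, not for its conditional
    maps. Reading \<open>S i\<close> off \<open>T\<close> at the vector with \<open>u\<close> in
    coordinate \<open>i\<close> and \<open>p\<close> in all others makes it jointly
    measurable.\<close>
  define S where "S i p u = T (\<chi> j. if j = i then u else p) $ i" for i p u
  have S: "S i p u = (if i = i1 then T1 u else G i u (T1 p))" for i p u
    by (simp add: S_def T_eq)
  have "case_prod (S i) \<in> borel_measurable (borel \<Otimes>\<^sub>M borel)" for i
  proof -
    have "(\<lambda>x. (\<chi> j. if j = i then snd x else fst x) :: real^'n) \<in> borel_measurable (borel \<Otimes>\<^sub>M borel)"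
      by (intro measurable_vec_lambda) auto
    from measurable_compose[OF measurable_compose[OF this T] borel_measurable_nth[of i]]
    show ?thesis by (simp add: S_def case_prod_unfold)
  qed
  moreover have "strict_mono (S i p)" for i p
    using T1 G[of i "T1 p"] by (auto simp: S strict_mono_def)
  moreover have "S i1 p = S i1 q" for p q by (simp add: S fun_eq_iff)
  moreover have "T = starmap i1 S" by (auto simp: fun_eq_iff vec_eq_iff S T_eq)
  ultimately show "\<exists>S. star_family i1 S \<and> T = starmap i1 S" unfolding star_family_def by blast
next
  assume "\<exists>S. star_family i1 S \<and> T = starmap i1 S"
  then obtain S where S: "\<And>i. case_prod (S i) \<in> borel_measurable (borel \<Otimes>\<^sub>M borel)"
     "\<And>p q. S i1 p = S i1 q" "\<And>i p. strict_mono (S i p)" and T: "T = starmap i1 S"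
    unfolding star_family_def by blast
  define T1 where "T1 = S i1 0"
  have T1: "strict_mono T1" by (simp add: T1_def S)
  then have "inj T1" by (rule strict_mono_imp_inj_on)
  \<comment> \<open>\<open>inv T1\<close> recovers the source coordinate from its image. Off the
    range of \<open>T1\<close> its values are arbitrary, but the sections built from them are still
    strictly increasing, since \<open>S i p\<close> is so for every \<open>p\<close>.\<close>
  then have "T x = (\<chi> i. if i = i1 then T1 (x $ i1) else S i (inv T1 (T1 (x $ i1))) (x $ i))" for x
    using S(2)[of "x $ i1" 0] by (simp add: T vec_eq_iff T1_def)
  moreover have "T \<in> borel_measurable borel" unfolding T by (rule borel_measurable_starmap[OF S(1)])
  ultimately show "T \<in> T_star i1"
    unfolding T_star_def star_sep_def using T1 S(3)
    by (intro CollectI conjI exI[of _ T1] exI[of _ "\<lambda>i s z. S i (inv T1 z) s"]) (auto simp: strict_mono_def)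
qed

text \<open>\<open>D\<close> is a substitute for the partial derivatives \<open>\<partial>\<^sub>i T\<^sub>i\<close> that is stable under convex combinations
  and under almost everywhere limits; it spares the differentiation theory of monotone functions.\<close>
definition subderivative :: "'n \<Rightarrow> ('n \<Rightarrow> real \<Rightarrow> real \<Rightarrow> real) \<Rightarrow> ('n \<Rightarrow> real \<Rightarrow> real \<Rightarrow> real) \<Rightarrow> bool" where
  "subderivative i1 S D \<longleftrightarrow> (\<forall>i. case_prod (D i) \<in> borel_measurable (borel \<Otimes>\<^sub>M borel)) \<and>
     (\<forall>p q. D i1 p = D i1 q) \<and> (\<forall>i p u. 0 \<le> D i p u) \<and>
     (\<forall>i. AE p in stdn. AE u in stdn. 0 < D i p u) \<and>
     (\<forall>i. AE p in stdn. \<forall>u v. u < v \<longrightarrow>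
        (\<integral>\<^sup>+w. ennreal (D i p w) * indicator {u<..<v} w \<partial>lborel) \<le> ennreal (S i p v - S i p u))"

text \<open>A change of variables with the product of the \<open>D i\<close> as Jacobian
  determinant. Triangularity allows Tonelli: for fixed \<open>p = x $ i1\<close> the other
  coordinates are mapped independently of each other and are pushed first, which replaces
  \<open>h\<close> by its integral \<open>H\<close> at \<open>S i1 0 p\<close>; the coordinate
  \<open>i1\<close> is pushed last.\<close>

lemma nn_integral_starmap_le:
  fixes h :: "real ^ 'n \<Rightarrow> ennreal"
  assumes S: "star_family i1 S" and D: "subderivative i1 S D" and h[measurable]: "h \<in> borel_measurable borel"
  shows "(\<integral>\<^sup>+x. h (starmap i1 S x) * ennreal (\<Prod>i\<in>UNIV. D i (x $ i1) (x $ i)) \<partial>lborel) \<le> (\<integral>\<^sup>+z. h z \<partial>lborel)"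
proof -
  note Sm = S[unfolded star_family_def, THEN conjunct1, rule_format]
  note Dm = D[unfolded subderivative_def, THEN conjunct1, rule_format]
  have S1: "S i1 p = S i1 0" for p using S by (auto simp: star_family_def)
  have D1: "D i1 p = D i1 0" for p using D by (auto simp: subderivative_def)
  have D0: "0 \<le> D i p u" for i p u using D by (auto simp: subderivative_def)
  have mono: "strict_mono (S i p)" for i p using S by (auto simp: star_family_def)
  have ineq: "AE p in lborel. \<forall>u v. u < v \<longrightarrow>
        (\<integral>\<^sup>+w. ennreal (D i p w) * indicator {u<..<v} w \<partial>lborel) \<le> ennreal (S i p v - S i p u)" for i
    using D by (auto simp: subderivative_def AE_stdn_iff)
  have push: "(\<integral>\<^sup>+u. k (S i p u) * ennreal (D i p u) \<partial>lborel) \<le> (\<integral>\<^sup>+z. k z \<partial>lborel)"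
    if "\<forall>u v. u < v \<longrightarrow> (\<integral>\<^sup>+w. ennreal (D i p w) * indicator {u<..<v} w \<partial>lborel) \<le> ennreal (S i p v - S i p u)"
      "k \<in> borel_measurable borel" for k i p
    by (rule nn_integral_push_le) (use that mono borel_measurable_section[OF Sm] borel_measurable_section[OF Dm] in auto)
  have Smeas[measurable]: "starmap i1 S \<in> borel_measurable borel"
    by (rule borel_measurable_starmap[OF Sm])
  have Dmeas[measurable]: "(\<lambda>x::real^'n. D i (x $ i1) (x $ i)) \<in> borel_measurable borel" for i
    by (rule borel_measurable_coords[OF Dm])
  let ?I = "UNIV - {i1}"
  let ?P = "PiM ?I (\<lambda>_. lborel :: real measure)"
  define H where "H z = (\<integral>\<^sup>+y. h (vec_lambda (y(i1 := z))) \<partial>?P)" for z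
  interpret product_sigma_finite "\<lambda>_::'n. lborel::real measure" ..
  interpret P: finite_product_sigma_finite "\<lambda>_::'n. lborel::real measure" ?I by standard simp
  have upd: "(\<lambda>(z, y). vec_lambda (y(i1 := z)) :: real^'n) \<in> borel_measurable (lborel \<Otimes>\<^sub>M ?P)"
    unfolding case_prod_unfold
  proof (rule measurable_vec_lambda)
    fix i
    show "(\<lambda>x. ((snd x)(i1 := fst x)) i) \<in> borel_measurable (lborel \<Otimes>\<^sub>M ?P)"
      by (cases "i = i1") (auto intro!: measurable_compose[OF measurable_snd] measurable_component_singleton[of i ?I "\<lambda>_. lborel", simplified])
  qed
  have hupd: "(\<lambda>(z, y). h (vec_lambda (y(i1 := z)))) \<in> borel_measurable (lborel \<Otimes>\<^sub>M ?P)"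
    using measurable_compose[OF upd h] by (simp add: case_prod_unfold)
  have H[measurable]: "H \<in> borel_measurable borel"
    unfolding H_def using P.borel_measurable_nn_integral[OF hupd] by simp
  have "(\<integral>\<^sup>+x. h (starmap i1 S x) * ennreal (\<Prod>i\<in>UNIV. D i (x $ i1) (x $ i)) \<partial>lborel)
     = (\<integral>\<^sup>+p. \<integral>\<^sup>+y. h (starmap i1 S (vec_lambda (y(i1 := p)))) *
          ennreal (\<Prod>i\<in>UNIV. D i p ((y(i1 := p)) i)) \<partial>?P \<partial>lborel)"
    unfolding lborel_eq_vecM by (subst nn_integral_vecM_split[where ?i1.0=i1]) (auto intro: lborel.sigma_finite_measure_axioms)
  also have "\<dots> \<le> (\<integral>\<^sup>+p. H (S i1 0 p) * ennreal (D i1 0 p) \<partial>lborel)"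
  proof (rule nn_integral_mono_AE)
    have "AE p in lborel. \<forall>i. \<forall>u v. u < v \<longrightarrow>
        (\<integral>\<^sup>+w. ennreal (D i p w) * indicator {u<..<v} w \<partial>lborel) \<le> ennreal (S i p v - S i p u)"
      using ineq by (simp add: AE_all_countable)
    then show "AE p in lborel. (\<integral>\<^sup>+y. h (starmap i1 S (vec_lambda (y(i1 := p)))) *
          ennreal (\<Prod>i\<in>UNIV. D i p ((y(i1 := p)) i)) \<partial>?P) \<le> H (S i1 0 p) * ennreal (D i1 0 p)"
    proof eventually_elim
      case (elim p)
      let ?h = "\<lambda>w. h (vec_lambda (w(i1 := S i1 0 p)))"
      have hm: "?h \<in> borel_measurable ?P"
        using measurable_compose[OF measurable_Pair1' hupd, of "S i1 0 p"] by simp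
      have sm: "(\<lambda>x. \<lambda>j\<in>?I. S j p (x j)) \<in> measurable ?P ?P"
        by (rule measurable_restrict)
           (auto intro!: measurable_compose[OF measurable_component_singleton] borel_measurable_section[OF Sm])
      have dm: "(\<lambda>x. \<Prod>j\<in>?I. ennreal (D j p (x j))) \<in> borel_measurable ?P"
        by (intro borel_measurable_prod_ennreal measurable_compose[OF _ measurable_ennreal]
          measurable_compose[OF measurable_component_singleton] borel_measurable_section[OF Dm, simplified measurable_lborel2[symmetric]])
      have "(\<integral>\<^sup>+y. h (starmap i1 S (vec_lambda (y(i1 := p)))) * ennreal (\<Prod>i\<in>UNIV. D i p ((y(i1 := p)) i)) \<partial>?P)
         = (\<integral>\<^sup>+y. ?h (\<lambda>j\<in>?I. S j p (y j)) * (\<Prod>j\<in>?I. ennreal (D j p (y j))) * ennreal (D i1 0 p) \<partial>?P)"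
      proof (intro nn_integral_cong)
        fix y
        have 1: "starmap i1 S (vec_lambda (y(i1 := p))) = vec_lambda ((\<lambda>j\<in>?I. S j p (y j))(i1 := S i1 0 p))"
          using S1[of p] by (auto simp: vec_eq_iff)
        have 2: "ennreal (\<Prod>i\<in>UNIV. D i p ((y(i1 := p)) i)) = (\<Prod>j\<in>?I. ennreal (D j p (y j))) * ennreal (D i1 0 p)"
          by (subst prod_eq_insert_UNIV[of _ i1])
             (auto simp: D1[of p] D0 ennreal_mult' prod_ennreal prod_nonneg mult.commute intro!: arg_cong2[where f="(*)"] prod.cong)
        show "h (starmap i1 S (vec_lambda (y(i1 := p)))) * ennreal (\<Prod>i\<in>UNIV. D i p ((y(i1 := p)) i))
          = ?h (\<lambda>j\<in>?I. S j p (y j)) * (\<Prod>j\<in>?I. ennreal (D j p (y j))) * ennreal (D i1 0 p)"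
          unfolding 1 2 by (simp add: mult.assoc)
      qed
      also have "\<dots> = (\<integral>\<^sup>+y. ?h (\<lambda>j\<in>?I. S j p (y j)) * (\<Prod>j\<in>?I. ennreal (D j p (y j))) \<partial>?P) * ennreal (D i1 0 p)"
        using measurable_compose[OF sm hm] dm by (intro nn_integral_multc borel_measurable_times_ennreal) auto
      also have "\<dots> \<le> H (S i1 0 p) * ennreal (D i1 0 p)"
        unfolding H_def
        by (intro mult_right_mono nn_integral_PiM_push_le hm push[OF spec[OF elim]] borel_measurable_section[OF Dm] borel_measurable_section[OF Sm]) auto
      finally show ?case .
    qed
  qed
  also have "\<dots> \<le> (\<integral>\<^sup>+z. H z \<partial>lborel)"
  proof (rule push)
    \<comment> \<open>At \<open>i1\<close> nothing depends on the dummy argument, so a single good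
      \<open>p\<close> yields the inequality for the argument 0.\<close>
    have "\<exists>p. \<forall>u v. u < v \<longrightarrow> (\<integral>\<^sup>+w. ennreal (D i1 p w) * indicator {u<..<v} w \<partial>lborel) \<le> ennreal (S i1 p v - S i1 p u)"
      using ineq[of i1] by (rule eventually_happens'[rotated]) (simp add: ae_filter_eq_bot_iff)
    then show "\<forall>u v. u < v \<longrightarrow> (\<integral>\<^sup>+w. ennreal (D i1 0 w) * indicator {u<..<v} w \<partial>lborel) \<le> ennreal (S i1 0 v - S i1 0 u)"
      using S1 D1 by metis
  qed measurable
  also have "\<dots> = (\<integral>\<^sup>+z. h z \<partial>lborel)"
    unfolding H_def lborel_eq_vecM
    by (subst nn_integral_vecM_split[where ?i1.0=i1]) (auto intro: lborel.sigma_finite_measure_axioms)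
  finally show ?thesis .
qed

section \<open>Strongly log-concave targets\<close>

lemma nn_integral_prod_vecM:
  assumes M: "sigma_finite_measure M" "sets M = sets borel"
    and f: "\<And>i. f i \<in> borel_measurable borel"
  shows "(\<integral>\<^sup>+x. (\<Prod>i\<in>UNIV. f i ((x::real^'n) $ i)) \<partial>vecM M) = (\<Prod>i\<in>UNIV. \<integral>\<^sup>+u. f i u \<partial>M)"
proof -
  interpret M: sigma_finite_measure M by fact
  interpret product_sigma_finite "\<lambda>_::'n. M" by standard
  have "(\<lambda>x::real^'n. \<Prod>i\<in>UNIV. f i (x $ i)) \<in> borel_measurable borel"
    by (intro borel_measurable_prod_ennreal measurable_compose[OF borel_measurable_nth f])
  then have "(\<integral>\<^sup>+x. (\<Prod>i\<in>UNIV. f i ((x::real^'n) $ i)) \<partial>vecM M) = (\<integral>\<^sup>+y. (\<Prod>i\<in>UNIV. f i (y i)) \<partial>PiM UNIV (\<lambda>_::'n. M))"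
    by (subst nn_integral_vecM[OF M(2)]) auto
  also have "\<dots> = (\<Prod>i\<in>UNIV. \<integral>\<^sup>+u. f i u \<partial>M)"
    by (rule product_nn_integral_prod) (use f M(2) in \<open>auto cong: measurable_cong_sets\<close>)
  finally show ?thesis .
qed

lemma integrable_exp_neg_square:
  fixes a :: real assumes "0 < a"
  shows "integrable lborel (\<lambda>u::real. exp (- a * u\<^sup>2))"
proof -
  define s where "s = sqrt (1 / (2 * a))"
  have s: "0 < s" "s\<^sup>2 = 1 / (2 * a)" using assms by (auto simp: s_def)
  have "exp (- a * u\<^sup>2) = sqrt (2 * pi * s\<^sup>2) * normal_density 0 s u" for u
    using s assms by (simp add: normal_density_def)
  moreover have "integrable lborel (\<lambda>u. sqrt (2 * pi * s\<^sup>2) * normal_density 0 s u)"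
    using integrable_normal_density[OF s(1)] by simp
  ultimately show ?thesis by simp
qed

lemma norm_vec_square: "(norm (x::real^'n))\<^sup>2 = (\<Sum>i\<in>UNIV. (x $ i)\<^sup>2)"
  unfolding norm_vec_def L2_set_def by (simp add: sum_nonneg)

lemma exp_norm_square: "exp (a * (norm (x::real^'n))\<^sup>2) = (\<Prod>i\<in>UNIV. exp (a * (x $ i)\<^sup>2))"
  by (simp add: norm_vec_square sum_distrib_left exp_sum)

text \<open>The Hessian enters only through the chord inequality and a quadratic lower bound. In the
  latter, \<open>\<alpha> / 4\<close> in place of \<open>\<alpha> / 2\<close> leaves room to absorb
  the linear term of the expansion at 0.\<close>

locale strong_potential =
  fixes V :: "real ^ 'n \<Rightarrow> real" and \<alpha> :: real
  assumes growth: "\<And>c2. 0 < c2 \<Longrightarrow> \<exists>c1>0. \<forall>z. \<bar>V z\<bar> \<le> c1 * exp (c2 * (norm z)\<^sup>2)"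
    and V_cont: "continuous_on UNIV V"
    and alpha_pos: "0 < \<alpha>"
    and V_conv: "\<And>a b t. 0 \<le> t \<Longrightarrow> t \<le> 1 \<Longrightarrow>
      V ((1 - t) *\<^sub>R a + t *\<^sub>R b) \<le> (1 - t) * V a + t * V b - \<alpha> / 2 * t * (1 - t) * (norm (b - a))\<^sup>2"
    and V_lower: "\<exists>c. \<forall>z. c + \<alpha> / 4 * (norm z)\<^sup>2 \<le> V z"
begin

lemma V_borel[measurable]: "V \<in> borel_measurable borel"
  by (rule borel_measurable_continuous_onI[OF V_cont])

lemma integrable_exp_V: "integrable lborel (\<lambda>z. exp (- V z))"
proof -
  obtain c where c: "\<And>z. c + \<alpha> / 4 * (norm z)\<^sup>2 \<le> V z" using V_lower by blast
  have 1: "(\<integral>\<^sup>+u. ennreal (exp (- (\<alpha> / 4) * (u::real)\<^sup>2)) \<partial>lborel) < \<infinity>"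
    using integrable_exp_neg_square[of "\<alpha> / 4"] alpha_pos
    by (auto simp: integrable_iff_bounded)
  have "(\<integral>\<^sup>+z. ennreal (exp (- V z)) \<partial>lborel) \<le> (\<integral>\<^sup>+z. ennreal (exp (- c)) * (\<Prod>i\<in>UNIV. ennreal (exp (- (\<alpha> / 4) * ((z::real^'n) $ i)\<^sup>2))) \<partial>lborel)"
  proof (intro nn_integral_mono)
    fix z :: "real^'n"
    have "exp (- V z) \<le> exp (- c + - (\<alpha> / 4) * (norm z)\<^sup>2)" using c[of z] by simp
    also have "\<dots> = exp (- c) * (\<Prod>i\<in>UNIV. exp (- (\<alpha> / 4) * (z $ i)\<^sup>2))"
      unfolding exp_add exp_norm_square ..
    finally show "ennreal (exp (- V z)) \<le> ennreal (exp (- c)) * (\<Prod>i\<in>UNIV. ennreal (exp (- (\<alpha> / 4) * (z $ i)\<^sup>2)))"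
      by (simp add: prod_ennreal ennreal_mult'[symmetric] prod_nonneg)
  qed
  also have "\<dots> = ennreal (exp (- c)) * (\<integral>\<^sup>+z. (\<Prod>i\<in>UNIV. ennreal (exp (- (\<alpha> / 4) * ((z::real^'n) $ i)\<^sup>2))) \<partial>vecM lborel)"
    unfolding lborel_eq_vecM by (rule nn_integral_cmult) measurable
  also have "\<dots> = ennreal (exp (- c)) * (\<Prod>i\<in>(UNIV::'n set). \<integral>\<^sup>+u. ennreal (exp (- (\<alpha> / 4) * (u::real)\<^sup>2)) \<partial>lborel)"
    by (subst nn_integral_prod_vecM) (auto intro: lborel.sigma_finite_measure_axioms)
  also have "\<dots> < \<infinity>" using 1 by (simp add: ennreal_mult_less_top ennreal_prod_eq_top power_less_top_ennreal)
  finally show ?thesis by (intro integrableI_nonneg) auto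
qed

definition Z :: real where "Z = (\<integral>z. exp (- V z) \<partial>lborel)"

lemma Z_pos: "0 < Z"
proof -
  have "Z \<noteq> 0"
  proof
    assume "Z = 0"
    then have "AE z in lborel. exp (- V z) = 0"
      unfolding Z_def using integral_nonneg_eq_0_iff_AE[OF integrable_exp_V] by simp
    then have "AE z in (lborel :: (real^'n) measure). False" by simp
    then show False using ae_filter_eq_bot_iff[of "lborel :: (real^'n) measure"]
      by (simp add: trivial_limit_def)
  qed
  moreover have "0 \<le> Z" unfolding Z_def by simp
  ultimately show ?thesis by simp
qed

definition pdens :: "real^'n \<Rightarrow> real" where "pdens z = exp (- V z) / Z"

lemma pdens_pos: "0 < pdens z" using Z_pos by (simp add: pdens_def)

lemma pdens_borel[measurable]: "pdens \<in> borel_measurable borel"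
  unfolding pdens_def by measurable

lemma target_eq: "target V = density lborel (\<lambda>z. ennreal (pdens z))"
  by (simp add: target_def pdens_def Z_def)

lemma sets_target[simp, measurable_cong]: "sets (target V) = sets borel"
  by (simp add: target_eq)

lemma prob_space_target: "prob_space (target V)"
proof
  have "emeasure (target V) (space (target V)) = (\<integral>\<^sup>+z. ennreal (exp (- V z)) / ennreal Z \<partial>lborel)"
    using Z_pos by (simp add: target_eq emeasure_density pdens_def divide_ennreal)
  also have "\<dots> = (\<integral>\<^sup>+z. ennreal (exp (- V z)) \<partial>lborel) / ennreal Z"
    by (rule nn_integral_divide) measurable
  also have "(\<integral>\<^sup>+z. ennreal (exp (- V z)) \<partial>lborel) = ennreal Z"
    unfolding Z_def by (rule nn_integral_eq_integral[OF integrable_exp_V]) simp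
  also have "ennreal Z / ennreal Z = 1" using Z_pos by (simp add: divide_ennreal)
  finally show "emeasure (target V) (space (target V)) = 1" .
qed

lemma null_sets_target: "A \<in> null_sets (target V) \<longleftrightarrow> A \<in> null_sets lborel"
proof (cases "A \<in> sets borel")
  case True
  then show ?thesis
    unfolding target_eq using pdens_pos
    by (subst null_sets_density_iff) (auto simp: AE_iff_null_sets not_le[symmetric] ennreal_eq_0_iff)
qed (auto simp: null_sets_def target_eq)

definition gdens :: "real^'n \<Rightarrow> real" where "gdens x = (\<Prod>i\<in>UNIV. std_normal_density (x $ i))"

lemma gdens_pos: "0 < gdens x" by (simp add: gdens_def prod_pos normal_density_pos)

lemma gdens_borel[measurable]: "gdens \<in> borel_measurable borel"
  unfolding gdens_def by measurable

lemma gauss_eq: "gauss = density lborel (\<lambda>x. ennreal (gdens x))"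
  by (simp add: gauss_def gdens_def)

text \<open>For \<open>D\<close> the genuine partial derivatives, this is the reciprocal of the density of
  \<open>T\<^sub>#\<rho>\<close> with respect to \<open>\<pi>\<close>, evaluated at \<open>T x\<close>.\<close>
definition subdens :: "'n \<Rightarrow> ('n \<Rightarrow> real \<Rightarrow> real \<Rightarrow> real) \<Rightarrow> ('n \<Rightarrow> real \<Rightarrow> real \<Rightarrow> real) \<Rightarrow> real^'n \<Rightarrow> real" where
  "subdens i1 S D x = (\<Prod>i\<in>UNIV. D i (x $ i1) (x $ i)) * pdens (starmap i1 S x) / gdens x"

lemma subdens_borel:
  assumes S: "star_family i1 S" and D: "subderivative i1 S D"
  shows "subdens i1 S D \<in> borel_measurable borel"
proof -
  have [measurable]: "starmap i1 S \<in> borel_measurable borel"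
    using S by (intro borel_measurable_starmap) (auto simp: star_family_def)
  have [measurable]: "(\<lambda>x::real^'n. D i (x $ i1) (x $ i)) \<in> borel_measurable borel" for i
    using D by (intro borel_measurable_coords) (auto simp: subderivative_def)
  show ?thesis unfolding subdens_def by measurable
qed

lemma subdens_nonneg: "subderivative i1 S D \<Longrightarrow> 0 \<le> subdens i1 S D x"
  unfolding subdens_def subderivative_def
  by (intro divide_nonneg_pos mult_nonneg_nonneg prod_nonneg) (auto intro: less_imp_le pdens_pos gdens_pos)

lemma AE_subderivative_pos:
  fixes S D :: "'n \<Rightarrow> real \<Rightarrow> real \<Rightarrow> real"
  assumes D: "subderivative i1 S D"
  shows "AE x::real^'n in gauss. \<forall>i. 0 < D i (x $ i1) (x $ i)"
proof -
  have "AE x::real^'n in gauss. 0 < D i (x $ i1) (x $ i)" for i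
  proof (subst AE_gauss_coord_iff)
    have [measurable]: "case_prod (D i) \<in> borel_measurable (borel \<Otimes>\<^sub>M borel)"
      using D by (simp add: subderivative_def)
    have "Measurable.pred (borel \<Otimes>\<^sub>M borel) (\<lambda>z. 0 < case_prod (D i) z)" by measurable
    then show "Measurable.pred (borel \<Otimes>\<^sub>M borel) (\<lambda>(p, u). 0 < D i p u)" by (simp add: case_prod_unfold)
    show "\<forall>p q u. (0 < D i p u) = (0 < D i q u)" if "i = i1"
    proof (intro allI)
      fix p q u
      have "D i1 p = D i1 q" using D by (simp add: subderivative_def)
      then show "(0 < D i p u) = (0 < D i q u)" by (simp add: that)
    qed
    show "AE p in stdn. AE u in stdn. 0 < D i p u" using D by (simp add: subderivative_def)
  qed
  then show ?thesis by (simp add: AE_all_countable)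
qed

lemma AE_subdens_pos:
  assumes "subderivative i1 S D"
  shows "AE x in gauss. 0 < subdens i1 S D x"
  using AE_subderivative_pos[OF assms]
  by eventually_elim (simp add: subdens_def prod_pos pdens_pos gdens_pos)

text \<open>Multiplication by \<open>gdens\<close> cancels the denominator of
  \<open>subdens\<close>, and the factor \<open>pdens (starmap i1 S x)\<close> is taken into the
  test function. So the map pushes \<open>subdens\<close> times \<open>gauss\<close> below the
  target; a constant test function then bounds the mass of \<open>subdens\<close> by 1.\<close>

lemma nn_integral_subdens_le:
  assumes S: "star_family i1 S" and D: "subderivative i1 S D" and h[measurable]: "h \<in> borel_measurable borel"
  shows "(\<integral>\<^sup>+x. h (starmap i1 S x) * ennreal (subdens i1 S D x) \<partial>gauss) \<le> (\<integral>\<^sup>+z. h z \<partial>target V)"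
proof -
  have [measurable]: "starmap i1 S \<in> borel_measurable borel"
    using S by (intro borel_measurable_starmap) (auto simp: star_family_def)
  have [measurable]: "subdens i1 S D \<in> borel_measurable borel" by (rule subdens_borel[OF S D])
  have D0: "0 \<le> D i p u" for i p u using D by (auto simp: subderivative_def)
  have "(\<integral>\<^sup>+x. h (starmap i1 S x) * ennreal (subdens i1 S D x) \<partial>gauss)
     = (\<integral>\<^sup>+x. ennreal (gdens x) * (h (starmap i1 S x) * ennreal (subdens i1 S D x)) \<partial>lborel)"
    unfolding gauss_eq by (subst nn_integral_density) auto
  also have "\<dots> = (\<integral>\<^sup>+x. (h (starmap i1 S x) * ennreal (pdens (starmap i1 S x))) * ennreal (\<Prod>i\<in>UNIV. D i (x $ i1) (x $ i)) \<partial>lborel)"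
  proof (intro nn_integral_cong)
    fix x
    have "gdens x * subdens i1 S D x = pdens (starmap i1 S x) * (\<Prod>i\<in>UNIV. D i (x $ i1) (x $ i))"
      using gdens_pos[of x] by (simp add: subdens_def)
    then have "ennreal (gdens x) * ennreal (subdens i1 S D x) = ennreal (pdens (starmap i1 S x)) * ennreal (\<Prod>i\<in>UNIV. D i (x $ i1) (x $ i))"
      using gdens_pos[of x] pdens_pos[of "starmap i1 S x"] by (simp add: ennreal_mult'[symmetric])
    then show "ennreal (gdens x) * (h (starmap i1 S x) * ennreal (subdens i1 S D x)) =
       (h (starmap i1 S x) * ennreal (pdens (starmap i1 S x))) * ennreal (\<Prod>i\<in>UNIV. D i (x $ i1) (x $ i))"
      unfolding mult.left_commute[of "ennreal (gdens x)"] mult.assoc by simp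
  qed
  also have "\<dots> \<le> (\<integral>\<^sup>+z. h z * ennreal (pdens z) \<partial>lborel)"
    by (rule nn_integral_starmap_le[OF S D]) measurable
  also have "\<dots> = (\<integral>\<^sup>+z. h z \<partial>target V)"
    unfolding target_eq by (subst nn_integral_density) (auto simp: mult.commute)
  finally show ?thesis .
qed

lemma subdens_integrable:
  assumes S: "star_family i1 S" and D: "subderivative i1 S D"
  shows "integrable gauss (subdens i1 S D)" "(\<integral>x. subdens i1 S D x \<partial>gauss) \<le> 1"
proof -
  interpret T: prob_space "target V" by (rule prob_space_target)
  have [measurable]: "subdens i1 S D \<in> borel_measurable borel" by (rule subdens_borel[OF S D])
  have le: "(\<integral>\<^sup>+x. ennreal (subdens i1 S D x) \<partial>gauss) \<le> 1"
    using nn_integral_subdens_le[OF S D, of "\<lambda>_. 1"] T.emeasure_space_1 by simp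
  show int: "integrable gauss (subdens i1 S D)"
    by (rule integrableI_nonneg) (use le subdens_nonneg[OF D] in \<open>auto intro: le_less_trans\<close>)
  have "ennreal (\<integral>x. subdens i1 S D x \<partial>gauss) \<le> 1"
    using nn_integral_eq_integral[OF int] subdens_nonneg[OF D] le by simp
  then show "(\<integral>x. subdens i1 S D x \<partial>gauss) \<le> 1" by (simp add: ennreal_le_1)
qed

lemma prob_space_distr_gauss:
  "T \<in> borel_measurable borel \<Longrightarrow> prob_space (distr gauss borel (T :: real^'n \<Rightarrow> real^'n))"
  by (rule gauss.prob_space_distr) (simp cong: measurable_cong_sets)

text \<open>With \<open>q\<close> the density of the law relative to the target and
  \<open>r = subdens\<close>, integrate \<open>ln y \<le> y - 1\<close> at
  \<open>y = q (T x) * r x\<close>. The integral of \<open>y\<close> is at most the total mass 1 of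
  \<open>q\<close>, because the map pushes \<open>r\<close> times \<open>gauss\<close> below the
  target. The same inequality bounds the positive part of \<open>ln q\<close>; the negative part is
  always integrable.\<close>

lemma KL_le_subdens:
  assumes S: "star_family i1 S" and D: "subderivative i1 S D"
    and int: "integrable gauss (\<lambda>x. ln (subdens i1 S D x))"
  shows "KL (distr gauss borel (starmap i1 S)) (target V) \<le> ereal (- (\<integral>x. ln (subdens i1 S D x) \<partial>gauss))"
proof -
  let ?T = "starmap i1 S" and ?r = "subdens i1 S D" and ?M = "target V"
  define N where "N = distr gauss borel ?T"
  interpret M: prob_space "target V" by (rule prob_space_target)
  have T[measurable]: "?T \<in> borel_measurable borel"
    using S by (intro borel_measurable_starmap) (auto simp: star_family_def)
  have [measurable]: "?T \<in> measurable gauss borel" by simp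
  have r[measurable]: "?r \<in> borel_measurable borel" by (rule subdens_borel[OF S D])
  have setsN[simp, measurable_cong]: "sets N = sets borel" by (simp add: N_def)
  interpret N: prob_space N unfolding N_def by (rule prob_space_distr_gauss[OF T])
  have ac: "absolutely_continuous ?M N"
    unfolding absolutely_continuous_def
  proof
    fix A assume A: "A \<in> null_sets ?M"
    then have [measurable]: "A \<in> sets borel" by (auto simp: null_sets_def)
    have "(\<integral>\<^sup>+x. indicator A (?T x) * ennreal (?r x) \<partial>gauss) \<le> (\<integral>\<^sup>+z. indicator A z \<partial>?M)"
      by (rule nn_integral_subdens_le[OF S D]) measurable
    also have "\<dots> = 0" using A by (simp add: null_sets_def)
    \<comment> \<open>As \<open>r\<close> is positive almost everywhere, it cannot vanish on a
      preimage of positive measure; this is how an inequality between measures yields absolute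
      continuity.\<close>
    finally have "AE x in gauss. indicator A (?T x) * ennreal (?r x) = 0"
      by (subst nn_integral_0_iff_AE[symmetric]) auto
    then have "AE x in gauss. ?T x \<notin> A"
      using AE_subdens_pos[OF D] by eventually_elim (auto simp: indicator_def split: if_splits)
    then have "AE z in N. z \<notin> A" unfolding N_def by (subst AE_distr_iff) auto
    then show "A \<in> null_sets N" by (subst AE_iff_null_sets) auto
  qed
  define q where "q z = enn2real (RN_deriv ?M N z)" for z
  have q[measurable]: "q \<in> borel_measurable borel"
    unfolding q_def using borel_measurable_RN_deriv[of ?M N] by simp
  have q0: "0 \<le> q z" for z by (simp add: q_def)
  have N_eq: "N = density ?M (\<lambda>z. ennreal (q z))"
  proof -
    have "N = density ?M (RN_deriv ?M N)" by (rule M.density_RN_deriv[OF ac, symmetric]) simp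
    also have "\<dots> = density ?M (\<lambda>z. ennreal (q z))"
    proof (rule density_cong)
      show "AE z in ?M. RN_deriv ?M N z = ennreal (q z)"
        using M.RN_deriv_finite[OF N.sigma_finite_measure_axioms ac] by (auto simp: q_def less_top[symmetric])
    qed auto
    finally show ?thesis .
  qed
  have qpos: "AE x in gauss. 0 < q (?T x)"
  proof -
    have "AE z in N. 0 < q z" unfolding N_eq by (subst AE_density) (auto simp: less_le q0)
    then show ?thesis unfolding N_def by (subst (asm) AE_distr_iff) auto
  qed
  have qr: "(\<integral>\<^sup>+x. ennreal (q (?T x) * ?r x) \<partial>gauss) \<le> 1"
  proof -
    have "(\<integral>\<^sup>+x. ennreal (q (?T x) * ?r x) \<partial>gauss) = (\<integral>\<^sup>+x. ennreal (q (?T x)) * ennreal (?r x) \<partial>gauss)"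
      by (simp add: ennreal_mult q0 subdens_nonneg[OF D])
    also have "\<dots> \<le> (\<integral>\<^sup>+z. ennreal (q z) \<partial>?M)"
      by (rule nn_integral_subdens_le[OF S D]) measurable
    also have "\<dots> = emeasure (density ?M (\<lambda>z. ennreal (q z))) (space ?M)"
      by (subst emeasure_density) (auto intro!: nn_integral_cong simp: sets_eq_imp_space_eq[OF sets_target])
    also have "\<dots> = emeasure N (space N)"
      using sets_eq_imp_space_eq[OF sets_target] sets_eq_imp_space_eq[OF setsN] by (simp add: N_eq[symmetric])
    finally show ?thesis by (simp add: N.emeasure_space_1)
  qed
  have int_qr: "integrable gauss (\<lambda>x. q (?T x) * ?r x)"
    by (rule integrableI_nonneg) (use qr q0 subdens_nonneg[OF D] in \<open>auto intro: le_less_trans\<close>)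
  have qr_le: "(\<integral>x. q (?T x) * ?r x \<partial>gauss) \<le> 1"
    using nn_integral_eq_integral[OF int_qr] qr q0 subdens_nonneg[OF D] by (simp add: ennreal_le_1)
  have key: "AE x in gauss. ln (q (?T x)) \<le> q (?T x) * ?r x - 1 - ln (?r x)"
    using qpos AE_subdens_pos[OF D]
  proof eventually_elim
    case (elim x)
    then show ?case using ln_le_minus_one[of "q (?T x) * ?r x"] by (simp add: ln_mult)
  qed
  have int_q: "integrable gauss (\<lambda>x. ln (q (?T x)))"
  proof -
    have int': "integrable gauss (\<lambda>x. q (?T x) * ?r x - 1 - ln (?r x))"
      using int int_qr by (intro Bochner_Integration.integrable_diff) auto
    have "(\<integral>\<^sup>+x. ennreal (ln (q (?T x))) \<partial>gauss) \<le> (\<integral>\<^sup>+x. ennreal (q (?T x) * ?r x - 1 - ln (?r x)) \<partial>gauss)"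
      using key by (intro nn_integral_mono_AE) (auto elim!: eventually_mono intro: ennreal_leI)
    also have "\<dots> < \<infinity>" using int' by (auto simp: real_integrable_def less_top[symmetric])
    finally have 1: "(\<integral>\<^sup>+x. ennreal (ln (q (?T x))) \<partial>gauss) \<noteq> \<infinity>" by simp
    have "(\<integral>\<^sup>+z. ennreal (- ln (q z)) \<partial>N) \<noteq> \<infinity>"
      by (rule KL_density(3)[OF prob_space_target N.prob_space_axioms _ q0 N_eq]) simp
    then have "(\<integral>\<^sup>+x. ennreal (- ln (q (?T x))) \<partial>gauss) \<noteq> \<infinity>"
      unfolding N_def by (subst (asm) nn_integral_distr) auto
    with 1 show ?thesis by (simp add: real_integrable_def)
  qed
  then have "integrable N (\<lambda>z. ln (q z))"
    unfolding N_def by (subst integrable_distr_eq) auto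
  then have "KL N ?M = ereal (\<integral>z. ln (q z) \<partial>N)"
    by (rule KL_density(1)[OF prob_space_target N.prob_space_axioms _ q0 N_eq, rotated]) simp
  also have "(\<integral>z. ln (q z) \<partial>N) = (\<integral>x. ln (q (?T x)) \<partial>gauss)"
    unfolding N_def by (subst integral_distr) auto
  also have "\<dots> \<le> (\<integral>x. q (?T x) * ?r x - 1 - ln (?r x) \<partial>gauss)"
    by (rule integral_mono_AE[OF int_q _ key]) (use int int_qr in \<open>intro Bochner_Integration.integrable_diff; auto\<close>)
  also have "\<dots> = (\<integral>x. q (?T x) * ?r x \<partial>gauss) - 1 - (\<integral>x. ln (?r x) \<partial>gauss)"
    using int int_qr gauss.prob_space by (simp add: Bochner_Integration.integral_diff)
  finally have "KL N ?M \<le> ereal ((\<integral>x. q (?T x) * ?r x \<partial>gauss) - 1 - (\<integral>x. ln (?r x) \<partial>gauss))" by simp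
  also have "\<dots> \<le> ereal (- (\<integral>x. ln (?r x) \<partial>gauss))" using qr_le by simp
  finally show ?thesis by (simp add: N_def)
qed

lemma integrable_gauss_V: "integrable gauss V"
proof -
  \<comment> \<open>Any exponent below 1/2 would do: against the Gaussian weight
    \<open>exp (- u\<^sup>2 / 2)\<close>, the factor \<open>exp (u\<^sup>2 / 4)\<close> leaves
    \<open>exp (- u\<^sup>2 / 4)\<close>.\<close>
  obtain c1 where c1: "0 < c1" "\<And>z. \<bar>V z\<bar> \<le> c1 * exp (1/4 * (norm z)\<^sup>2)" using growth[of "1/4"] by auto
  have 1: "(\<integral>\<^sup>+u. ennreal (exp (1/4 * u\<^sup>2)) \<partial>stdn) < \<infinity>"
  proof -
    have "(\<integral>\<^sup>+u. ennreal (exp (1/4 * u\<^sup>2)) \<partial>stdn) = (\<integral>\<^sup>+u. ennreal (1 / sqrt (2 * pi)) * ennreal (exp (- (1/4) * u\<^sup>2)) \<partial>lborel)"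
      by (subst nn_integral_stdn)
         (auto intro!: nn_integral_cong simp: ennreal_mult'[symmetric] std_normal_density_def mult_exp_exp)
    also have "\<dots> = ennreal (1 / sqrt (2 * pi)) * (\<integral>\<^sup>+u. ennreal (exp (- (1/4) * u\<^sup>2)) \<partial>lborel)"
      by (rule nn_integral_cmult) measurable
    also have "\<dots> < \<infinity>"
      using integrable_exp_neg_square[of "1/4"]
      by (auto simp: integrable_iff_bounded ennreal_mult_less_top)
    finally show ?thesis .
  qed
  have "(\<integral>\<^sup>+z. ennreal \<bar>V z\<bar> \<partial>gauss) \<le> (\<integral>\<^sup>+z. ennreal c1 * (\<Prod>i\<in>UNIV. ennreal (exp (1/4 * ((z::real^'n) $ i)\<^sup>2))) \<partial>gauss)"
  proof (intro nn_integral_mono)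
    fix z :: "real^'n"
    show "ennreal \<bar>V z\<bar> \<le> ennreal c1 * (\<Prod>i\<in>UNIV. ennreal (exp (1/4 * (z $ i)\<^sup>2)))"
      using c1(2)[of z] c1(1) unfolding exp_norm_square
      by (simp add: prod_ennreal ennreal_mult'[symmetric] prod_nonneg)
  qed
  also have "\<dots> = ennreal c1 * (\<integral>\<^sup>+z. (\<Prod>i\<in>UNIV. ennreal (exp (1/4 * ((z::real^'n) $ i)\<^sup>2))) \<partial>vecM stdn)"
    unfolding gauss_eq_vecM by (rule nn_integral_cmult) measurable
  also have "\<dots> = ennreal c1 * (\<Prod>i\<in>(UNIV::'n set). \<integral>\<^sup>+u. ennreal (exp (1/4 * u\<^sup>2)) \<partial>stdn)"
    by (subst nn_integral_prod_vecM) (auto intro: stdn.sigma_finite_measure_axioms)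
  also have "\<dots> < \<infinity>" using 1 by (simp add: ennreal_mult_less_top power_less_top_ennreal)
  finally show ?thesis by (auto simp: integrable_iff_bounded)
qed

text \<open>The identity map with derivative 1 is a witness: its entropy bound involves Gaussian
  integrals of \<open>V\<close>, finite by the growth condition, and of squared coordinates. A
  competitor of finite entropy is what a minimizing sequence has to start from.\<close>

lemma exists_finite_KL: "\<exists>T\<in>T_star i1. KL (distr gauss borel T) (target V) \<noteq> \<infinity>"
proof
  define S :: "'n \<Rightarrow> real \<Rightarrow> real \<Rightarrow> real" where "S = (\<lambda>i p u. u)"
  define D :: "'n \<Rightarrow> real \<Rightarrow> real \<Rightarrow> real" where "D = (\<lambda>i p u. 1)"
  have S: "star_family i1 S" by (auto simp: star_family_def S_def strict_mono_def)
  have D: "subderivative i1 S D" by (auto simp: subderivative_def S_def D_def)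
  show "starmap i1 S \<in> T_star i1" using S T_star_iff by blast
  have T: "starmap i1 S x = x" for x by (simp add: vec_eq_iff S_def)
  have sq: "integrable gauss (\<lambda>x::real^'n. (x $ i)\<^sup>2)" for i
  proof -
    have "integrable stdn (\<lambda>u. u\<^sup>2)"
      unfolding stdn_def using integrable_std_normal_moment[of 2]
      by (subst integrable_density) (auto simp: normal_density_nonneg)
    then have "integrable (distr gauss borel (\<lambda>x::real^'n. x $ i)) (\<lambda>u. u\<^sup>2)" by (simp only: distr_gauss_coord)
    then show ?thesis by (subst (asm) integrable_distr_eq) auto
  qed
  have "ln (subdens i1 S D x) = - V x - ln Z + (\<Sum>i\<in>UNIV. (x $ i)\<^sup>2 / 2 - ln (1 / sqrt (2 * pi)))" for x
  proof -
    have "ln (subdens i1 S D x) = ln (pdens x) - ln (gdens x)"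
      using pdens_pos[of x] gdens_pos[of x] by (simp add: subdens_def T D_def ln_div)
    also have "ln (pdens x) = - V x - ln Z" using Z_pos by (simp add: pdens_def ln_div)
    also have "ln (gdens x) = (\<Sum>i\<in>UNIV. ln (std_normal_density (x $ i)))"
      unfolding gdens_def using normal_density_pos[of 1 0] by (intro ln_prod) (auto simp: less_le)
    also have "\<dots> = (\<Sum>i\<in>UNIV. ln (1 / sqrt (2 * pi)) - (x $ i)\<^sup>2 / 2)"
      by (intro sum.cong) (auto simp: std_normal_density_def ln_mult ln_div)
    finally show ?thesis by (simp add: sum_subtractf)
  qed
  moreover have "integrable gauss (\<lambda>x. - V x - ln Z + (\<Sum>i\<in>UNIV. (x $ i)\<^sup>2 / 2 - ln (1 / sqrt (2 * pi))))"
    using integrable_gauss_V sq by (intro Bochner_Integration.integrable_add Bochner_Integration.integrable_diff Bochner_Integration.integrable_sum) auto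
  ultimately have "integrable gauss (\<lambda>x. ln (subdens i1 S D x))" by simp
  from KL_le_subdens[OF S D this] show "KL (distr gauss borel (starmap i1 S)) (target V) \<noteq> \<infinity>" by auto
qed

end

section \<open>Densities of star-structured measures\<close>

text \<open>Conditional laws can be compared on each test set only up to a null set, hence on
  countably many sets at a time; half-lines with rational end points are enough by right
  continuity.\<close>

lemma real_distribution_eqI_rat:
  assumes A: "real_distribution A" and B: "real_distribution B"
    and eq: "\<And>q. q \<in> \<rat> \<Longrightarrow> cdf A q = cdf B q"
  shows "A = B"
proof (rule cdf_unique[OF A B], rule ext)
  have le: "cdf A x \<le> cdf B x" if A: "real_distribution A" and B: "real_distribution B"
    and eq: "\<And>q. q \<in> \<rat> \<Longrightarrow> cdf A q = cdf B q" for A B x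
  proof -
    interpret A: real_distribution A by fact
    interpret B: real_distribution B by fact
    have "(cdf B \<longlongrightarrow> cdf B x) (at_right x)"
      using B.cdf_is_right_cont[of x] by (simp add: continuous_within)
    moreover have "eventually (\<lambda>y. cdf A x \<le> cdf B y) (at_right x)"
      unfolding eventually_at_right_field
    proof (intro exI[of _ "x + 1"] conjI allI impI)
      fix y assume y: "y > x" "y < x + 1"
      obtain q where q: "q \<in> \<rat>" "x < q" "q < y" using Rats_dense_in_real[OF y(1)] by blast
      have "cdf A x \<le> cdf A q" using q by (intro A.cdf_nondecreasing) simp
      also have "\<dots> = cdf B q" by (rule eq) fact
      also have "\<dots> \<le> cdf B y" using q by (intro B.cdf_nondecreasing) simp
      finally show "cdf A x \<le> cdf B y" .
    qed simp
    ultimately show ?thesis by (rule tendsto_lowerbound) simp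
  qed
  show "cdf A x = cdf B x" for x
    using le[OF A B eq] le[OF B A eq[symmetric]] by (rule antisym)
qed

text \<open>A Radon-Nikodym density of the joint law against \<open>M\<close> times Lebesgue measure
  consists of conditional densities: for each Borel \<open>B\<close>, the two candidates for the
  conditional mass of \<open>B\<close> have equal integrals over all \<open>A\<close>, so they agree
  almost everywhere. Letting \<open>B\<close> run through the rational half-lines and the whole line
  costs a single null set.\<close>

lemma kernel_density:
  fixes M :: "real measure" and K :: "real \<Rightarrow> real measure"
  assumes M: "prob_space M" "sets M = sets borel"
    and K: "\<And>z. prob_space (K z)" "\<And>z. sets (K z) = sets borel"
    and Km: "\<And>A. A \<in> sets borel \<Longrightarrow> (\<lambda>z. emeasure (K z) A) \<in> borel_measurable borel"
    and N: "prob_space N" "sets N = sets (borel \<Otimes>\<^sub>M borel)"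
    and NAB: "\<And>A B. A \<in> sets borel \<Longrightarrow> B \<in> sets borel \<Longrightarrow>
      emeasure N (A \<times> B) = (\<integral>\<^sup>+z. indicator A z * emeasure (K z) B \<partial>M)"
    and ac: "absolutely_continuous (M \<Otimes>\<^sub>M lborel) N"
  obtains g :: "real \<Rightarrow> real \<Rightarrow> real" where "case_prod g \<in> borel_measurable (borel \<Otimes>\<^sub>M borel)"
    "\<And>z w. 0 \<le> g z w" "AE z in M. K z = density lborel (\<lambda>w. ennreal (g z w))"
proof -
  note [measurable_cong] = M(2)
  interpret M: prob_space M by fact
  interpret N: prob_space N by fact
  interpret P: pair_sigma_finite M lborel ..
  have setsP: "sets (M \<Otimes>\<^sub>M lborel) = sets (borel \<Otimes>\<^sub>M borel)"
    by (intro sets_pair_measure_cong M) simp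
  have setsN: "sets N = sets (M \<Otimes>\<^sub>M lborel)" by (rule trans[OF N(2) setsP[symmetric]])
  define f where "f = RN_deriv (M \<Otimes>\<^sub>M lborel) N"
  have f[measurable]: "f \<in> borel_measurable (M \<Otimes>\<^sub>M lborel)" by (simp add: f_def)
  have Nf: "N = density (M \<Otimes>\<^sub>M lborel) f"
    unfolding f_def by (rule P.density_RN_deriv[OF ac setsN, symmetric])
  define g where "g z w = enn2real (f (z, w))" for z w
  have gf: "case_prod g = (\<lambda>x. enn2real (f x))" by (auto simp: g_def fun_eq_iff)
  have gP[measurable]: "case_prod g \<in> borel_measurable (M \<Otimes>\<^sub>M lborel)" unfolding gf by measurable
  then have gm: "case_prod g \<in> borel_measurable (borel \<Otimes>\<^sub>M borel)"
    using measurable_cong_sets[OF setsP refl] by blast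
  have Ng: "N = density (M \<Otimes>\<^sub>M lborel) (\<lambda>x. ennreal (case_prod g x))"
  proof -
    have "AE x in M \<Otimes>\<^sub>M lborel. f x \<noteq> \<infinity>"
      unfolding f_def by (rule P.RN_deriv_finite[OF N.sigma_finite_measure_axioms ac setsN])
    then have "AE x in M \<Otimes>\<^sub>M lborel. f x = ennreal (case_prod g x)"
      by eventually_elim (simp add: gf less_top[symmetric])
    then show ?thesis unfolding Nf by (intro density_cong) auto
  qed
  have AE_B: "AE z in M. emeasure (K z) B = (\<integral>\<^sup>+w. ennreal (g z w) * indicator B w \<partial>lborel)"
    if B[measurable]: "B \<in> sets borel" for B
  proof (rule M.density_unique_finite_measure)
    show "(\<lambda>z. emeasure (K z) B) \<in> borel_measurable M" using Km[OF B] by (simp cong: measurable_cong_sets)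
    have m: "(\<lambda>(z, w). ennreal (g z w) * indicator B w) \<in> borel_measurable (M \<Otimes>\<^sub>M lborel)"
      using gP by (auto simp: case_prod_unfold intro!: borel_measurable_times_ennreal)
    show "(\<lambda>z. \<integral>\<^sup>+w. ennreal (g z w) * indicator B w \<partial>lborel) \<in> borel_measurable M"
      using lborel.borel_measurable_nn_integral[OF m] by simp
    fix A assume "A \<in> sets M"
    then have A[measurable]: "A \<in> sets borel" using M by simp
    have AB: "A \<times> B \<in> sets (M \<Otimes>\<^sub>M lborel)" by (intro pair_measureI) (use A B M in auto)
    have "(\<integral>\<^sup>+z. emeasure (K z) B * indicator A z \<partial>M) = emeasure N (A \<times> B)"
      by (simp add: NAB A B mult.commute)
    also have "\<dots> = (\<integral>\<^sup>+x. ennreal (case_prod g x) * indicator (A \<times> B) x \<partial>(M \<Otimes>\<^sub>M lborel))"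
      unfolding Ng using AB by (subst emeasure_density) auto
    also have "\<dots> = (\<integral>\<^sup>+z. \<integral>\<^sup>+w. ennreal (g z w) * indicator (A \<times> B) (z, w) \<partial>lborel \<partial>M)"
      using AB gP by (subst lborel.nn_integral_fst[symmetric]) (auto intro!: borel_measurable_times_ennreal simp: case_prod_unfold)
    also have "\<dots> = (\<integral>\<^sup>+z. (\<integral>\<^sup>+w. ennreal (g z w) * indicator B w \<partial>lborel) * indicator A z \<partial>M)"
      by (intro nn_integral_cong) (auto simp: indicator_def)
    finally show "(\<integral>\<^sup>+z. emeasure (K z) B * indicator A z \<partial>M)
       = (\<integral>\<^sup>+z. (\<integral>\<^sup>+w. ennreal (g z w) * indicator B w \<partial>lborel) * indicator A z \<partial>M)" .
  qed auto
  have "AE z in M. \<forall>q\<in>\<rat>. emeasure (K z) {..q} = (\<integral>\<^sup>+w. ennreal (g z w) * indicator {..q} w \<partial>lborel)"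
    by (subst AE_ball_countable) (auto intro!: AE_B countable_rat)
  moreover have "AE z in M. emeasure (K z) UNIV = (\<integral>\<^sup>+w. ennreal (g z w) * indicator UNIV w \<partial>lborel)"
    by (rule AE_B) simp
  ultimately have "AE z in M. K z = density lborel (\<lambda>w. ennreal (g z w))"
  proof eventually_elim
    case (elim z)
    let ?D = "density lborel (\<lambda>w. ennreal (g z w))"
    have gz[measurable]: "g z \<in> borel_measurable borel" by (rule borel_measurable_section[OF gm])
    interpret Kz: prob_space "K z" by (rule K)
    have spK: "space (K z) = UNIV" using sets_eq_imp_space_eq[OF K(2)[of z]] by simp
    have eD: "emeasure ?D A = (\<integral>\<^sup>+w. ennreal (g z w) * indicator A w \<partial>lborel)" if "A \<in> sets borel" for A
      using that by (subst emeasure_density) auto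
    have "prob_space ?D"
      by (rule prob_spaceI) (use elim(2) Kz.emeasure_space_1 spK eD[of UNIV] in simp)
    then have D: "real_distribution ?D" by (simp add: real_distribution_def real_distribution_axioms_def)
    have KD: "real_distribution (K z)"
      using K by (simp add: real_distribution_def real_distribution_axioms_def)
    show ?case
      by (rule real_distribution_eqI_rat[OF KD D]) (use elim(1) eD in \<open>simp add: cdf_def measure_def\<close>)
  qed
  with gm show thesis by (intro that[of g]) (auto simp: g_def)
qed

text \<open>Names the witnesses hidden in \<open>C_star\<close>, so that one and the same kernel can
  be followed through several lemmas.\<close>

definition star_kernel :: "'n \<Rightarrow> (real ^ 'n) measure \<Rightarrow> real measure \<Rightarrow> ('n \<Rightarrow> real \<Rightarrow> real measure) \<Rightarrow> bool" where
  "star_kernel i1 \<mu> \<mu>1 K \<longleftrightarrow> prob_space \<mu>1 \<and> sets \<mu>1 = sets borel \<and>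
        (\<forall>j z. prob_space (K j z) \<and> sets (K j z) = sets borel) \<and>
        (\<forall>j A. A \<in> sets borel \<longrightarrow> (\<lambda>z. emeasure (K j z) A) \<in> borel_measurable borel) \<and>
        (\<forall>A :: 'n \<Rightarrow> real set. (\<forall>j. A j \<in> sets borel) \<longrightarrow>
            emeasure \<mu> {z. \<forall>j. z $ j \<in> A j}
            = (\<integral>\<^sup>+z1. indicator (A i1) z1 * (\<Prod>j\<in>UNIV - {i1}. emeasure (K j z1) (A j)) \<partial>\<mu>1))"

lemma C_star_iff: "\<mu> \<in> C_star i1 \<longleftrightarrow> prob_space \<mu> \<and> sets \<mu> = sets borel \<and> (\<exists>\<mu>1 K. star_kernel i1 \<mu> \<mu>1 K)"
  unfolding C_star_def star_kernel_def by simp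

lemma absolutely_continuous_AE_gauss:
  fixes \<mu> :: "(real^'n) measure"
  assumes "absolutely_continuous lborel \<mu>" "sets \<mu> = sets borel" "AE x in gauss. P x"
  shows "AE x in \<mu>. P x"
  using assms(3) unfolding AE_gauss_iff by (intro absolutely_continuous_AE[OF _ assms(1)]) (use assms(2) in simp)

lemma star_kernel_pair:
  fixes \<mu> :: "(real^'n) measure"
  assumes \<mu>: "sets \<mu> = sets borel" and k: "star_kernel i1 \<mu> \<mu>1 K" and j: "j \<noteq> i1"
    and [measurable]: "A \<in> sets borel" "B \<in> sets borel"
  shows "emeasure \<mu> {z. z $ i1 \<in> A \<and> z $ j \<in> B} = (\<integral>\<^sup>+z1. indicator A z1 * emeasure (K j z1) B \<partial>\<mu>1)"
proof -
  let ?A = "\<lambda>i. if i = i1 then A else if i = j then B else UNIV"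
  have K: "prob_space (K i z)" "sets (K i z) = sets borel" for i z using k by (auto simp: star_kernel_def)
  have K1: "emeasure (K i z) UNIV = 1" for i z
    using prob_space.emeasure_space_1[OF K(1)[of i z]] sets_eq_imp_space_eq[OF K(2)[of i z]] by simp
  have "{z. z $ i1 \<in> A \<and> z $ j \<in> B} = {z. \<forall>i. z $ i \<in> ?A i}" using j by auto
  then have "emeasure \<mu> {z. z $ i1 \<in> A \<and> z $ j \<in> B}
     = (\<integral>\<^sup>+z1. indicator (?A i1) z1 * (\<Prod>i\<in>UNIV - {i1}. emeasure (K i z1) (?A i)) \<partial>\<mu>1)"
    using k unfolding star_kernel_def by auto
  also have "\<dots> = (\<integral>\<^sup>+z1. indicator A z1 * emeasure (K j z1) B \<partial>\<mu>1)"
  proof (intro nn_integral_cong)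
    fix z
    have j': "j \<in> UNIV - {i1}" using j by auto
    have "(\<Prod>i\<in>UNIV - {i1}. emeasure (K i z) (?A i)) = emeasure (K j z) B"
      by (subst prod.remove[OF _ j']) (auto simp: K1 j intro!: prod.neutral)
    then show "indicator (?A i1) z * (\<Prod>i\<in>UNIV - {i1}. emeasure (K i z) (?A i)) = indicator A z * emeasure (K j z) B"
      by simp
  qed
  finally show ?thesis .
qed

lemma star_kernel_marginal:
  fixes \<mu> :: "(real^'n) measure"
  assumes \<mu>: "sets \<mu> = sets borel" and k: "star_kernel i1 \<mu> \<mu>1 K"
  shows "\<mu>1 = distr \<mu> borel (\<lambda>z. z $ i1)"
proof (rule measure_eqI)
  show "sets \<mu>1 = sets (distr \<mu> borel (\<lambda>z. z $ i1))" using k by (simp add: star_kernel_def)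
  fix A assume "A \<in> sets \<mu>1"
  then have A[measurable]: "A \<in> sets borel" using k by (simp add: star_kernel_def)
  let ?A = "\<lambda>i. if i = i1 then A else UNIV"
  have K: "prob_space (K i z)" "sets (K i z) = sets borel" for i z using k by (auto simp: star_kernel_def)
  have K1: "emeasure (K i z) UNIV = 1" for i z
    using prob_space.emeasure_space_1[OF K(1)[of i z]] sets_eq_imp_space_eq[OF K(2)[of i z]] by simp
  have sp: "space \<mu> = UNIV" using sets_eq_imp_space_eq[OF \<mu>] by simp
  have "{z. z $ i1 \<in> A} = {z. \<forall>i. z $ i \<in> ?A i}" by auto
  then have "emeasure \<mu> {z. z $ i1 \<in> A}
     = (\<integral>\<^sup>+z1. indicator (?A i1) z1 * (\<Prod>i\<in>UNIV - {i1}. emeasure (K i z1) (?A i)) \<partial>\<mu>1)"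
    using k unfolding star_kernel_def by auto
  also have "\<dots> = (\<integral>\<^sup>+z1. indicator A z1 \<partial>\<mu>1)"
    by (intro nn_integral_cong) (simp add: K1)
  also have "\<dots> = emeasure \<mu>1 A" using A k by (simp add: star_kernel_def)
  finally show "emeasure \<mu>1 A = emeasure (distr \<mu> borel (\<lambda>z. z $ i1)) A"
    using \<mu> sp by (subst emeasure_distr) (auto simp: vimage_def cong: measurable_cong_sets)
qed

text \<open>A null set \<open>X\<close> of \<open>\<mu>1 \<Otimes>\<^sub>M lborel\<close> can have
  positive Lebesgue measure where \<open>\<mu>1\<close> vanishes. The set \<open>B\<close> of first
  coordinates whose slice of \<open>X\<close> has positive length is null for \<open>\<mu>1\<close>;
  off \<open>B\<close> all slices are null, so the rest of \<open>X\<close> is Lebesgue null and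
  absolute continuity of \<open>\<mu>\<close> applies.\<close>

lemma star_kernel_pair_absolutely_continuous:
  fixes \<mu> :: "(real^'n) measure"
  assumes \<mu>: "sets \<mu> = sets borel" "prob_space \<mu>" and k: "star_kernel i1 \<mu> \<mu>1 K"
    and ac: "absolutely_continuous lborel \<mu>" and j: "j \<noteq> i1"
  shows "absolutely_continuous (\<mu>1 \<Otimes>\<^sub>M lborel) (distr \<mu> (borel \<Otimes>\<^sub>M borel) (\<lambda>z. (z $ i1, z $ j)))"
  unfolding absolutely_continuous_def
proof
  interpret \<mu>1: prob_space \<mu>1 using k by (simp add: star_kernel_def)
  have \<mu>1s[measurable_cong]: "sets \<mu>1 = sets borel" using k by (simp add: star_kernel_def)
  note [measurable_cong] = \<mu>(1)
  interpret P: pair_sigma_finite \<mu>1 lborel ..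
  have setsP: "sets (\<mu>1 \<Otimes>\<^sub>M lborel) = sets (borel \<Otimes>\<^sub>M borel)"
    by (intro sets_pair_measure_cong \<mu>1s) simp
  fix X assume X: "X \<in> null_sets (\<mu>1 \<Otimes>\<^sub>M (lborel :: real measure))"
  then have Xm[measurable]: "X \<in> sets (borel \<Otimes>\<^sub>M borel)" using setsP by (auto simp: null_sets_def)
  have "AE x in \<mu>1 \<Otimes>\<^sub>M lborel. x \<notin> X" by (rule AE_not_in[OF X])
  then have slices: "AE p in \<mu>1. AE w in lborel. (p, w) \<notin> X" by (rule P.AE_pair)
  define B where "B = {p. emeasure lborel (Pair p -` X) \<noteq> 0}"
  have B_iff: "p \<notin> B \<longleftrightarrow> (AE w in lborel. (p, w) \<notin> X)" for p
  proof -
    have "Pair p -` X \<in> sets lborel" using sets_Pair1[OF Xm, of p] by simp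
    then show ?thesis unfolding B_def by (subst AE_iff_measurable[of "Pair p -` X"]) auto
  qed
  have Bm[measurable]: "B \<in> sets borel"
  proof -
    have "(\<lambda>p. emeasure lborel (Pair p -` X)) \<in> borel_measurable borel"
      by (rule lborel.measurable_emeasure_Pair) (use Xm in \<open>simp cong: sets_pair_measure_cong\<close>)
    then have "{p \<in> space borel. emeasure lborel (Pair p -` X) \<noteq> 0} \<in> sets borel" by measurable
    then show ?thesis by (simp add: B_def)
  qed
  have "AE p in \<mu>1. p \<notin> B" using slices by (simp add: B_iff)
  then have 1: "AE z in \<mu>. z $ i1 \<notin> B"
    unfolding star_kernel_marginal[OF \<mu>(1) k] by (subst (asm) AE_distr_iff) auto
  have "AE z in gauss. \<not> (z $ i1 \<notin> B \<and> ((z::real^'n) $ i1, z $ j) \<in> X)"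
  proof (subst AE_gauss_coord_iff)
    have "Measurable.pred (borel \<Otimes>\<^sub>M borel) (\<lambda>x. \<not> (fst x \<notin> B \<and> x \<in> X))" by measurable
    then show "Measurable.pred (borel \<Otimes>\<^sub>M borel) (\<lambda>(p, u). \<not> (p \<notin> B \<and> (p, u) \<in> X))"
      by (simp add: case_prod_unfold)
    show "AE p in stdn. AE u in stdn. \<not> (p \<notin> B \<and> (p, u) \<in> X)"
      unfolding AE_stdn_iff
    proof (rule AE_I2)
      fix p
      show "AE u in lborel. \<not> (p \<notin> B \<and> (p, u) \<in> X)"
        using B_iff[of p] by (cases "p \<in> B") auto
    qed
  qed (use j in auto)
  then have 2: "AE z in \<mu>. \<not> (z $ i1 \<notin> B \<and> (z $ i1, z $ j) \<in> X)"
    by (rule absolutely_continuous_AE_gauss[OF ac \<mu>(1)])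
  have "AE z in \<mu>. (z $ i1, z $ j) \<notin> X" using 1 2 by eventually_elim auto
  then have "AE x in distr \<mu> (borel \<Otimes>\<^sub>M borel) (\<lambda>z. (z $ i1, z $ j)). x \<notin> X"
    by (subst AE_distr_iff) auto
  then show "X \<in> null_sets (distr \<mu> (borel \<Otimes>\<^sub>M borel) (\<lambda>z. (z $ i1, z $ j)))"
    by (subst AE_iff_null_sets) auto
qed

text \<open>Absolute continuity passes to the laws of \<open>(z $ i1, z $ j)\<close>, which gives
  conditional densities one coordinate at a time; the resulting product density has the right values
  on all rectangles.\<close>

lemma star_kernel_densities:
  fixes \<mu> :: "(real^'n) measure"
  assumes \<mu>: "sets \<mu> = sets borel" "prob_space \<mu>" and k: "star_kernel i1 \<mu> \<mu>1 K"
    and ac: "absolutely_continuous lborel \<mu>"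
  obtains f :: "real \<Rightarrow> real" and g :: "'n \<Rightarrow> real \<Rightarrow> real \<Rightarrow> real"
  where "f \<in> borel_measurable borel" "\<And>z. 0 \<le> f z" "\<mu>1 = density lborel (\<lambda>z. ennreal (f z))"
    "\<And>j. case_prod (g j) \<in> borel_measurable (borel \<Otimes>\<^sub>M borel)" "\<And>j z w. 0 \<le> g j z w"
    "\<And>j. j \<noteq> i1 \<Longrightarrow> AE z in \<mu>1. K j z = density lborel (\<lambda>w. ennreal (g j z w))"
    "\<mu> = density lborel (\<lambda>z. ennreal (f (z $ i1) * (\<Prod>j\<in>UNIV - {i1}. g j (z $ i1) (z $ j))))"
proof -
  interpret \<mu>: prob_space \<mu> by fact
  interpret \<mu>1: prob_space \<mu>1 using k by (simp add: star_kernel_def)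
  have \<mu>1s[measurable_cong]: "sets \<mu>1 = sets borel" using k by (simp add: star_kernel_def)
  note [measurable_cong] = \<mu>(1)
  have K: "prob_space (K i z)" "sets (K i z) = sets borel" for i z using k by (auto simp: star_kernel_def)
  have Km: "A \<in> sets borel \<Longrightarrow> (\<lambda>z. emeasure (K j z) A) \<in> borel_measurable borel" for j A
    using k by (auto simp: star_kernel_def)
  have ac1: "absolutely_continuous lborel \<mu>1"
    unfolding absolutely_continuous_def
  proof
    fix X :: "real set" assume X: "X \<in> null_sets lborel"
    then have [measurable]: "X \<in> sets borel" by (auto simp: null_sets_def)
    have "AE u in stdn. u \<notin> X" unfolding AE_stdn_iff by (rule AE_not_in[OF X])
    then have "AE z::real^'n in gauss. z $ i1 \<notin> X"
      unfolding distr_gauss_coord[of i1, symmetric] by (subst (asm) AE_distr_iff) auto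
    then have "AE z in \<mu>. z $ i1 \<notin> X" by (rule absolutely_continuous_AE_gauss[OF ac \<mu>(1)])
    then have "AE u in \<mu>1. u \<notin> X"
      unfolding star_kernel_marginal[OF \<mu>(1) k] by (subst AE_distr_iff) auto
    then show "X \<in> null_sets \<mu>1" by (subst AE_iff_null_sets) auto
  qed
  define f where "f z = enn2real (RN_deriv lborel \<mu>1 z)" for z
  have f[measurable]: "f \<in> borel_measurable borel"
    unfolding f_def using borel_measurable_RN_deriv[of lborel \<mu>1] by simp
  have f0: "0 \<le> f z" for z by (simp add: f_def)
  have f_eq: "\<mu>1 = density lborel (\<lambda>z. ennreal (f z))"
  proof -
    have "\<mu>1 = density lborel (RN_deriv lborel \<mu>1)"
      by (rule sigma_finite_measure.density_RN_deriv[OF lborel.sigma_finite_measure_axioms ac1, symmetric]) (simp add: \<mu>1s)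
    also have "\<dots> = density lborel (\<lambda>z. ennreal (f z))"
    proof (rule density_cong)
      show "AE z in lborel. RN_deriv lborel \<mu>1 z = ennreal (f z)"
        using sigma_finite_measure.RN_deriv_finite[OF lborel.sigma_finite_measure_axioms \<mu>1.sigma_finite_measure_axioms ac1] by (auto simp: f_def less_top[symmetric] \<mu>1s)
    qed auto
    finally show ?thesis .
  qed
  have "\<exists>g. case_prod g \<in> borel_measurable (borel \<Otimes>\<^sub>M borel) \<and> (\<forall>z w. 0 \<le> g z w) \<and>
     (j \<noteq> i1 \<longrightarrow> (AE z in \<mu>1. K j z = density lborel (\<lambda>w. ennreal (g z w))))" for j
  proof (cases "j = i1")
    case True then show ?thesis by (intro exI[of _ "\<lambda>_ _. 0"]) auto
  next
    case False
    let ?N = "distr \<mu> (borel \<Otimes>\<^sub>M borel) (\<lambda>z. (z $ i1, z $ j))"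
    obtain g :: "real \<Rightarrow> real \<Rightarrow> real" where "case_prod g \<in> borel_measurable (borel \<Otimes>\<^sub>M borel)"
      "\<And>z w. 0 \<le> g z w" "AE z in \<mu>1. K j z = density lborel (\<lambda>w. ennreal (g z w))"
    proof (rule kernel_density[of \<mu>1 "K j" ?N])
      show "prob_space ?N" by (rule \<mu>.prob_space_distr) measurable
      show "absolutely_continuous (\<mu>1 \<Otimes>\<^sub>M lborel) ?N"
        by (rule star_kernel_pair_absolutely_continuous[OF \<mu> k ac False])
      fix A B :: "real set" assume [measurable]: "A \<in> sets borel" "B \<in> sets borel"
      have sp: "space \<mu> = UNIV" using sets_eq_imp_space_eq[OF \<mu>(1)] by simp
      have "emeasure ?N (A \<times> B) = emeasure \<mu> {z. z $ i1 \<in> A \<and> z $ j \<in> B}"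
        by (subst emeasure_distr) (auto simp: sp intro!: arg_cong2[where f=emeasure])
      also have "\<dots> = (\<integral>\<^sup>+z1. indicator A z1 * emeasure (K j z1) B \<partial>\<mu>1)"
        by (rule star_kernel_pair[OF \<mu>(1) k False]) measurable
      finally show "emeasure ?N (A \<times> B) = (\<integral>\<^sup>+z1. indicator A z1 * emeasure (K j z1) B \<partial>\<mu>1)" .
    qed (use K Km \<mu>1s \<mu>1.prob_space_axioms in auto)
    then show ?thesis by blast
  qed
  then obtain g where g: "\<And>j. case_prod (g j) \<in> borel_measurable (borel \<Otimes>\<^sub>M borel)" "\<And>j z w. 0 \<le> g j z w"
    and gK: "\<And>j. j \<noteq> i1 \<Longrightarrow> AE z in \<mu>1. K j z = density lborel (\<lambda>w. ennreal (g j z w))"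
    by metis
  have [measurable]: "(\<lambda>z::real^'n. g j (z $ i1) (z $ j)) \<in> borel_measurable borel" for j
    by (rule borel_measurable_coords[OF g(1)])
  have gs[measurable]: "g j z \<in> borel_measurable borel" for j z
    by (rule borel_measurable_section[OF g(1)])
  let ?q = "\<lambda>z. f (z $ i1) * (\<Prod>j\<in>UNIV - {i1}. g j (z $ i1) (z $ j))"
  have "\<mu> = density lborel (\<lambda>z. ennreal (?q z))"
  proof (rule measure_eqI_rect[OF \<mu>(2,1)])
    fix A :: "'n \<Rightarrow> real set" assume A[measurable]: "\<And>j. A j \<in> sets borel"
    have "emeasure (density lborel (\<lambda>z. ennreal (?q z))) {z. \<forall>j. z $ j \<in> A j}
       = (\<integral>\<^sup>+z. ennreal (?q z) * indicator {z. \<forall>j. z $ j \<in> A j} z \<partial>vecM lborel)"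
      unfolding lborel_eq_vecM[symmetric] by (subst emeasure_density) auto
    also have "\<dots> = (\<integral>\<^sup>+z. (ennreal (f (z $ i1)) * indicator (A i1) (z $ i1)) *
         (\<Prod>j\<in>UNIV - {i1}. ennreal (g j (z $ i1) (z $ j)) * indicator (A j) (z $ j)) \<partial>vecM lborel)"
    proof (intro nn_integral_cong)
      fix z :: "real^'n"
      have "(indicator {z. \<forall>j. z $ j \<in> A j} z :: ennreal) = (\<Prod>j\<in>UNIV. indicator (A j) (z $ j))"
        by (auto simp: indicator_def)
      also have "\<dots> = indicator (A i1) (z $ i1) * (\<Prod>j\<in>UNIV - {i1}. indicator (A j) (z $ j))"
        by (rule prod_eq_insert_UNIV)
      finally have 1: "(indicator {z. \<forall>j. z $ j \<in> A j} z :: ennreal)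
          = indicator (A i1) (z $ i1) * (\<Prod>j\<in>UNIV - {i1}. indicator (A j) (z $ j))" .
      have 2: "ennreal (?q z) = ennreal (f (z $ i1)) * (\<Prod>j\<in>UNIV - {i1}. ennreal (g j (z $ i1) (z $ j)))"
        by (simp add: ennreal_mult' f0 g(2) prod_ennreal prod_nonneg)
      show "ennreal (?q z) * indicator {z. \<forall>j. z $ j \<in> A j} z = (ennreal (f (z $ i1)) * indicator (A i1) (z $ i1)) *
         (\<Prod>j\<in>UNIV - {i1}. ennreal (g j (z $ i1) (z $ j)) * indicator (A j) (z $ j))"
        unfolding 1 2 prod.distrib by (simp add: ac_simps)
    qed
    also have "\<dots> = (\<integral>\<^sup>+p. (ennreal (f p) * indicator (A i1) p) *
         (\<Prod>j\<in>UNIV - {i1}. \<integral>\<^sup>+u. ennreal (g j p u) * indicator (A j) u \<partial>lborel) \<partial>lborel)"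
    proof (rule nn_integral_vecM_star[where g="\<lambda>j p u. ennreal (g j p u) * indicator (A j) u"])
      have "(\<lambda>x. ennreal (case_prod (g j) x) * indicator (A j) (snd x)) \<in> borel_measurable (borel \<Otimes>\<^sub>M borel)" for j
        using g(1)[of j] by measurable
      then show "(\<lambda>(p, u). ennreal (g j p u) * indicator (A j) u) \<in> borel_measurable (borel \<Otimes>\<^sub>M borel)" for j
        by (simp add: case_prod_unfold)
    qed (auto intro: lborel.sigma_finite_measure_axioms)
    also have "\<dots> = (\<integral>\<^sup>+p. indicator (A i1) p *
         (\<Prod>j\<in>UNIV - {i1}. \<integral>\<^sup>+u. ennreal (g j p u) * indicator (A j) u \<partial>lborel) \<partial>\<mu>1)"
    proof -
      have "(\<lambda>p. \<integral>\<^sup>+u. ennreal (g j p u) * indicator (A j) u \<partial>lborel) \<in> borel_measurable borel" for j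
      proof (rule lborel.borel_measurable_nn_integral)
        have "(\<lambda>x. ennreal (case_prod (g j) x) * indicator (A j) (snd x)) \<in> borel_measurable (borel \<Otimes>\<^sub>M lborel)"
          using g(1)[of j] by measurable
        then show "(\<lambda>(p, u). ennreal (g j p u) * indicator (A j) u) \<in> borel_measurable (borel \<Otimes>\<^sub>M lborel)"
          by (simp add: case_prod_unfold)
      qed
      then show ?thesis unfolding f_eq by (subst nn_integral_density) (auto simp: mult.assoc)
    qed
    also have "\<dots> = (\<integral>\<^sup>+p. indicator (A i1) p * (\<Prod>j\<in>UNIV - {i1}. emeasure (K j p) (A j)) \<partial>\<mu>1)"
    proof (rule nn_integral_cong_AE)
      have "AE p in \<mu>1. \<forall>j\<in>UNIV - {i1}. K j p = density lborel (\<lambda>w. ennreal (g j p w))"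
        by (subst AE_ball_countable) (auto intro: gK)
      then show "AE p in \<mu>1. indicator (A i1) p * (\<Prod>j\<in>UNIV - {i1}. \<integral>\<^sup>+u. ennreal (g j p u) * indicator (A j) u \<partial>lborel)
          = indicator (A i1) p * (\<Prod>j\<in>UNIV - {i1}. emeasure (K j p) (A j))"
      proof eventually_elim
        case (elim p)
        then show ?case by (auto intro!: arg_cong2[where f="(*)"] prod.cong simp: emeasure_density)
      qed
    qed
    also have "\<dots> = emeasure \<mu> {z. \<forall>j. z $ j \<in> A j}" using k A by (simp add: star_kernel_def)
    finally show "emeasure \<mu> {z. \<forall>j. z $ j \<in> A j} = emeasure (density lborel (\<lambda>z. ennreal (?q z))) {z. \<forall>j. z $ j \<in> A j}" ..
  qed simp
  with f f0 f_eq g gK show thesis by (intro that[of f g]) auto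
qed

section \<open>Star maps and star-structured measures\<close>

text \<open>The supremum of \<open>{p. s p \<le> z}\<close> is a monotone left inverse, but the set
  may be empty or unbounded. Compression by \<open>arctan\<close> and insertion of the lower end
  point \<open>- (pi / 2)\<close> make the supremum exist for every \<open>z\<close>; the tangent,
  spelled out as a quotient, undoes the compression.\<close>

lemma strict_mono_borel_left_inverse:
  fixes s :: "real \<Rightarrow> real"
  assumes s: "strict_mono s"
  obtains \<psi> :: "real \<Rightarrow> real" where "\<psi> \<in> borel_measurable borel" "\<And>p. \<psi> (s p) = p"
proof
  define X where "X z = insert (- (pi / 2)) (arctan ` {p. s p \<le> z})" for z
  define \<phi> where "\<phi> z = Sup (X z)" for z
  have bdd: "bdd_above (X z)" for z
  proof (rule bdd_aboveI)
    fix y assume "y \<in> X z"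
    then consider "y = - (pi / 2)" | p where "y = arctan p" unfolding X_def by blast
    then show "y \<le> pi / 2"
      using pi_ge_zero by cases (linarith, simp only: less_imp_le[OF arctan_ubound])
  qed
  have "mono \<phi>"
  proof
    fix x y :: real assume "x \<le> y"
    then have "X x \<subseteq> X y" by (auto simp: X_def)
    then show "\<phi> x \<le> \<phi> y" unfolding \<phi>_def by (intro cSup_subset_mono bdd) (auto simp: X_def)
  qed
  then have [measurable]: "\<phi> \<in> borel_measurable borel" by (rule borel_measurable_mono)
  show "(\<lambda>z. sin (\<phi> z) / cos (\<phi> z)) \<in> borel_measurable borel" by measurable
  fix p
  have "{q. s q \<le> s p} = {..p}" using strict_mono_less_eq[OF s] by auto
  then have "\<phi> (s p) = arctan p"
    unfolding \<phi>_def X_def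
    by (intro cSup_eq_maximum) (auto simp: arctan_monotone' less_imp_le[OF arctan_lbound])
  then show "sin (\<phi> (s p)) / cos (\<phi> (s p)) = p" using tan_arctan[of p] by (simp only: tan_def)
qed

text \<open>The conditional law must be a measurable function of the image \<open>S i1 0 p\<close>,
  whereas \<open>S j\<close> is indexed by the source \<open>p\<close>; a Borel left inverse of the
  first map translates between them. Integrals against the marginal law are pulled back along
  \<open>S i1 0\<close>, so only values on its range enter.\<close>

lemma starmap_star_kernel:
  fixes S :: "'n::finite \<Rightarrow> real \<Rightarrow> real \<Rightarrow> real"
  assumes S: "star_family i1 S"
  obtains K where "star_kernel i1 (distr gauss borel (starmap i1 S)) (distr stdn borel (S i1 0)) K"
    "\<And>j p. K j (S i1 0 p) = distr stdn borel (S j p)"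
proof -
  have Sm: "case_prod (S i) \<in> borel_measurable (borel \<Otimes>\<^sub>M borel)" for i using S by (simp add: star_family_def)
  have S1: "S i1 p = S i1 0" for p using S by (auto simp: star_family_def)
  have "strict_mono (S i1 0)" using S by (simp add: star_family_def)
  then obtain \<psi> where \<psi>[measurable]: "\<psi> \<in> borel_measurable borel" and \<psi>s: "\<And>p. \<psi> (S i1 0 p) = p"
    using strict_mono_borel_left_inverse by blast
  define K where "K j z = distr stdn borel (S j (\<psi> z))" for j z
  have Ss[measurable]: "S j p \<in> borel_measurable borel" for j p by (rule borel_measurable_section[OF Sm])
  have T[measurable]: "starmap i1 S \<in> borel_measurable borel" by (rule borel_measurable_starmap[OF Sm])
  have slice: "(\<lambda>p. emeasure stdn (S j p -` A)) \<in> borel_measurable borel" if [measurable]: "A \<in> sets borel" for j A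
  proof -
    have "case_prod (S j) -` A \<inter> space (borel \<Otimes>\<^sub>M borel) \<in> sets (borel \<Otimes>\<^sub>M borel)"
      by (rule measurable_sets[OF Sm that])
    then have "case_prod (S j) -` A \<in> sets (borel \<Otimes>\<^sub>M stdn)"
      by (simp add: space_pair_measure cong: sets_pair_measure_cong)
    then have "(\<lambda>p. emeasure stdn (Pair p -` (case_prod (S j) -` A))) \<in> borel_measurable borel"
      by (rule stdn.measurable_emeasure_Pair)
    moreover have "Pair p -` (case_prod (S j) -` A) = S j p -` A" for p by auto
    ultimately show ?thesis by simp
  qed
  have eK: "emeasure (K j z) A = emeasure stdn (S j (\<psi> z) -` A)" if "A \<in> sets borel" for j z A
    unfolding K_def using that by (subst emeasure_distr) auto
  have Km: "(\<lambda>z. emeasure (K j z) A) \<in> borel_measurable borel" if "A \<in> sets borel" for j A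
    using measurable_compose[OF \<psi> slice[OF that]] by (simp add: eK that)
  have rect: "emeasure (distr gauss borel (starmap i1 S)) {z. \<forall>j. z $ j \<in> A j}
      = (\<integral>\<^sup>+z1. indicator (A i1) z1 * (\<Prod>j\<in>UNIV - {i1}. emeasure (K j z1) (A j)) \<partial>distr stdn borel (S i1 0))"
    if A[measurable]: "\<And>j. A j \<in> sets borel" for A
  proof -
    have "emeasure (distr gauss borel (starmap i1 S)) {z. \<forall>j. z $ j \<in> A j}
       = (\<integral>\<^sup>+z. indicator {z. \<forall>j. z $ j \<in> A j} z \<partial>distr gauss borel (starmap i1 S))"
      by simp
    also have "\<dots> = (\<integral>\<^sup>+x. indicator {z. \<forall>j. z $ j \<in> A j} (starmap i1 S x) \<partial>vecM stdn)"
      unfolding gauss_eq_vecM[symmetric] by (subst nn_integral_distr) auto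
    also have "\<dots> = (\<integral>\<^sup>+x. indicator (A i1) (S i1 0 (x $ i1)) *
        (\<Prod>j\<in>UNIV - {i1}. indicator (A j) (S j (x $ i1) (x $ j))) \<partial>vecM stdn)"
    proof (intro nn_integral_cong)
      fix x :: "real^'n"
      have "(indicator {z. \<forall>j. z $ j \<in> A j} (starmap i1 S x) :: ennreal) = (\<Prod>j\<in>UNIV. indicator (A j) (S j (x $ i1) (x $ j)))"
        by (auto simp: indicator_def)
      also have "\<dots> = indicator (A i1) (S i1 (x $ i1) (x $ i1)) * (\<Prod>j\<in>UNIV - {i1}. indicator (A j) (S j (x $ i1) (x $ j)))"
        by (rule prod_eq_insert_UNIV)
      finally show "(indicator {z. \<forall>j. z $ j \<in> A j} (starmap i1 S x) :: ennreal)
          = indicator (A i1) (S i1 0 (x $ i1)) * (\<Prod>j\<in>UNIV - {i1}. indicator (A j) (S j (x $ i1) (x $ j)))"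
        by (simp add: S1[of "x $ i1"])
    qed
    also have "\<dots> = (\<integral>\<^sup>+p. indicator (A i1) (S i1 0 p) *
        (\<Prod>j\<in>UNIV - {i1}. \<integral>\<^sup>+u. indicator (A j) (S j p u) \<partial>stdn) \<partial>stdn)"
    proof (rule nn_integral_vecM_star[where k="\<lambda>p. indicator (A i1) (S i1 0 p)" and g="\<lambda>j p u. indicator (A j) (S j p u)"])
      show "(\<lambda>(p, u). indicator (A j) (S j p u) :: ennreal) \<in> borel_measurable (borel \<Otimes>\<^sub>M borel)" for j
        using measurable_compose[OF Sm borel_measurable_indicator[OF A]] by (simp add: case_prod_unfold)
    qed (auto intro: stdn.sigma_finite_measure_axioms)
    also have "\<dots> = (\<integral>\<^sup>+p. indicator (A i1) (S i1 0 p) *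
        (\<Prod>j\<in>UNIV - {i1}. emeasure (K j (S i1 0 p)) (A j)) \<partial>stdn)"
    proof (intro nn_integral_cong)
      fix p
      have "(\<integral>\<^sup>+u. indicator (A j) (S j p u) \<partial>stdn) = emeasure stdn (S j p -` A j)" for j
      proof -
        have "S j p -` A j \<in> sets stdn" using measurable_sets_borel[of "S j p" borel "A j"] by simp
        then have "emeasure stdn (S j p -` A j) = (\<integral>\<^sup>+u. indicator (S j p -` A j) u \<partial>stdn)" by simp
        also have "\<dots> = (\<integral>\<^sup>+u. indicator (A j) (S j p u) \<partial>stdn)"
          by (intro nn_integral_cong) (auto simp: indicator_def)
        finally show ?thesis ..
      qed
      then show "indicator (A i1) (S i1 0 p) * (\<Prod>j\<in>UNIV - {i1}. \<integral>\<^sup>+u. indicator (A j) (S j p u) \<partial>stdn)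
         = indicator (A i1) (S i1 0 p) * (\<Prod>j\<in>UNIV - {i1}. emeasure (K j (S i1 0 p)) (A j))"
        by (simp add: eK \<psi>s)
    qed
    also have "\<dots> = (\<integral>\<^sup>+z1. indicator (A i1) z1 * (\<Prod>j\<in>UNIV - {i1}. emeasure (K j z1) (A j)) \<partial>distr stdn borel (S i1 0))"
      by (subst nn_integral_distr) (auto intro!: borel_measurable_times_ennreal borel_measurable_prod_ennreal Km)
    finally show ?thesis .
  qed
  show thesis
  proof
    show "K j (S i1 0 p) = distr stdn borel (S j p)" for j p by (simp add: K_def \<psi>s)
    have "prob_space (distr stdn borel (S j p))" for j p
      by (rule stdn.prob_space_distr) (simp cong: measurable_cong_sets)
    then show "star_kernel i1 (distr gauss borel (starmap i1 S)) (distr stdn borel (S i1 0)) K"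
      unfolding star_kernel_def using rect Km by (simp add: K_def)
  qed
qed

lemma distr_starmap_in_C_star:
  assumes S: "star_family i1 (S :: 'n::finite \<Rightarrow> real \<Rightarrow> real \<Rightarrow> real)"
  shows "distr gauss borel (starmap i1 S) \<in> C_star i1"
proof -
  obtain K where "star_kernel i1 (distr gauss borel (starmap i1 S)) (distr stdn borel (S i1 0)) K"
    by (rule starmap_star_kernel[OF S])
  moreover have "starmap i1 S \<in> borel_measurable borel"
    using S by (intro borel_measurable_starmap) (simp add: star_family_def)
  ultimately show ?thesis unfolding C_star_iff using gauss.prob_space_distr[of "starmap i1 S" borel]
    by (auto cong: measurable_cong_sets)
qed

section \<open>Exact subderivatives of maps with finite entropy\<close>

context strong_potential
begin

lemma KL_finite_absolutely_continuous:
  assumes "KL \<mu> (target V) \<noteq> \<infinity>"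
  shows "absolutely_continuous lborel \<mu>"
  using assms null_sets_target unfolding KL_def absolutely_continuous_def by (auto split: if_splits)

text \<open>Each \<open>D i\<close> is the normal density divided by the conditional density at the
  image point. In the product the normal densities cancel \<open>gdens\<close>, so
  \<open>subdens\<close> is the reciprocal of the density \<open>q\<close> relative to the target,
  taken at the image point, and Gibbs' inequality turns into an equality.\<close>

lemma exact_subderivative:
  assumes S: "star_family i1 S"
    and fin: "KL (distr gauss borel (starmap i1 S)) (target V) \<noteq> \<infinity>"
  obtains D where "subderivative i1 S D" "integrable gauss (\<lambda>x. ln (subdens i1 S D x))"
    "KL (distr gauss borel (starmap i1 S)) (target V) = ereal (- (\<integral>x. ln (subdens i1 S D x) \<partial>gauss))"
proof -
  let ?N = "distr gauss borel (starmap i1 S)"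
  have Sm: "case_prod (S i) \<in> borel_measurable (borel \<Otimes>\<^sub>M borel)" for i using S by (simp add: star_family_def)
  have S1: "S i1 p = S i1 0" for p using S by (auto simp: star_family_def)
  have mono: "strict_mono (S i p)" for i p using S by (simp add: star_family_def)
  have Ss[measurable]: "S j p \<in> borel_measurable borel" for j p by (rule borel_measurable_section[OF Sm])
  have T[measurable]: "starmap i1 S \<in> borel_measurable borel" by (rule borel_measurable_starmap[OF Sm])
  have ac: "absolutely_continuous lborel ?N" by (rule KL_finite_absolutely_continuous[OF fin])
  have pN: "prob_space ?N" by (rule prob_space_distr_gauss[OF T])
  obtain K where K: "star_kernel i1 ?N (distr stdn borel (S i1 0)) K"
    and KS: "\<And>j p. K j (S i1 0 p) = distr stdn borel (S j p)"
    using starmap_star_kernel[OF S] by blast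
  obtain f g where f[measurable]: "f \<in> borel_measurable borel" and f0: "\<And>z. 0 \<le> f z"
    and f_eq: "distr stdn borel (S i1 0) = density lborel (\<lambda>z. ennreal (f z))"
    and g: "\<And>j. case_prod (g j) \<in> borel_measurable (borel \<Otimes>\<^sub>M borel)" "\<And>j z w. 0 \<le> g j z w"
    and gK: "\<And>j. j \<noteq> i1 \<Longrightarrow> AE z in distr stdn borel (S i1 0). K j z = density lborel (\<lambda>w. ennreal (g j z w))"
    and N_eq: "?N = density lborel (\<lambda>z. ennreal (f (z $ i1) * (\<Prod>j\<in>UNIV - {i1}. g j (z $ i1) (z $ j))))"
    by (rule star_kernel_densities[OF _ pN K ac]) auto
  have [measurable]: "(\<lambda>z::real^'n. g j (z $ i1) (z $ j)) \<in> borel_measurable borel" for j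
    by (rule borel_measurable_coords[OF g(1)])
  have gs[measurable]: "g j z \<in> borel_measurable borel" for j z
    by (rule borel_measurable_section[OF g(1)])
  define D where "D i p u = (if i = i1 then std_normal_density u / f (S i1 0 u)
      else std_normal_density u / g i (S i1 0 p) (S i p u))" for i p u
  have Dm: "case_prod (D i) \<in> borel_measurable (borel \<Otimes>\<^sub>M borel)" for i
  proof -
    have "(\<lambda>x. (S i1 0 (fst x), case_prod (S i) x)) \<in> measurable (borel \<Otimes>\<^sub>M borel) (borel \<Otimes>\<^sub>M borel)"
      using Sm[of i] by measurable
    from measurable_compose[OF this g(1)[of i]]
    have [measurable]: "(\<lambda>x. g i (S i1 0 (fst x)) (S i (fst x) (snd x))) \<in> borel_measurable (borel \<Otimes>\<^sub>M borel)"
      by (simp add: case_prod_unfold)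
    show ?thesis unfolding D_def case_prod_unfold by (cases "i = i1") (simp_all, measurable)
  qed
  have D0: "0 \<le> D i p u" for i p u by (simp add: D_def f0 g(2) normal_density_nonneg)
  have D_AE: "AE p in stdn. (AE u in stdn. 0 < D i p u) \<and> (\<forall>u v. u < v \<longrightarrow>
     (\<integral>\<^sup>+w. ennreal (D i p w) * indicator {u<..<v} w \<partial>lborel) \<le> ennreal (S i p v - S i p u))" for i
  proof (cases "i = i1")
    case True
    have "(AE u in stdn. 0 < D i p u) \<and> (\<forall>u v. u < v \<longrightarrow>
     (\<integral>\<^sup>+w. ennreal (D i p w) * indicator {u<..<v} w \<partial>lborel) \<le> ennreal (S i p v - S i p u))" for p
      using derivative_of_density[OF mono Ss f f0 f_eq]
      unfolding True D_def S1[of p] AE_stdn_iff by simp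
    then show ?thesis by simp
  next
    case False
    have "AE p in stdn. K i (S i1 0 p) = density lborel (\<lambda>w. ennreal (g i (S i1 0 p) w))"
      by (rule AE_distrD[OF _ gK[OF False]]) measurable
    then show ?thesis
    proof eventually_elim
      case (elim p)
      then have "distr stdn borel (S i p) = density lborel (\<lambda>w. ennreal (g i (S i1 0 p) w))" by (simp only: KS)
      from derivative_of_density[OF mono Ss gs g(2) this] show ?case
        using False unfolding D_def AE_stdn_iff by simp
    qed
  qed
  have D: "subderivative i1 S D"
    unfolding subderivative_def using Dm D0 D_AE by (auto simp: D_def)
  define q where "q z = f (z $ i1) * (\<Prod>j\<in>UNIV - {i1}. g j (z $ i1) (z $ j)) / pdens z" for z
  have q[measurable]: "q \<in> borel_measurable borel" unfolding q_def by measurable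
  have q0: "0 \<le> q z" for z
    unfolding q_def by (intro divide_nonneg_pos mult_nonneg_nonneg prod_nonneg pdens_pos) (auto simp: f0 g(2))
  have N_q: "?N = density (target V) (\<lambda>z. ennreal (q z))"
  proof -
    have "density (target V) (\<lambda>z. ennreal (q z)) = density lborel (\<lambda>z. ennreal (pdens z) * ennreal (q z))"
      unfolding target_eq by (rule density_density_eq) measurable
    also have "(\<lambda>z. ennreal (pdens z) * ennreal (q z)) = (\<lambda>z. ennreal (f (z $ i1) * (\<Prod>j\<in>UNIV - {i1}. g j (z $ i1) (z $ j))))"
    proof
      fix z
      have "pdens z * q z = f (z $ i1) * (\<Prod>j\<in>UNIV - {i1}. g j (z $ i1) (z $ j))"
        using pdens_pos[of z] by (simp add: q_def)
      then show "ennreal (pdens z) * ennreal (q z) = ennreal (f (z $ i1) * (\<Prod>j\<in>UNIV - {i1}. g j (z $ i1) (z $ j)))"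
        using pdens_pos[of z] by (simp add: ennreal_mult'[symmetric])
    qed
    finally show ?thesis using N_eq by simp
  qed
  have inv: "subdens i1 S D x = inverse (q (starmap i1 S x))" for x
  proof -
    have "(\<Prod>i\<in>UNIV. D i (x $ i1) (x $ i)) = D i1 (x $ i1) (x $ i1) * (\<Prod>j\<in>UNIV - {i1}. D j (x $ i1) (x $ j))"
      by (rule prod_eq_insert_UNIV)
    also have "\<dots> = (std_normal_density (x $ i1) / f (S i1 0 (x $ i1))) *
       (\<Prod>j\<in>UNIV - {i1}. std_normal_density (x $ j) / g j (S i1 0 (x $ i1)) (S j (x $ i1) (x $ j)))"
      by (auto simp: D_def intro!: prod.cong arg_cong2[where f="(*)"])
    also have "\<dots> = (std_normal_density (x $ i1) * (\<Prod>j\<in>UNIV - {i1}. std_normal_density (x $ j))) /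
       (f (S i1 0 (x $ i1)) * (\<Prod>j\<in>UNIV - {i1}. g j (S i1 0 (x $ i1)) (S j (x $ i1) (x $ j))))"
      by (simp add: prod_dividef)
    also have "std_normal_density (x $ i1) * (\<Prod>j\<in>UNIV - {i1}. std_normal_density (x $ j)) = gdens x"
      unfolding gdens_def by (rule prod_eq_insert_UNIV[symmetric])
    finally have P: "(\<Prod>i\<in>UNIV. D i (x $ i1) (x $ i)) = gdens x /
       (f (S i1 0 (x $ i1)) * (\<Prod>j\<in>UNIV - {i1}. g j (S i1 0 (x $ i1)) (S j (x $ i1) (x $ j))))" .
    show ?thesis unfolding subdens_def P q_def using gdens_pos[of x] S1[of "x $ i1"] by simp
  qed
  have "integrable ?N (\<lambda>z. ln (q z))"
    by (rule KL_density(2)[OF prob_space_target pN _ q0 N_q fin]) simp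
  then have int: "integrable gauss (\<lambda>x. ln (q (starmap i1 S x)))"
    by (subst (asm) integrable_distr_eq) auto
  \<comment> \<open>At \<open>q = 0\<close> both sides are 0, by the values of
    \<open>inverse\<close> and \<open>ln\<close> there.\<close>
  have ln_inv: "ln (subdens i1 S D x) = - ln (q (starmap i1 S x))" for x
    unfolding inv using q0[of "starmap i1 S x"] by (cases "q (starmap i1 S x) = 0") (auto simp: ln_inverse)
  have "KL ?N (target V) = ereal (\<integral>z. ln (q z) \<partial>?N)"
    by (rule KL_density(1)[OF prob_space_target pN _ q0 N_q]) (simp, fact)
  also have "(\<integral>z. ln (q z) \<partial>?N) = (\<integral>x. ln (q (starmap i1 S x)) \<partial>gauss)"
    by (subst integral_distr) auto
  also have "\<dots> = - (\<integral>x. ln (subdens i1 S D x) \<partial>gauss)" by (simp add: ln_inv)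
  finally show thesis using D int by (intro that[of D]) (simp_all add: ln_inv)
qed

end

section \<open>Quantile transforms and the Knothe-Rosenblatt map\<close>

text \<open>\<open>normal_quantile M\<close> pushes the standard normal law to \<open>M\<close>; it composes the quantile function
  of \<open>M\<close> with the normal distribution function.\<close>
definition normal_quantile :: "real measure \<Rightarrow> real \<Rightarrow> real" where
  "normal_quantile M u = Inf {x. cdf stdn u \<le> cdf M x}"

lemma real_distribution_stdn: "real_distribution stdn"
  by (simp add: real_distribution_def real_distribution_axioms_def stdn.prob_space_axioms)

interpretation stdn: real_distribution stdn by (rule real_distribution_stdn)

lemma cdf_stdn_strict_mono: "strict_mono (cdf stdn)"
proof (rule strict_monoI)
  fix x y :: real assume xy: "x < y"
  have "cdf stdn y - cdf stdn x = measure stdn {x<..y}" using stdn.cdf_diff_eq[OF xy] .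
  moreover have "measure stdn {x<..y} \<noteq> 0"
  proof
    assume "measure stdn {x<..y} = 0"
    then have "emeasure stdn {x<..y} = 0" by (simp add: stdn.emeasure_eq_measure)
    then have "{x<..y} \<in> null_sets stdn" by auto
    then have "AE u in lborel. u \<notin> {x<..y}" unfolding AE_stdn_iff[symmetric] by (rule AE_not_in)
    then have "{x<..y} \<in> null_sets lborel" by (subst AE_iff_null_sets) auto
    then show False using xy by (auto dest: null_setsD1)
  qed
  ultimately show "cdf stdn x < cdf stdn y" using measure_nonneg[of stdn "{x<..y}"] by linarith
qed

lemma stdn_singleton: "measure stdn {x} = 0"
proof -
  have "AE u in stdn. u \<notin> {x}" unfolding AE_stdn_iff using AE_lborel_singleton[of x] by simp
  then have "{x} \<in> null_sets stdn" by (subst AE_iff_null_sets) auto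
  then show ?thesis by (auto simp: measure_def)
qed

lemma isCont_cdf_stdn: "isCont (cdf stdn) x"
  using stdn.isCont_cdf[of x] stdn_singleton by simp

lemma cdf_stdn_bounds: "0 < cdf stdn u" "cdf stdn u < 1"
proof -
  have "cdf stdn (u - 1) < cdf stdn u" "cdf stdn u < cdf stdn (u + 1)"
    using cdf_stdn_strict_mono by (auto simp: strict_mono_def)
  then show "0 < cdf stdn u" "cdf stdn u < 1"
    using stdn.cdf_nonneg[of "u - 1"] stdn.cdf_bounded_prob[of "u + 1"] by linarith+
qed

text \<open>The Galois connection between quantiles and distribution functions. It holds for every
  real \<open>u\<close> because the normal distribution function stays strictly between 0 and 1;
  law, measurability and monotonicity of quantiles are all read off from it.\<close>

lemma normal_quantile_le_iff:
  assumes "real_distribution M"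
  shows "normal_quantile M u \<le> x \<longleftrightarrow> cdf stdn u \<le> cdf M x"
proof -
  interpret M: cdf_distribution M by (rule cdf_distribution.intro[OF assms])
  show ?thesis unfolding normal_quantile_def by (rule M.pseudoinverse[OF cdf_stdn_bounds, symmetric])
qed

text \<open>A quantile function is flat only at atoms: if \<open>u < v\<close> had the same quantile
  \<open>x\<close>, the distribution function would jump at \<open>x\<close> from at most
  \<open>cdf stdn u\<close> to at least \<open>cdf stdn v\<close>.\<close>

lemma strict_mono_normal_quantile:
  assumes M: "real_distribution M" and atomless: "\<And>x. measure M {x} = 0"
  shows "strict_mono (normal_quantile M)"
proof (rule strict_monoI, rule ccontr)
  interpret M: real_distribution M by fact
  fix u v :: real assume uv: "u < v" and "\<not> normal_quantile M u < normal_quantile M v"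
  then have le: "normal_quantile M v \<le> normal_quantile M u" by simp
  let ?x = "normal_quantile M u"
  have v: "cdf stdn v \<le> cdf M ?x" using le normal_quantile_le_iff[OF M] by blast
  have c: "isCont (cdf M) ?x" using M.isCont_cdf atomless by simp
  have "cdf M ?x \<le> cdf stdn u"
  proof (rule tendsto_upperbound)
    show "(cdf M \<longlongrightarrow> cdf M ?x) (at_left ?x)"
      using c by (simp add: isCont_def filterlim_at_split)
    show "eventually (\<lambda>y. cdf M y \<le> cdf stdn u) (at_left ?x)"
      unfolding eventually_at_left_field
    proof (intro exI[of _ "?x - 1"] conjI allI impI)
      fix y assume "y > ?x - 1" "y < ?x"
      then have "\<not> cdf stdn u \<le> cdf M y" using normal_quantile_le_iff[OF M, of u y] by simp
      then show "cdf M y \<le> cdf stdn u" by simp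
    qed simp
  qed simp
  then show False using v strict_monoD[OF cdf_stdn_strict_mono uv] by simp
qed

lemma borel_measurable_normal_quantile:
  assumes M: "real_distribution M"
  shows "normal_quantile M \<in> borel_measurable borel"
proof (rule borel_measurable_mono, rule monoI)
  fix u v :: real assume "u \<le> v"
  then have "cdf stdn u \<le> cdf stdn v" by (rule stdn.cdf_nondecreasing)
  also have "\<dots> \<le> cdf M (normal_quantile M v)" using normal_quantile_le_iff[OF M, of v] by blast
  finally show "normal_quantile M u \<le> normal_quantile M v" using normal_quantile_le_iff[OF M] by blast
qed

text \<open>The probability integral transform: the normal distribution function maps
  \<open>stdn\<close> to the uniform law. The levels 0 and 1 are not attained, which makes them
  separate cases.\<close>

lemma measure_stdn_cdf_le:
  assumes "0 \<le> p" "p \<le> 1"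
  shows "measure stdn {u. cdf stdn u \<le> p} = p"
proof -
  consider "p = 0" | "p = 1" | "0 < p" "p < 1" using assms by linarith
  then show ?thesis
  proof cases
    case 1
    then have "{u. cdf stdn u \<le> p} = {}" using cdf_stdn_bounds(1) by (auto simp: not_le)
    then show ?thesis using 1 by simp
  next
    case 2
    then have "{u. cdf stdn u \<le> p} = UNIV" using cdf_stdn_bounds(2) by (auto simp: less_imp_le)
    then show ?thesis using 2 stdn.prob_space by simp
  next
    case 3
    obtain a where a: "cdf stdn a < p"
      using order_tendstoD(2)[OF stdn.cdf_lim_at_bot 3(1)] by (auto dest: eventually_happens)
    obtain b where b: "p < cdf stdn b"
      using order_tendstoD(1)[OF stdn.cdf_lim_at_top_prob 3(2)] by (auto dest: eventually_happens)
    have "a \<le> b" using a b stdn.cdf_nondecreasing[of b a] by (cases "a \<le> b") auto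
    then obtain x where x: "cdf stdn x = p"
      using IVT[of "cdf stdn" a p b] a b isCont_cdf_stdn by auto
    then have "{u. cdf stdn u \<le> p} = {..x}"
      using strict_mono_less_eq[OF cdf_stdn_strict_mono] by auto
    then show ?thesis using x by (simp add: cdf_def)
  qed
qed

lemma distr_normal_quantile:
  assumes M: "real_distribution M"
  shows "distr stdn borel (normal_quantile M) = M"
proof (rule cdf_unique)
  interpret M: real_distribution M by fact
  note [measurable] = borel_measurable_normal_quantile[OF M]
  show "real_distribution (distr stdn borel (normal_quantile M))"
    using stdn.prob_space_distr[of "normal_quantile M" borel]
    by (simp add: real_distribution_def real_distribution_axioms_def cong: measurable_cong_sets)
  show "cdf (distr stdn borel (normal_quantile M)) = cdf M"
  proof
    fix x
    have "cdf (distr stdn borel (normal_quantile M)) x = measure stdn {u. normal_quantile M u \<le> x}"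
      unfolding cdf_def by (subst measure_distr) (auto intro!: arg_cong2[where f=measure])
    also have "\<dots> = cdf M x"
      unfolding normal_quantile_le_iff[OF M]
      by (rule measure_stdn_cdf_le) (auto intro: M.cdf_nonneg M.cdf_bounded_prob)
    finally show "cdf (distr stdn borel (normal_quantile M)) x = cdf M x" .
  qed
qed fact

text \<open>By the Galois connection the sublevel set at \<open>x\<close> is given by
  \<open>cdf stdn u \<le> cdf (K (s p)) x\<close>, an inequality between measurable functions of
  \<open>u\<close> and of \<open>p\<close>.\<close>

lemma normal_quantile_section_borel:
  fixes K :: "real \<Rightarrow> real measure" and s :: "real \<Rightarrow> real"
  assumes K: "\<And>z. real_distribution (K z)"
    and Km: "\<And>A. A \<in> sets borel \<Longrightarrow> (\<lambda>z. emeasure (K z) A) \<in> borel_measurable borel"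
    and s[measurable]: "s \<in> borel_measurable borel"
  shows "(\<lambda>(p, u). normal_quantile (K (s p)) u) \<in> borel_measurable (borel \<Otimes>\<^sub>M borel)"
  unfolding borel_measurable_iff_le
proof
  fix x :: real
  have [measurable]: "(\<lambda>z. cdf (K z) x) \<in> borel_measurable borel"
    unfolding cdf_def measure_def using Km[of "{..x}"] by measurable
  have [measurable]: "cdf stdn \<in> borel_measurable borel"
    by (intro borel_measurable_mono monoI stdn.cdf_nondecreasing)
  have "{w \<in> space (borel \<Otimes>\<^sub>M borel). cdf stdn (snd w) \<le> cdf (K (s (fst w))) x} \<in> sets (borel \<Otimes>\<^sub>M borel)"
    by measurable
  then show "{w \<in> space (borel \<Otimes>\<^sub>M borel). (case w of (p, u) \<Rightarrow> normal_quantile (K (s p)) u) \<le> x} \<in> sets (borel \<Otimes>\<^sub>M borel)"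
    by (simp add: case_prod_unfold normal_quantile_le_iff[OF K])
qed

lemma density_singleton:
  assumes "M = density lborel f" and [measurable]: "f \<in> borel_measurable borel"
  shows "measure M {x::real} = 0"
proof -
  have "absolutely_continuous lborel M" unfolding assms(1) by (rule absolutely_continuousI_density) simp
  then have "{x} \<in> null_sets M"
    using finite_imp_null_set_lborel[of "{x}"] by (auto simp: absolutely_continuous_def)
  then show ?thesis by (auto simp: measure_def)
qed

text \<open>The Knothe--Rosenblatt map. On the null set of \<open>z\<^sub>1\<close> whose conditional laws may have atoms, where
  quantile functions are not strictly increasing, it is replaced by the identity.\<close>
lemma exists_starmap_distr:
  fixes \<mu> :: "(real^'n) measure"
  assumes \<mu>: "sets \<mu> = sets borel" "prob_space \<mu>" and k: "star_kernel i1 \<mu> \<mu>1 K"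
    and ac: "absolutely_continuous lborel \<mu>"
  obtains S where "star_family i1 S" "distr gauss borel (starmap i1 S) = \<mu>"
proof -
  obtain f g where f: "f \<in> borel_measurable borel" and f_eq: "\<mu>1 = density lborel (\<lambda>z. ennreal (f z))"
    and g: "\<And>j. case_prod (g j) \<in> borel_measurable (borel \<Otimes>\<^sub>M borel)"
    and gK: "\<And>j. j \<noteq> i1 \<Longrightarrow> AE z in \<mu>1. K j z = density lborel (\<lambda>w. ennreal (g j z w))"
    by (rule star_kernel_densities[OF \<mu> k ac]) auto
  note [measurable] = f
  have gs[measurable]: "g j z \<in> borel_measurable borel" for j z
    by (rule borel_measurable_section[OF g(1)])
  have \<mu>1: "real_distribution \<mu>1"
    using k by (simp add: star_kernel_def real_distribution_def real_distribution_axioms_def)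
  have K: "real_distribution (K j z)" for j z
    using k by (simp add: star_kernel_def real_distribution_def real_distribution_axioms_def)
  have Km: "A \<in> sets borel \<Longrightarrow> (\<lambda>z. emeasure (K j z) A) \<in> borel_measurable borel" for j A
    using k by (auto simp: star_kernel_def)
  have \<mu>1_sets: "sets \<mu>1 = sets borel" using k by (simp add: star_kernel_def)
  define s where "s = normal_quantile \<mu>1"
  have s[measurable]: "s \<in> borel_measurable borel" unfolding s_def by (rule borel_measurable_normal_quantile[OF \<mu>1])
  have ds: "distr stdn borel s = \<mu>1" unfolding s_def by (rule distr_normal_quantile[OF \<mu>1])
  have s_mono: "strict_mono s"
    unfolding s_def by (rule strict_mono_normal_quantile[OF \<mu>1 density_singleton[OF f_eq]]) measurable
  have "AE z in \<mu>1. \<forall>j\<in>UNIV - {i1}. K j z = density lborel (\<lambda>w. ennreal (g j z w))"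
    by (subst AE_ball_countable) (auto intro: gK)
  then obtain N where N: "{z \<in> space \<mu>1. \<not> (\<forall>j\<in>UNIV - {i1}. K j z = density lborel (\<lambda>w. ennreal (g j z w)))} \<subseteq> N"
    "emeasure \<mu>1 N = 0" "N \<in> sets \<mu>1" by (rule AE_E)
  have [measurable]: "N \<in> sets borel" using N(3) \<mu>1_sets by simp
  have sp: "space \<mu>1 = UNIV" using sets_eq_imp_space_eq[OF \<mu>1_sets] by simp
  have atomless: "measure (K j z) {x} = 0" if "z \<notin> N" "j \<noteq> i1" for j z x
  proof -
    have "K j z = density lborel (\<lambda>w. ennreal (g j z w))" using N(1) that sp by blast
    then show ?thesis by (rule density_singleton) measurable
  qed
  define S where "S j p u = (if j = i1 then s u else if s p \<in> N then u else normal_quantile (K j (s p)) u)" for j p u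
  have Sm: "case_prod (S j) \<in> borel_measurable (borel \<Otimes>\<^sub>M borel)" for j
  proof -
    have [measurable]: "(\<lambda>x. normal_quantile (K j (s (fst x))) (snd x)) \<in> borel_measurable (borel \<Otimes>\<^sub>M borel)"
      using normal_quantile_section_borel[where K="K j", OF K Km s] by (simp add: case_prod_unfold)
    show ?thesis unfolding S_def case_prod_unfold by measurable
  qed
  have S: "star_family i1 S"
    unfolding star_family_def
  proof (intro conjI allI)
    fix p q show "S i1 p = S i1 q" by (simp add: S_def fun_eq_iff)
  next
    fix i p
    consider "i = i1" | "i \<noteq> i1" "s p \<in> N" | "i \<noteq> i1" "s p \<notin> N" by blast
    then show "strict_mono (S i p)"
    proof cases
      case 1 then show ?thesis using s_mono by (simp add: S_def strict_mono_def)
    next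
      case 2 then show ?thesis by (simp add: S_def strict_mono_def)
    next
      case 3
      then show ?thesis using strict_mono_normal_quantile[OF K atomless[OF 3(2,1)]] by (simp add: S_def strict_mono_def)
    qed
  qed (rule Sm)
  have S1: "S i1 0 = s" by (simp add: S_def fun_eq_iff)
  \<comment> \<open>The kernel of the law of the constructed map. At \<open>s p\<close> it agrees
    with \<open>K\<close> for almost every \<open>p\<close>, and this is enough to match all
    rectangles.\<close>
  obtain K' where K': "star_kernel i1 (distr gauss borel (starmap i1 S)) \<mu>1 K'"
    and K'S: "\<And>j p. K' j (s p) = distr stdn borel (S j p)"
    using starmap_star_kernel[OF S] unfolding S1 ds by blast
  have T: "starmap i1 S \<in> borel_measurable borel" by (rule borel_measurable_starmap[OF Sm])
  have sN: "AE p in stdn. s p \<notin> N"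
  proof -
    have "AE z in \<mu>1. z \<notin> N" using N by (intro AE_not_in) auto
    then show ?thesis unfolding ds[symmetric] by (subst (asm) AE_distr_iff) auto
  qed
  have "\<mu> = distr gauss borel (starmap i1 S)"
  proof (rule measure_eqI_rect[OF \<mu>(2,1)])
    fix A :: "'n \<Rightarrow> real set" assume A[measurable]: "\<And>j. A j \<in> sets borel"
    have K'm: "A \<in> sets borel \<Longrightarrow> (\<lambda>z. emeasure (K' j z) A) \<in> borel_measurable borel" for j A
      using K' by (auto simp: star_kernel_def)
    have "emeasure \<mu> {z. \<forall>j. z $ j \<in> A j} = (\<integral>\<^sup>+z1. indicator (A i1) z1 * (\<Prod>j\<in>UNIV - {i1}. emeasure (K j z1) (A j)) \<partial>distr stdn borel s)"
      using k A by (simp add: star_kernel_def ds)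
    also have "\<dots> = (\<integral>\<^sup>+p. indicator (A i1) (s p) * (\<Prod>j\<in>UNIV - {i1}. emeasure (K j (s p)) (A j)) \<partial>stdn)"
      by (rule nn_integral_distr) (auto intro!: borel_measurable_times_ennreal borel_measurable_prod_ennreal Km)
    also have "\<dots> = (\<integral>\<^sup>+p. indicator (A i1) (s p) * (\<Prod>j\<in>UNIV - {i1}. emeasure (K' j (s p)) (A j)) \<partial>stdn)"
    proof (rule nn_integral_cong_AE)
      show "AE p in stdn. indicator (A i1) (s p) * (\<Prod>j\<in>UNIV - {i1}. emeasure (K j (s p)) (A j))
         = indicator (A i1) (s p) * (\<Prod>j\<in>UNIV - {i1}. emeasure (K' j (s p)) (A j))"
        using sN
      proof eventually_elim
        case (elim p)
        have "K' j (s p) = K j (s p)" if "j \<noteq> i1" for j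
        proof -
          have "S j p = normal_quantile (K j (s p))" using that elim by (simp add: S_def fun_eq_iff)
          then show ?thesis unfolding K'S using distr_normal_quantile[OF K] by simp
        qed
        then show ?case by (auto intro!: arg_cong2[where f="(*)"] prod.cong)
      qed
    qed
    also have "\<dots> = (\<integral>\<^sup>+z1. indicator (A i1) z1 * (\<Prod>j\<in>UNIV - {i1}. emeasure (K' j z1) (A j)) \<partial>distr stdn borel s)"
      by (rule nn_integral_distr[symmetric]) (auto intro!: borel_measurable_times_ennreal borel_measurable_prod_ennreal K'm)
    also have "\<dots> = emeasure (distr gauss borel (starmap i1 S)) {z. \<forall>j. z $ j \<in> A j}"
      using K' A by (simp add: star_kernel_def ds)
    finally show "emeasure \<mu> {z. \<forall>j. z $ j \<in> A j} = emeasure (distr gauss borel (starmap i1 S)) {z. \<forall>j. z $ j \<in> A j}" .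
  qed simp
  with S show thesis by (intro that) auto
qed

section \<open>Strong convexity\<close>

text \<open>The Jensen defect of \<open>ln\<close>: the part of the strong concavity that controls
  the derivatives.\<close>

definition ln_gap :: "real \<Rightarrow> real \<Rightarrow> real \<Rightarrow> real" where
  "ln_gap t a b = ln ((1 - t) * a + t * b) - (1 - t) * ln a - t * ln b"

lemma ln_gap_nonneg:
  assumes "0 \<le> t" "t \<le> 1" "0 < a" "0 < b"
  shows "0 \<le> ln_gap t a b"
proof -
  define c where "c = (1 - t) * a + t * b"
  have c: "0 < c"
    unfolding c_def using assms by (cases "t = 1") (auto intro!: add_pos_nonneg)
  have "ln a - ln c \<le> a / c - 1" "ln b - ln c \<le> b / c - 1"
    using ln_le_minus_one[of "a / c"] ln_le_minus_one[of "b / c"] assms c by (auto simp: ln_div)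
  then have "(1 - t) * (ln a - ln c) + t * (ln b - ln c) \<le> (1 - t) * (a / c - 1) + t * (b / c - 1)"
    using assms by (intro add_mono mult_left_mono) auto
  also have "\<dots> = ((1 - t) * a + t * b) / c - 1"
    using c by (simp add: field_simps)
  also have "\<dots> = 0" using c by (simp add: c_def[symmetric])
  finally show ?thesis unfolding ln_gap_def c_def[symmetric] by (simp add: algebra_simps)
qed

text \<open>The gap at \<open>t = 1/2\<close> equals \<open>ln (cosh ((ln a - ln b) / 2))\<close>.\<close>
lemma ln_gap_half_bound:
  assumes "0 < a" "0 < b" "ln_gap (1/2) a b \<le> 1"
  shows "(ln a - ln b)\<^sup>2 \<le> 32 * ln_gap (1/2) a b"
proof -
  define g where "g = ln_gap (1/2) a b"
  define v where "v = \<bar>ln a - ln b\<bar> / 2"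
  have g0: "0 \<le> g" unfolding g_def using assms by (intro ln_gap_nonneg) auto
  have "(1 - 1/2) * a + 1/2 * b = (a + b) / 2" by simp
  then have g_eq: "g = ln ((a + b) / 2) - (ln a / 2 + ln b / 2)" by (simp only: g_def ln_gap_def) simp
  have "exp g = ((a + b) / 2) / (exp (ln a / 2) * exp (ln b / 2))"
    unfolding g_eq exp_diff exp_add using assms by simp
  also have "\<dots> = (exp (ln a) + exp (ln b)) / 2 / (exp (ln a / 2) * exp (ln b / 2))"
    using assms by simp
  also have "\<dots> = (exp ((ln a - ln b) / 2) + exp (- ((ln a - ln b) / 2))) / 2"
  proof -
    define A B where "A = exp (ln a / 2)" and "B = exp (ln b / 2)"
    have "exp (ln a) = A * A" "exp (ln b) = B * B" unfolding A_def B_def exp_add[symmetric] by simp_all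
    moreover have "exp ((ln a - ln b) / 2) = A / B"
      unfolding diff_divide_distrib exp_diff A_def B_def ..
    moreover have "- ((ln a - ln b) / 2) = ln b / 2 - ln a / 2" by (simp add: diff_divide_distrib)
    then have "exp (- ((ln a - ln b) / 2)) = B / A"
      by (simp only: exp_diff A_def B_def)
    moreover have "0 < A" "0 < B" by (simp_all add: A_def B_def)
    ultimately show ?thesis
      unfolding A_def[symmetric] B_def[symmetric] by (simp only:) (simp add: field_simps)
  qed
  also have "\<dots> = (exp v + exp (- v)) / 2"
    unfolding v_def by (cases "ln a \<ge> ln b") (auto simp: abs_if diff_divide_distrib)
  finally have "exp g = (exp v + exp (- v)) / 2" .
  moreover have "1 + v + v\<^sup>2 / 2 \<le> exp v" by (rule exp_lower_Taylor_quadratic) (simp add: v_def)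
  moreover have "1 + (- v) \<le> exp (- v)" by (rule exp_ge_add_one_self)
  moreover have "exp g \<le> 1 + g + g\<^sup>2" using g0 assms(3) by (intro exp_bound) (auto simp: g_def)
  moreover have "g\<^sup>2 \<le> g" using g0 assms(3) by (simp add: g_def power2_eq_square mult_left_le)
  \<comment> \<open>The two exponential bounds add up to
    \<open>exp g \<ge> 1 + v\<^sup>2 / 4\<close>, while \<open>exp g \<le> 1 + 2 * g\<close> for
    \<open>g \<le> 1\<close>. The restriction on \<open>g\<close> matters:
    \<open>ln (cosh v)\<close> grows only linearly, so no such quadratic bound holds for large
    gaps.\<close>
  ultimately have "v\<^sup>2 \<le> 8 * g" by (simp add: field_simps)
  moreover have "(ln a - ln b)\<^sup>2 = 4 * v\<^sup>2" by (simp add: v_def power_divide)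
  ultimately show ?thesis by (simp add: g_def)
qed

text \<open>Square roots turn the bound into a geometric series of ratio \<open>sqrt (1/2)\<close>.
  It is asked for eventually, because the logarithms of the derivatives are controlled only once
  their Jensen defect is at most 1.\<close>

lemma convergent_of_fast_increments:
  fixes a :: "nat \<Rightarrow> real"
  assumes "eventually (\<lambda>n. (a (Suc n) - a n)\<^sup>2 \<le> C / 2 ^ n) sequentially"
  shows "convergent a"
proof -
  have "summable (\<lambda>n. a (Suc n) - a n)"
  proof (rule summable_comparison_test_ev)
    show "eventually (\<lambda>n. norm (a (Suc n) - a n) \<le> sqrt C * sqrt (1/2) ^ n) sequentially"
      using assms
    proof eventually_elim
      case (elim n)
      have "\<bar>a (Suc n) - a n\<bar> = sqrt ((a (Suc n) - a n)\<^sup>2)" by simp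
      also have "\<dots> \<le> sqrt (C / 2 ^ n)" using elim by (simp only: real_sqrt_le_iff)
      also have "\<dots> = sqrt C * sqrt (1/2) ^ n"
        by (simp add: real_sqrt_divide real_sqrt_power power_divide)
      finally show ?case by simp
    qed
    show "summable (\<lambda>n. sqrt C * sqrt (1/2) ^ n)"
      by (intro summable_mult summable_geometric) (simp add: real_sqrt_lt_1_iff)
  qed
  then have "convergent (\<lambda>n. \<Sum>k<n. a (Suc k) - a k)" by (simp add: summable_iff_convergent)
  then have "convergent (\<lambda>n. a n - a 0)" by (simp add: sum_lessThan_telescope)
  then have "convergent (\<lambda>n. (a n - a 0) + a 0)" by (intro convergent_add convergent_const)
  then show ?thesis by simp
qed

text \<open>A convex combination acts on each section \<open>S i p\<close> separately because
  \<open>p\<close> is the source coordinate. In terms of images, the two maps would have to be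
  combined at different conditioning values for the same point.\<close>

lemma star_family_convex:
  assumes S: "star_family i1 S0" "star_family i1 S1" and t: "0 \<le> t" "t \<le> 1"
  shows "star_family i1 (\<lambda>i p u. (1 - t) * S0 i p u + t * S1 i p u)"
proof -
  have "case_prod (\<lambda>p u. (1 - t) * S0 i p u + t * S1 i p u) \<in> borel_measurable (borel \<Otimes>\<^sub>M borel)" for i
  proof -
    have "case_prod (S0 i) \<in> borel_measurable (borel \<Otimes>\<^sub>M borel)" "case_prod (S1 i) \<in> borel_measurable (borel \<Otimes>\<^sub>M borel)"
      using S by (auto simp: star_family_def)
    then show ?thesis unfolding case_prod_unfold by measurable
  qed
  moreover have "S0 i1 p = S0 i1 q" "S1 i1 p = S1 i1 q" for p q using S unfolding star_family_def by blast+
  then have "(\<lambda>u. (1 - t) * S0 i1 p u + t * S1 i1 p u) = (\<lambda>u. (1 - t) * S0 i1 q u + t * S1 i1 q u)" for p q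
    by metis
  moreover have "strict_mono (\<lambda>u. (1 - t) * S0 i p u + t * S1 i p u)" for i p
  proof (rule strict_monoI)
    fix u v :: real assume "u < v"
    then have "S0 i p u < S0 i p v" "S1 i p u < S1 i p v"
      using S by (auto simp: star_family_def strict_mono_def)
    then show "(1 - t) * S0 i p u + t * S1 i p u < (1 - t) * S0 i p v + t * S1 i p v"
      using t by (cases "t = 1") (auto intro!: add_less_le_mono mult_strict_left_mono mult_left_mono)
  qed
  ultimately show ?thesis unfolding star_family_def by simp
qed

lemma subderivative_convex:
  assumes D: "subderivative i1 S0 D0" "subderivative i1 S1 D1" and S: "star_family i1 S0" "star_family i1 S1"
    and t: "0 \<le> t" "t \<le> 1"
  shows "subderivative i1 (\<lambda>i p u. (1 - t) * S0 i p u + t * S1 i p u) (\<lambda>i p u. (1 - t) * D0 i p u + t * D1 i p u)"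
proof -
  have m: "case_prod (D0 i) \<in> borel_measurable (borel \<Otimes>\<^sub>M borel)" "case_prod (D1 i) \<in> borel_measurable (borel \<Otimes>\<^sub>M borel)" for i
    using D by (auto simp: subderivative_def)
  have [measurable]: "D0 i p \<in> borel_measurable borel" "D1 i p \<in> borel_measurable borel" for i p
    using borel_measurable_section[OF m(1)] borel_measurable_section[OF m(2)] by auto
  have "case_prod (\<lambda>p u. (1 - t) * D0 i p u + t * D1 i p u) \<in> borel_measurable (borel \<Otimes>\<^sub>M borel)" for i
    using m[of i] unfolding case_prod_unfold by measurable
  moreover have "D0 i1 p = D0 i1 q" "D1 i1 p = D1 i1 q" for p q using D unfolding subderivative_def by blast+
  then have "(\<lambda>u. (1 - t) * D0 i1 p u + t * D1 i1 p u) = (\<lambda>u. (1 - t) * D0 i1 q u + t * D1 i1 q u)" for p q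
    by metis
  moreover have nn: "0 \<le> D0 i p u" "0 \<le> D1 i p u" for i p u using D by (auto simp: subderivative_def)
  then have "0 \<le> (1 - t) * D0 i p u + t * D1 i p u" for i p u using t by simp
  moreover have "AE p in stdn. AE u in stdn. 0 < (1 - t) * D0 i p u + t * D1 i p u" for i
  proof -
    have "AE p in stdn. AE u in stdn. 0 < D0 i p u" "AE p in stdn. AE u in stdn. 0 < D1 i p u"
      using D by (auto simp: subderivative_def)
    then show ?thesis
    proof eventually_elim
      case (elim p)
      from elim show ?case
      proof eventually_elim
        case (elim u)
        then show ?case using t by (cases "t = 1") (auto intro!: add_pos_nonneg)
      qed
    qed
  qed
  moreover have "AE p in stdn. \<forall>u v. u < v \<longrightarrow>
        (\<integral>\<^sup>+w. ennreal ((1 - t) * D0 i p w + t * D1 i p w) * indicator {u<..<v} w \<partial>lborel)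
         \<le> ennreal (((1 - t) * S0 i p v + t * S1 i p v) - ((1 - t) * S0 i p u + t * S1 i p u))" for i
  proof -
    have "AE p in stdn. \<forall>u v. u < v \<longrightarrow>
        (\<integral>\<^sup>+w. ennreal (D0 i p w) * indicator {u<..<v} w \<partial>lborel) \<le> ennreal (S0 i p v - S0 i p u)"
      "AE p in stdn. \<forall>u v. u < v \<longrightarrow>
        (\<integral>\<^sup>+w. ennreal (D1 i p w) * indicator {u<..<v} w \<partial>lborel) \<le> ennreal (S1 i p v - S1 i p u)"
      using D by (auto simp: subderivative_def)
    then show ?thesis
    proof eventually_elim
      case (elim p)
      show ?case
      proof (intro allI impI)
        fix u v :: real assume uv: "u < v"
        have mono: "S0 i p u \<le> S0 i p v" "S1 i p u \<le> S1 i p v"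
          using S uv by (auto simp: star_family_def strict_mono_def less_imp_le)
        have "(\<integral>\<^sup>+w. ennreal ((1 - t) * D0 i p w + t * D1 i p w) * indicator {u<..<v} w \<partial>lborel)
           = (\<integral>\<^sup>+w. ennreal (1 - t) * (ennreal (D0 i p w) * indicator {u<..<v} w) +
                ennreal t * (ennreal (D1 i p w) * indicator {u<..<v} w) \<partial>lborel)"
          using t nn by (intro nn_integral_cong) (auto simp: indicator_def ennreal_mult)
        also have "\<dots> = ennreal (1 - t) * (\<integral>\<^sup>+w. ennreal (D0 i p w) * indicator {u<..<v} w \<partial>lborel) +
             ennreal t * (\<integral>\<^sup>+w. ennreal (D1 i p w) * indicator {u<..<v} w \<partial>lborel)"
          by (subst nn_integral_add) (auto simp: nn_integral_cmult)
        also have "\<dots> \<le> ennreal (1 - t) * ennreal (S0 i p v - S0 i p u) + ennreal t * ennreal (S1 i p v - S1 i p u)"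
          using elim uv by (intro add_mono mult_left_mono) auto
        also have "\<dots> = ennreal ((1 - t) * (S0 i p v - S0 i p u) + t * (S1 i p v - S1 i p u))"
          using t mono by (simp add: ennreal_mult)
        finally show "(\<integral>\<^sup>+w. ennreal ((1 - t) * D0 i p w + t * D1 i p w) * indicator {u<..<v} w \<partial>lborel)
         \<le> ennreal (((1 - t) * S0 i p v + t * S1 i p v) - ((1 - t) * S0 i p u + t * S1 i p u))"
          by (simp add: algebra_simps)
      qed
    qed
  qed
  ultimately show ?thesis unfolding subderivative_def by simp
qed

lemma starmap_convex:
  "starmap i1 (\<lambda>i p u. (1 - t) * S0 i p u + t * S1 i p u) x = (1 - t) *\<^sub>R starmap i1 S0 x + t *\<^sub>R starmap i1 S1 x"
  by (simp add: vec_eq_iff)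

context strong_potential
begin

lemma ln_subdens:
  assumes "\<forall>i. 0 < D i (x $ i1) (x $ i)"
  shows "ln (subdens i1 S D x) = (\<Sum>i\<in>UNIV. ln (D i (x $ i1) (x $ i))) - V (starmap i1 S x) - ln Z - ln (gdens x)"
proof -
  have aux: "ln (a * b / c) = ln a + ln b - ln c" if "0 < a" "0 < b" "0 < c" for a b c :: real
    using that by (simp add: ln_div ln_mult)
  have "ln (subdens i1 S D x) = ln (\<Prod>i\<in>UNIV. D i (x $ i1) (x $ i)) + ln (pdens (starmap i1 S x)) - ln (gdens x)"
  proof -
    have "0 < (\<Prod>i\<in>UNIV. D i (x $ i1) (x $ i))" using assms by (intro prod_pos) simp
    moreover have "0 < pdens (starmap i1 S x)" "0 < gdens x" by (rule pdens_pos, rule gdens_pos)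
    ultimately show ?thesis
      unfolding subdens_def by (rule aux)
  qed
  also have "ln (\<Prod>i\<in>UNIV. D i (x $ i1) (x $ i)) = (\<Sum>i\<in>UNIV. ln (D i (x $ i1) (x $ i)))"
    using assms by (intro ln_prod) (auto simp: less_imp_neq[symmetric])
  also have "ln (pdens (starmap i1 S x)) = - V (starmap i1 S x) - ln Z"
    using Z_pos by (simp add: pdens_def ln_div)
  finally show ?thesis by simp
qed

text \<open>A lower bound for the surplus in the concavity of \<open>ln subdens\<close> along the
  segment: the quadratic term comes from \<open>V\<close>, the Jensen defects from the
  derivatives.\<close>

definition gap :: "'n \<Rightarrow> real \<Rightarrow> ('n \<Rightarrow> real \<Rightarrow> real \<Rightarrow> real) \<Rightarrow> ('n \<Rightarrow> real \<Rightarrow> real \<Rightarrow> real) \<Rightarrow>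
    ('n \<Rightarrow> real \<Rightarrow> real \<Rightarrow> real) \<Rightarrow> ('n \<Rightarrow> real \<Rightarrow> real \<Rightarrow> real) \<Rightarrow> real^'n \<Rightarrow> real" where
  "gap i1 t S0 D0 S1 D1 x = \<alpha> / 2 * t * (1 - t) * (norm (starmap i1 S1 x - starmap i1 S0 x))\<^sup>2 +
     (\<Sum>i\<in>UNIV. ln_gap t (D0 i (x $ i1) (x $ i)) (D1 i (x $ i1) (x $ i)))"

lemma gap_borel:
  assumes "star_family i1 S0" "star_family i1 S1" "subderivative i1 S0 D0" "subderivative i1 S1 D1"
  shows "gap i1 t S0 D0 S1 D1 \<in> borel_measurable borel"
proof -
  have [measurable]: "starmap i1 S0 \<in> borel_measurable borel" "starmap i1 S1 \<in> borel_measurable borel"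
    using assms by (auto intro!: borel_measurable_starmap simp: star_family_def)
  have [measurable]: "(\<lambda>x::real^'n. D0 i (x $ i1) (x $ i)) \<in> borel_measurable borel"
    "(\<lambda>x::real^'n. D1 i (x $ i1) (x $ i)) \<in> borel_measurable borel" for i
    using assms by (auto intro!: borel_measurable_coords simp: subderivative_def)
  show ?thesis unfolding gap_def ln_gap_def by measurable
qed

text \<open>Pointwise, \<open>V_conv\<close> and the definition of \<open>ln_gap\<close> give the
  inequality with the gap as surplus. Integrability is inherited: \<open>ln r\<close> lies between
  the combination of the two integrable logarithms and \<open>r - 1\<close>, and the gap lies
  between 0 and the difference of \<open>ln r\<close> and that combination.\<close>

lemma ln_subdens_concave:
  assumes S: "star_family i1 S0" "star_family i1 S1" and D: "subderivative i1 S0 D0" "subderivative i1 S1 D1"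
    and t: "0 \<le> t" "t \<le> 1"
    and int: "integrable gauss (\<lambda>x. ln (subdens i1 S0 D0 x))" "integrable gauss (\<lambda>x. ln (subdens i1 S1 D1 x))"
  defines "S \<equiv> \<lambda>i p u. (1 - t) * S0 i p u + t * S1 i p u" and "D \<equiv> \<lambda>i p u. (1 - t) * D0 i p u + t * D1 i p u"
  shows "integrable gauss (\<lambda>x. ln (subdens i1 S D x))"
    and "integrable gauss (gap i1 t S0 D0 S1 D1)"
    and "AE x in gauss. 0 \<le> gap i1 t S0 D0 S1 D1 x"
    and "(1 - t) * (\<integral>x. ln (subdens i1 S0 D0 x) \<partial>gauss) + t * (\<integral>x. ln (subdens i1 S1 D1 x) \<partial>gauss)
        + (\<integral>x. gap i1 t S0 D0 S1 D1 x \<partial>gauss) \<le> (\<integral>x. ln (subdens i1 S D x) \<partial>gauss)"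
proof -
  let ?G = "gap i1 t S0 D0 S1 D1"
  let ?L = "\<lambda>x. (1 - t) * ln (subdens i1 S0 D0 x) + t * ln (subdens i1 S1 D1 x)"
  let ?r = "subdens i1 S D"
  have Sc: "star_family i1 S" unfolding S_def by (rule star_family_convex[OF S t])
  have Dc: "subderivative i1 S D" unfolding S_def D_def by (rule subderivative_convex[OF D S t])
  have [measurable]: "?r \<in> borel_measurable borel" "?G \<in> borel_measurable borel"
    by (rule subdens_borel[OF Sc Dc], rule gap_borel[OF S D])
  have intL: "integrable gauss ?L"
    using int by (intro Bochner_Integration.integrable_add integrable_mult_right) auto
  have key: "AE x in gauss. ?L x + ?G x \<le> ln (?r x) \<and> 0 \<le> ?G x"
    using AE_subderivative_pos[OF D(1)] AE_subderivative_pos[OF D(2)] AE_subderivative_pos[OF Dc]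
  proof eventually_elim
    case (elim x)
    let ?T0 = "starmap i1 S0 x" and ?T1 = "starmap i1 S1 x"
    have "V (starmap i1 S x) \<le> (1 - t) * V ?T0 + t * V ?T1 - \<alpha> / 2 * t * (1 - t) * (norm (?T1 - ?T0))\<^sup>2"
      unfolding S_def starmap_convex by (rule V_conv[OF t])
    moreover have "(\<Sum>i\<in>UNIV. ln (D i (x $ i1) (x $ i))) = (1 - t) * (\<Sum>i\<in>UNIV. ln (D0 i (x $ i1) (x $ i)))
       + t * (\<Sum>i\<in>UNIV. ln (D1 i (x $ i1) (x $ i))) + (\<Sum>i\<in>UNIV. ln_gap t (D0 i (x $ i1) (x $ i)) (D1 i (x $ i1) (x $ i)))"
      unfolding sum_distrib_left sum.distrib[symmetric] by (intro sum.cong) (auto simp: ln_gap_def D_def)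
    ultimately have "?L x + ?G x \<le> ln (?r x)"
      unfolding ln_subdens[of D0, OF elim(1)] ln_subdens[of D1, OF elim(2)] ln_subdens[of D, OF elim(3)] gap_def
      by (simp add: algebra_simps)
    moreover have "0 \<le> ?G x"
      unfolding gap_def using t alpha_pos elim
      by (intro add_nonneg_nonneg mult_nonneg_nonneg sum_nonneg ln_gap_nonneg) auto
    ultimately show ?case by blast
  qed
  then show G0: "AE x in gauss. 0 \<le> ?G x" by eventually_elim simp
  show int_r: "integrable gauss (\<lambda>x. ln (?r x))"
  proof (rule Bochner_Integration.integrable_bound)
    show "integrable gauss (\<lambda>x. \<bar>?r x - 1\<bar> + \<bar>?L x\<bar>)"
      by (intro Bochner_Integration.integrable_add[OF integrable_abs[OF Bochner_Integration.integrable_diff] integrable_abs[OF intL]]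
        subdens_integrable(1)[OF Sc Dc] gauss.integrable_const)
    show "AE x in gauss. norm (ln (?r x)) \<le> norm (\<bar>?r x - 1\<bar> + \<bar>?L x\<bar>)"
      using key AE_subdens_pos[OF Dc]
    proof eventually_elim
      case (elim x)
      have "ln (?r x) \<le> ?r x - 1" using elim by (intro ln_le_minus_one) auto
      moreover have "?L x \<le> ln (?r x)" using elim by linarith
      ultimately show ?case unfolding real_norm_def by linarith
    qed
  qed measurable
  show int_G: "integrable gauss ?G"
  proof (rule Bochner_Integration.integrable_bound)
    show "integrable gauss (\<lambda>x. ln (?r x) - ?L x)" using int_r intL by (rule Bochner_Integration.integrable_diff)
    show "AE x in gauss. norm (?G x) \<le> norm (ln (?r x) - ?L x)"
      using key by eventually_elim (simp only: real_norm_def, linarith)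
  qed measurable
  have "(\<integral>x. ?L x + ?G x \<partial>gauss) \<le> (\<integral>x. ln (?r x) \<partial>gauss)"
    by (rule integral_mono_AE) (use key intL int_G int_r in auto)
  moreover have "(\<integral>x. ?L x + ?G x \<partial>gauss) = (1 - t) * (\<integral>x. ln (subdens i1 S0 D0 x) \<partial>gauss)
     + t * (\<integral>x. ln (subdens i1 S1 D1 x) \<partial>gauss) + (\<integral>x. ?G x \<partial>gauss)"
    by (subst Bochner_Integration.integral_add[OF intL int_G], subst Bochner_Integration.integral_add)
      (use int in \<open>auto intro: integrable_mult_right\<close>)
  ultimately show "(1 - t) * (\<integral>x. ln (subdens i1 S0 D0 x) \<partial>gauss) + t * (\<integral>x. ln (subdens i1 S1 D1 x) \<partial>gauss)
        + (\<integral>x. ?G x \<partial>gauss) \<le> (\<integral>x. ln (?r x) \<partial>gauss)" by simp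
qed

lemma KL_convex:
  assumes T0: "T0 \<in> T_star i1" and T1: "T1 \<in> T_star i1" and t: "0 \<le> t" "t \<le> 1"
  shows "KL (distr gauss borel (\<lambda>x. (1 - t) *\<^sub>R T0 x + t *\<^sub>R T1 x)) (target V)
            \<le> ereal (1 - t) * KL (distr gauss borel T0) (target V)
               + ereal t * KL (distr gauss borel T1) (target V)
               - ereal (\<alpha> / 2 * t * (1 - t)) * enn2ereal (L2dist_sq T0 T1)"
proof -
  let ?K0 = "KL (distr gauss borel T0) (target V)" and ?K1 = "KL (distr gauss borel T1) (target V)"
  \<comment> \<open>At the end points the other entropy and the squared distance may be infinite,
    but both are multiplied by 0.\<close>
  consider "t = 0" | "t = 1" | "0 < t" "t < 1" using t by linarith
  then show ?thesis
  proof cases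
    case 1 then show ?thesis by (simp add: zero_ereal_def[symmetric] one_ereal_def[symmetric])
  next
    case 2 then show ?thesis by (simp add: zero_ereal_def[symmetric] one_ereal_def[symmetric])
  next
    case 3
    show ?thesis
    proof (cases "?K0 = \<infinity> \<or> ?K1 = \<infinity>")
      case True
      then have inf: "ereal (1 - t) * ?K0 + ereal t * ?K1 = \<infinity>" using 3 by auto
      \<comment> \<open>In \<open>ereal\<close>, infinity minus infinity is infinity, so the right
        side stays infinite whatever the distance is.\<close>
      show ?thesis unfolding inf by simp
    next
      case False
      obtain S0 S1 where S: "star_family i1 S0" "star_family i1 S1" and T: "T0 = starmap i1 S0" "T1 = starmap i1 S1"
        using T0 T1 T_star_iff by metis
      have fin: "KL (distr gauss borel (starmap i1 S0)) (target V) \<noteq> \<infinity>"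
        "KL (distr gauss borel (starmap i1 S1)) (target V) \<noteq> \<infinity>" using False T by auto
      obtain D0 where D0: "subderivative i1 S0 D0" "integrable gauss (\<lambda>x. ln (subdens i1 S0 D0 x))"
        and K0: "KL (distr gauss borel (starmap i1 S0)) (target V) = ereal (- (\<integral>x. ln (subdens i1 S0 D0 x) \<partial>gauss))"
        by (rule exact_subderivative[OF S(1) fin(1)])
      obtain D1 where D1: "subderivative i1 S1 D1" "integrable gauss (\<lambda>x. ln (subdens i1 S1 D1 x))"
        and K1: "KL (distr gauss borel (starmap i1 S1)) (target V) = ereal (- (\<integral>x. ln (subdens i1 S1 D1 x) \<partial>gauss))"
        by (rule exact_subderivative[OF S(2) fin(2)])
      let ?S = "\<lambda>i p u. (1 - t) * S0 i p u + t * S1 i p u" and ?D = "\<lambda>i p u. (1 - t) * D0 i p u + t * D1 i p u"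
      note c = ln_subdens_concave[OF S D0(1) D1(1) t D0(2) D1(2)]
      let ?c = "\<alpha> / 2 * t * (1 - t)"
      let ?d = "\<lambda>x. (norm (T1 x - T0 x))\<^sup>2"
      have c_pos: "0 < ?c" using 3 alpha_pos by simp
      have [measurable]: "T0 \<in> borel_measurable borel" "T1 \<in> borel_measurable borel"
        using S unfolding T by (auto intro!: borel_measurable_starmap simp: star_family_def)
      have le_gap: "AE x in gauss. ?c * ?d x \<le> gap i1 t S0 D0 S1 D1 x"
        using AE_subderivative_pos[OF D0(1)] AE_subderivative_pos[OF D1(1)]
      proof eventually_elim
        case (elim x)
        have "0 \<le> (\<Sum>i\<in>UNIV. ln_gap t (D0 i (x $ i1) (x $ i)) (D1 i (x $ i1) (x $ i)))"
          using elim t by (intro sum_nonneg ln_gap_nonneg) auto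
        then show ?case by (simp add: gap_def T)
      qed
      \<comment> \<open>Finite entropy at both ends makes the distance of the maps finite, since the
        gap is integrable and dominates the quadratic term.\<close>
      have int_d: "integrable gauss (\<lambda>x. ?c * ?d x)"
      proof (rule Bochner_Integration.integrable_bound[OF c(2)])
        show "AE x in gauss. norm (?c * ?d x) \<le> norm (gap i1 t S0 D0 S1 D1 x)"
          using le_gap
        proof eventually_elim
          case (elim x)
          moreover have "0 \<le> ?c * ?d x" by (rule mult_nonneg_nonneg[OF less_imp_le[OF c_pos]]) simp
          ultimately show ?case unfolding real_norm_def by linarith
        qed
      qed measurable
      have int_d': "integrable gauss ?d"
      proof -
        have "integrable gauss (\<lambda>x. (1 / ?c) * (?c * ?d x))" using int_d by (rule integrable_mult_right)
        moreover have "(1 / c) * (c * y) = y" if "0 < c" for c y :: real using that by simp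
        note this[OF c_pos]
        ultimately show ?thesis by (simp only:)
      qed
      have L2: "enn2ereal (L2dist_sq T0 T1) = ereal (\<integral>x. ?d x \<partial>gauss)"
        unfolding L2dist_sq_def by (subst nn_integral_eq_integral[OF int_d']) (auto simp: enn2ereal_ennreal)
      have le: "?c * (\<integral>x. ?d x \<partial>gauss) \<le> (\<integral>x. gap i1 t S0 D0 S1 D1 x \<partial>gauss)"
        using integral_mono_AE[OF int_d c(2) le_gap] by simp
      have "KL (distr gauss borel (starmap i1 ?S)) (target V) \<le> ereal (- (\<integral>x. ln (subdens i1 ?S ?D x) \<partial>gauss))"
        by (intro KL_le_subdens star_family_convex subderivative_convex S D0 D1 t c(1))
      also have "\<dots> \<le> ereal ((1 - t) * (- (\<integral>x. ln (subdens i1 S0 D0 x) \<partial>gauss))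
          + t * (- (\<integral>x. ln (subdens i1 S1 D1 x) \<partial>gauss)) - ?c * (\<integral>x. ?d x \<partial>gauss))"
        using c(4) le by simp
      also have "\<dots> = ereal (1 - t) * ?K0 + ereal t * ?K1 - ereal ?c * enn2ereal (L2dist_sq T0 T1)"
        unfolding T K0 K1 L2[unfolded T] by simp
      finally show ?thesis unfolding T starmap_convex[abs_def] .
    qed
  qed
qed

end

section \<open>Minimizers\<close>

lemma measure_gauss_UNIV: "measure (gauss :: (real^'n) measure) UNIV = 1"
  using gauss.prob_space by simp

section \<open>Almost everywhere limits of increasing functions and their subderivatives\<close>

lemma AE_lborel_exists_between:
  fixes a b :: real
  assumes "AE u in lborel. P u" "a < b"
  shows "\<exists>u. a < u \<and> u < b \<and> P u"
proof (rule ccontr)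
  assume "\<not> ?thesis"
  then have "AE u in lborel. u \<notin> {a<..<b}"
    using assms(1) by (auto elim!: eventually_mono)
  then have "{a<..<b} \<in> null_sets lborel" by (subst AE_iff_null_sets) auto
  then show False using assms(2) by (auto dest: null_setsD1)
qed

text \<open>The lower limit is defined at every point, also where the sequence diverges, and
  inherits monotonicity; a proper limit is available almost everywhere only.\<close>

definition liminf_fun :: "(nat \<Rightarrow> real \<Rightarrow> real) \<Rightarrow> real \<Rightarrow> real" where
  "liminf_fun s u = real_of_ereal (liminf (\<lambda>n. ereal (s n u)))"

context
  fixes s d :: "nat \<Rightarrow> real \<Rightarrow> real"
  assumes mono: "\<And>n. strict_mono (s n)"
    and d[measurable]: "\<And>n. d n \<in> borel_measurable borel"
    and ineq: "\<And>n u v. u < v \<Longrightarrow>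
      (\<integral>\<^sup>+w. ennreal (d n w) * indicator {u<..<v} w \<partial>lborel) \<le> ennreal (s n v - s n u)"
    and conv: "AE u in lborel. convergent (\<lambda>n. s n u) \<and> (\<exists>l>0. (\<lambda>n. d n u) \<longlonglongrightarrow> l)"
begin

text \<open>On either side of \<open>u\<close> there are points of convergence, and monotonicity
  squeezes the lower limit at \<open>u\<close> between the limits there, so it is finite.\<close>

lemma liminf_fun_ereal: "liminf (\<lambda>n. ereal (s n u)) = ereal (liminf_fun s u)"
proof -
  obtain a where a: "a < u" "convergent (\<lambda>n. s n a)"
    using AE_lborel_exists_between[OF conv, of "u - 1" u] by auto
  obtain b where b: "u < b" "convergent (\<lambda>n. s n b)"
    using AE_lborel_exists_between[OF conv, of u "u + 1"] by auto
  obtain la lb where la: "(\<lambda>n. s n a) \<longlonglongrightarrow> la" and lb: "(\<lambda>n. s n b) \<longlonglongrightarrow> lb"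
    using a b by (auto simp: convergent_def)
  have "liminf (\<lambda>n. ereal (s n a)) = ereal la" "liminf (\<lambda>n. ereal (s n b)) = ereal lb"
    using la lb by (auto intro!: lim_imp_Liminf)
  moreover have "liminf (\<lambda>n. ereal (s n a)) \<le> liminf (\<lambda>n. ereal (s n u))"
    using strict_monoD[OF mono a(1)] by (intro Liminf_mono always_eventually) (auto intro: less_imp_le)
  moreover have "liminf (\<lambda>n. ereal (s n u)) \<le> liminf (\<lambda>n. ereal (s n b))"
    using strict_monoD[OF mono b(1)] by (intro Liminf_mono always_eventually) (auto intro: less_imp_le)
  ultimately show ?thesis
    unfolding liminf_fun_def by (cases "liminf (\<lambda>n. ereal (s n u))") auto
qed

lemma liminf_fun_tendsto: "convergent (\<lambda>n. s n u) \<Longrightarrow> (\<lambda>n. s n u) \<longlonglongrightarrow> liminf_fun s u"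
proof -
  assume "convergent (\<lambda>n. s n u)"
  then obtain l where l: "(\<lambda>n. s n u) \<longlonglongrightarrow> l" by (auto simp: convergent_def)
  then have "liminf (\<lambda>n. ereal (s n u)) = ereal l" by (auto intro!: lim_imp_Liminf)
  then show ?thesis using l by (simp add: liminf_fun_def)
qed

text \<open>By Fatou's lemma the increments of \<open>s n\<close> eventually exceed any
  \<open>x\<close> below the integral. The lower limit of a difference does not split, so
  \<open>s n u\<close> is moved to the other side: \<open>x + s n u \<le> s n v\<close> does pass to
  lower limits.\<close>

lemma liminf_fun_increment:
  assumes uv: "u < v"
  shows "(\<integral>\<^sup>+w. ennreal (lim (\<lambda>n. d n w)) * indicator {u<..<v} w \<partial>lborel) \<le> ennreal (liminf_fun s v - liminf_fun s u)"
proof (rule ccontr)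
  let ?X = "\<integral>\<^sup>+w. ennreal (lim (\<lambda>n. d n w)) * indicator {u<..<v} w \<partial>lborel"
  assume "\<not> ?thesis"
  then have "ennreal (liminf_fun s v - liminf_fun s u) < ?X" by (simp add: not_le)
  then obtain y where y: "ennreal (liminf_fun s v - liminf_fun s u) < y" "y < ?X" using dense by blast
  define x where "x = enn2real y"
  have "y < \<top>" using y(2) by (rule less_le_trans) simp
  then have x: "y = ennreal x" "0 \<le> x" by (auto simp: x_def)
  have xlt: "liminf_fun s v - liminf_fun s u < x" using y(1) x by (simp add: ennreal_less_iff)
    (metis ennreal_less_iff ennreal_lessI linorder_not_le order_less_le_trans ennreal_le_iff2 nle_le)
  have "?X \<le> (\<integral>\<^sup>+w. liminf (\<lambda>n. ennreal (d n w) * indicator {u<..<v} w) \<partial>lborel)"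
  proof (rule nn_integral_mono_AE)
    show "AE w in lborel. ennreal (lim (\<lambda>n. d n w)) * indicator {u<..<v} w \<le> liminf (\<lambda>n. ennreal (d n w) * indicator {u<..<v} w)"
      using conv
    proof eventually_elim
      case (elim w)
      then obtain l where "(\<lambda>n. d n w) \<longlonglongrightarrow> l" by auto
      then have l: "(\<lambda>n. d n w) \<longlonglongrightarrow> lim (\<lambda>n. d n w)" by (simp add: limI)
      have "(\<lambda>n. ennreal (d n w) * indicator {u<..<v} w) \<longlonglongrightarrow> ennreal (lim (\<lambda>n. d n w)) * indicator {u<..<v} w"
        using tendsto_ennrealI[OF l] by (cases "w \<in> {u<..<v}") auto
      then have "liminf (\<lambda>n. ennreal (d n w) * indicator {u<..<v} w) = ennreal (lim (\<lambda>n. d n w)) * indicator {u<..<v} w"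
        by (intro lim_imp_Liminf) auto
      then show ?case by simp
    qed
  qed
  also have "\<dots> \<le> liminf (\<lambda>n. \<integral>\<^sup>+w. ennreal (d n w) * indicator {u<..<v} w \<partial>lborel)"
    by (rule nn_integral_liminf) measurable
  finally have "y < liminf (\<lambda>n. \<integral>\<^sup>+w. ennreal (d n w) * indicator {u<..<v} w \<partial>lborel)"
    using y(2) by (rule less_le_trans[rotated])
  then have "eventually (\<lambda>n. y < (\<integral>\<^sup>+w. ennreal (d n w) * indicator {u<..<v} w \<partial>lborel)) sequentially"
    by (rule less_LiminfD)
  then have ev: "eventually (\<lambda>n. ereal x + ereal (s n u) \<le> ereal (s n v)) sequentially"
  proof eventually_elim
    case (elim n)
    then have "ennreal x < ennreal (s n v - s n u)" using ineq[OF uv, of n] x by simp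
    then have "x < s n v - s n u" using x(2) by (simp add: ennreal_less_iff)
    then show ?case by simp
  qed
  have "ereal (x + liminf_fun s u) = ereal x + liminf (\<lambda>n. ereal (s n u))" by (simp add: liminf_fun_ereal)
  also have "\<dots> = liminf (\<lambda>n. ereal x + ereal (s n u))"
    by (rule Liminf_add_ereal_left[symmetric]) auto
  also have "\<dots> \<le> liminf (\<lambda>n. ereal (s n v))" by (rule Liminf_mono[OF ev])
  also have "\<dots> = ereal (liminf_fun s v)" by (rule liminf_fun_ereal)
  finally show False using xlt by simp
qed

text \<open>On an interval without increment the integral of the limiting derivative would vanish,
  although that derivative is positive almost everywhere.\<close>

lemma strict_mono_liminf_fun: "strict_mono (liminf_fun s)"
proof (rule strict_monoI, rule ccontr)
  fix u v :: real assume uv: "u < v" and "\<not> liminf_fun s u < liminf_fun s v"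
  then have "ennreal (liminf_fun s v - liminf_fun s u) = 0" by (simp add: ennreal_eq_0_iff)
  then have "(\<integral>\<^sup>+w. ennreal (lim (\<lambda>n. d n w)) * indicator {u<..<v} w \<partial>lborel) = 0"
    using liminf_fun_increment[OF uv] by simp
  then have "AE w in lborel. ennreal (lim (\<lambda>n. d n w)) * indicator {u<..<v} w = 0"
    by (subst (asm) nn_integral_0_iff_AE) auto
  then have "AE w in lborel. w \<notin> {u<..<v}" using conv
  proof eventually_elim
    case (elim w)
    then obtain l where "l > 0" "(\<lambda>n. d n w) \<longlonglongrightarrow> l" by auto
    then have "lim (\<lambda>n. d n w) > 0" by (simp add: limI)
    then show ?case using elim by (auto simp: indicator_def ennreal_eq_0_iff split: if_splits)
  qed
  from AE_lborel_exists_between[OF this uv] show False by auto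
qed

end

text \<open>Separates the passage to the limit from the source of convergence, which is the
  predicate \<open>Q\<close>. For exceptional \<open>p\<close> outside \<open>G i\<close> the
  section is replaced by the identity with derivative 1; \<open>G i\<close> is returned so that
  convergence can be claimed at every point over it that satisfies \<open>Q\<close>.\<close>

lemma subderivative_limit:
  fixes S D :: "nat \<Rightarrow> 'n::finite \<Rightarrow> real \<Rightarrow> real \<Rightarrow> real"
  assumes S: "\<And>n. star_family i1 (S n)" and D: "\<And>n. subderivative i1 (S n) (D n)"
    and Q: "\<And>i p u. Q i p u \<Longrightarrow> convergent (\<lambda>n. S n i p u) \<and> (\<exists>l>0. (\<lambda>n. D n i p u) \<longlonglongrightarrow> l)"
    and Q_AE: "\<And>i. AE p in stdn. AE u in stdn. Q i p u"
  obtains S' D' G where "star_family i1 S'" "subderivative i1 S' D'" "\<And>i. G i \<in> sets borel" "\<And>i. AE p in stdn. p \<in> G i"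
    "\<And>i p u. p \<in> G i \<Longrightarrow> Q i p u \<Longrightarrow> (\<lambda>n. S n i p u) \<longlonglongrightarrow> S' i p u"
    "\<And>i p u. p \<in> G i \<Longrightarrow> Q i p u \<Longrightarrow> (\<lambda>n. D n i p u) \<longlonglongrightarrow> D' i p u"
proof -
  have Sm: "case_prod (S n i) \<in> borel_measurable (borel \<Otimes>\<^sub>M borel)" for n i using S by (simp add: star_family_def)
  have Dm: "case_prod (D n i) \<in> borel_measurable (borel \<Otimes>\<^sub>M borel)" for n i using D by (simp add: subderivative_def)
  have Ds: "D n i p \<in> borel_measurable borel" for n i p by (rule borel_measurable_section[OF Dm])
  have mono: "strict_mono (S n i p)" for n i p using S by (simp add: star_family_def)
  have D0: "0 \<le> D n i p u" for n i p u using D by (simp add: subderivative_def)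
  have S1: "S n i1 p = S n i1 q" for n p q using S unfolding star_family_def by blast
  have D1: "D n i1 p = D n i1 q" for n p q using D unfolding subderivative_def by blast
  define C where "C i p u \<longleftrightarrow> convergent (\<lambda>n. S n i p u) \<and> (\<exists>l>0. (\<lambda>n. D n i p u) \<longlonglongrightarrow> l)" for i p u
  define P where "P i p \<longleftrightarrow> (\<forall>n u v. u < v \<longrightarrow>
      (\<integral>\<^sup>+w. ennreal (D n i p w) * indicator {u<..<v} w \<partial>lborel) \<le> ennreal (S n i p v - S n i p u)) \<and>
     (AE u in lborel. C i p u)" for i p
  have P_AE: "AE p in stdn. P i p" for i
  proof -
    have "AE p in stdn. \<forall>n. \<forall>u v. u < v \<longrightarrow>
      (\<integral>\<^sup>+w. ennreal (D n i p w) * indicator {u<..<v} w \<partial>lborel) \<le> ennreal (S n i p v - S n i p u)"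
      using D by (subst AE_all_countable) (simp add: subderivative_def)
    then show ?thesis using Q_AE[of i]
    proof eventually_elim
      case (elim p)
      have "AE u in lborel. C i p u"
        using elim(2) unfolding AE_stdn_iff by eventually_elim (simp add: C_def Q)
      then show ?case using elim(1) unfolding P_def by blast
    qed
  qed
  \<comment> \<open>At \<open>i1\<close> the set has to be everything, since a case distinction on
    the dummy argument would make the limit depend on it.\<close>
  have "\<exists>G. G \<in> sets borel \<and> (AE p in stdn. p \<in> G) \<and> (\<forall>p\<in>G. P i p) \<and> (i = i1 \<longrightarrow> G = UNIV)" for i
  proof (cases "i = i1")
    case True
    obtain p0 where "P i p0"
      using eventually_happens'[OF stdn.ae_filter_bot P_AE[of i]] by blast
    moreover have "P i p = P i p0" for p
      unfolding P_def C_def True S1[of _ p p0] D1[of _ p p0] ..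
    ultimately have "P i p" for p by simp
    then show ?thesis by (intro exI[of _ UNIV]) simp
  next
    case False
    obtain N where N: "{p \<in> space stdn. \<not> P i p} \<subseteq> N" "emeasure stdn N = 0" "N \<in> sets stdn"
      using P_AE[of i] by (rule AE_E)
    then have "AE p in stdn. p \<notin> N" by (intro AE_not_in) auto
    then show ?thesis using N False by (intro exI[of _ "- N"]) auto
  qed
  then obtain G where G: "\<And>i. G i \<in> sets borel" "\<And>i. AE p in stdn. p \<in> G i" "\<And>i p. p \<in> G i \<Longrightarrow> P i p" "G i1 = UNIV"
    by metis
  note [measurable] = G(1)
  define S' where "S' i p u = (if p \<in> G i then liminf_fun (\<lambda>n. S n i p) u else u)" for i p u
  \<comment> \<open>\<open>max 0\<close> secures nonnegativity also at points of divergence, where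
    \<open>lim\<close> is unspecified.\<close>
  define D' where "D' i p u = (if p \<in> G i then max 0 (lim (\<lambda>n. D n i p u)) else 1)" for i p u
  have good: "strict_mono (liminf_fun (\<lambda>n. S n i p))"
    "u < v \<Longrightarrow> (\<integral>\<^sup>+w. ennreal (lim (\<lambda>n. D n i p w)) * indicator {u<..<v} w \<partial>lborel)
        \<le> ennreal (liminf_fun (\<lambda>n. S n i p) v - liminf_fun (\<lambda>n. S n i p) u)"
    "convergent (\<lambda>n. S n i p u) \<Longrightarrow> (\<lambda>n. S n i p u) \<longlonglongrightarrow> liminf_fun (\<lambda>n. S n i p) u"
    if "p \<in> G i" for i p u v
  proof -
    have ineq: "(\<integral>\<^sup>+w. ennreal (D n i p w) * indicator {u<..<v} w \<partial>lborel) \<le> ennreal (S n i p v - S n i p u)"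
      if "u < v" for n u v using G(3)[OF \<open>p \<in> G i\<close>] that unfolding P_def by blast
    have conv: "AE u in lborel. convergent (\<lambda>n. S n i p u) \<and> (\<exists>l>0. (\<lambda>n. D n i p u) \<longlonglongrightarrow> l)"
      using G(3)[OF that] unfolding P_def C_def by blast
    show "strict_mono (liminf_fun (\<lambda>n. S n i p))"
      by (rule strict_mono_liminf_fun[OF mono Ds ineq conv])
    show "(\<integral>\<^sup>+w. ennreal (lim (\<lambda>n. D n i p w)) * indicator {u<..<v} w \<partial>lborel)
        \<le> ennreal (liminf_fun (\<lambda>n. S n i p) v - liminf_fun (\<lambda>n. S n i p) u)" if "u < v"
      by (rule liminf_fun_increment[OF mono Ds ineq conv that])
    show "convergent (\<lambda>n. S n i p u) \<Longrightarrow> (\<lambda>n. S n i p u) \<longlonglongrightarrow> liminf_fun (\<lambda>n. S n i p) u"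
      by (rule liminf_fun_tendsto[OF mono Ds ineq conv])
  qed
  show thesis
  proof (rule that[of S' D' G])
    show "star_family i1 S'"
      unfolding star_family_def
    proof (intro conjI allI)
      fix i
      have [measurable]: "(\<lambda>x. S n i (fst x) (snd x)) \<in> borel_measurable (borel \<Otimes>\<^sub>M borel)" for n
        using Sm[of n i] by (simp add: case_prod_unfold)
      show "case_prod (S' i) \<in> borel_measurable (borel \<Otimes>\<^sub>M borel)"
        unfolding S'_def liminf_fun_def case_prod_unfold by measurable
    next
      fix p q
      show "S' i1 p = S' i1 q" by (auto simp: S'_def G(4) liminf_fun_def S1[of _ p q])
    next
      fix i p
      show "strict_mono (S' i p)"
        using good(1)[of p i] by (cases "p \<in> G i") (auto simp: S'_def strict_mono_def)
    qed
    show "subderivative i1 S' D'"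
      unfolding subderivative_def
    proof (intro conjI allI)
      fix i
      have [measurable]: "(\<lambda>x. D n i (fst x) (snd x)) \<in> borel_measurable (borel \<Otimes>\<^sub>M borel)" for n
        using Dm[of n i] by (simp add: case_prod_unfold)
      show "case_prod (D' i) \<in> borel_measurable (borel \<Otimes>\<^sub>M borel)"
        unfolding D'_def case_prod_unfold by measurable
    next
      fix p q
      show "D' i1 p = D' i1 q" by (auto simp: D'_def G(4) D1[of _ p q])
    next
      fix i p u
      show "0 \<le> D' i p u" by (simp add: D'_def)
    next
      fix i
      show "AE p in stdn. AE u in stdn. 0 < D' i p u"
        using G(2)[of i]
      proof eventually_elim
        case (elim p)
        then have "AE u in lborel. C i p u" using G(3) unfolding P_def by blast
        then show ?case unfolding AE_stdn_iff
        proof eventually_elim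
          case (elim u)
          then obtain l where "l > 0" "(\<lambda>n. D n i p u) \<longlonglongrightarrow> l" unfolding C_def by blast
          then show ?case by (auto simp: D'_def limI)
        qed
      qed
      show "AE p in stdn. \<forall>u v. u < v \<longrightarrow>
        (\<integral>\<^sup>+w. ennreal (D' i p w) * indicator {u<..<v} w \<partial>lborel) \<le> ennreal (S' i p v - S' i p u)"
        using G(2)[of i]
      proof eventually_elim
        case (elim p)
        then have "ennreal (D' i p w) = ennreal (lim (\<lambda>n. D n i p w))" for w
          by (simp add: D'_def max_def ennreal_neg)
        then show ?case using good(2)[OF elim] elim by (simp add: S'_def)
      qed
    qed
    show "G i \<in> sets borel" "AE p in stdn. p \<in> G i" for i by (rule G)+
    show "(\<lambda>n. S n i p u) \<longlonglongrightarrow> S' i p u" if "p \<in> G i" "Q i p u" for i p u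
      using good(3)[OF that(1)] Q[OF that(2)] that(1) by (simp add: S'_def)
    show "(\<lambda>n. D n i p u) \<longlonglongrightarrow> D' i p u" if p: "p \<in> G i" and q: "Q i p u" for i p u
    proof -
      obtain l where "l > 0" "(\<lambda>n. D n i p u) \<longlonglongrightarrow> l" using Q[OF q] by blast
      then show ?thesis using p by (simp add: D'_def limI)
    qed
  qed
qed

section \<open>Existence and uniqueness of minimizers\<close>

context strong_potential
begin

definition admissible :: "'n \<Rightarrow> ('n \<Rightarrow> real \<Rightarrow> real \<Rightarrow> real) \<Rightarrow> ('n \<Rightarrow> real \<Rightarrow> real \<Rightarrow> real) \<Rightarrow> bool" where
  "admissible i1 S D \<longleftrightarrow> star_family i1 S \<and> subderivative i1 S D \<and> integrable gauss (\<lambda>x. ln (subdens i1 S D x))"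

definition J :: "'n \<Rightarrow> ('n \<Rightarrow> real \<Rightarrow> real \<Rightarrow> real) \<Rightarrow> ('n \<Rightarrow> real \<Rightarrow> real \<Rightarrow> real) \<Rightarrow> real" where
  "J i1 S D = - (\<integral>x. ln (subdens i1 S D x) \<partial>gauss)"

text \<open>From \<open>ln r \<le> r - 1\<close>, as \<open>r\<close> has mass at most 1. This makes
  the infimum of \<open>J\<close> finite.\<close>

lemma J_nonneg:
  assumes "admissible i1 S D"
  shows "0 \<le> J i1 S D"
proof -
  have S: "star_family i1 S" and D: "subderivative i1 S D" and int: "integrable gauss (\<lambda>x. ln (subdens i1 S D x))"
    using assms by (auto simp: admissible_def)
  have "(\<integral>x. ln (subdens i1 S D x) \<partial>gauss) \<le> (\<integral>x. subdens i1 S D x - 1 \<partial>gauss)"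
  proof (rule integral_mono_AE[OF int])
    show "AE x in gauss. ln (subdens i1 S D x) \<le> subdens i1 S D x - 1"
      using AE_subdens_pos[OF D] by eventually_elim (rule ln_le_minus_one)
  qed (use subdens_integrable(1)[OF S D] in auto)
  also have "\<dots> = (\<integral>x. subdens i1 S D x \<partial>gauss) - 1"
    using subdens_integrable(1)[OF S D] by (simp add: measure_gauss_UNIV)
  finally show ?thesis using subdens_integrable(2)[OF S D] by (simp add: J_def)
qed

lemma subdens_tendsto:
  assumes "\<And>i. (\<lambda>n. S n i (x $ i1) (x $ i)) \<longlonglongrightarrow> S' i (x $ i1) (x $ i)"
    and "\<And>i. (\<lambda>n. D n i (x $ i1) (x $ i)) \<longlonglongrightarrow> D' i (x $ i1) (x $ i)"
  shows "(\<lambda>n. subdens i1 (S n) (D n) x) \<longlonglongrightarrow> subdens i1 S' D' x"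
proof -
  have "(\<lambda>n. starmap i1 (S n) x) \<longlonglongrightarrow> starmap i1 S' x"
    by (rule vec_tendstoI) (simp add: assms)
  then have "(\<lambda>n. V (starmap i1 (S n) x)) \<longlonglongrightarrow> V (starmap i1 S' x)"
    using V_cont by (intro isCont_tendsto_compose[of _ V]) (auto simp: continuous_on_eq_continuous_at)
  then show ?thesis
    unfolding subdens_def pdens_def using Z_pos gdens_pos[of x]
    by (intro tendsto_intros assms) auto
qed

text \<open>Fatou's lemma for \<open>- ln r + \<epsilon> r\<close>, which is bounded below by \<open>1 + ln \<epsilon>\<close>;
  since \<open>\<integral> r d\<rho> \<le> 1\<close>, the extra term disappears as \<open>\<epsilon>\<close> tends to \<open>0\<close>.\<close>
lemma J_lower_semicontinuous:
  assumes A: "\<And>n. admissible i1 (S n) (D n)"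
    and S': "star_family i1 S'" and D': "subderivative i1 S' D'"
    and conv: "AE x in gauss. (\<lambda>n. subdens i1 (S n) (D n) x) \<longlonglongrightarrow> subdens i1 S' D' x"
    and le: "\<And>n. J i1 (S n) (D n) \<le> m + e n" and e: "e \<longlonglongrightarrow> 0" and m: "0 \<le> m"
  shows "admissible i1 S' D'" "J i1 S' D' \<le> m"
proof -
  let ?r = "\<lambda>n. subdens i1 (S n) (D n)" and ?r' = "subdens i1 S' D'"
  have S: "star_family i1 (S n)" and D: "subderivative i1 (S n) (D n)"
    and int: "integrable gauss (\<lambda>x. ln (?r n x))" for n
    using A by (auto simp: admissible_def)
  have [measurable]: "?r n \<in> borel_measurable borel" "?r' \<in> borel_measurable borel" for n
    by (rule subdens_borel[OF S D], rule subdens_borel[OF S' D'])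
  define f where "f \<epsilon> y = - ln y + \<epsilon> * y - (1 + ln \<epsilon>)" for \<epsilon> y :: real
  have f0: "0 \<le> f \<epsilon> y" if "0 < \<epsilon>" "0 < y" for \<epsilon> y
    using ln_le_minus_one[of "\<epsilon> * y"] that by (simp add: f_def ln_mult)
  have [measurable]: "f \<epsilon> \<in> borel_measurable borel" for \<epsilon> unfolding f_def by measurable
  have bound: "(\<integral>\<^sup>+x. ennreal (f \<epsilon> (?r' x)) \<partial>gauss) \<le> ennreal (m + \<epsilon> - (1 + ln \<epsilon>))" if \<epsilon>: "0 < \<epsilon>" for \<epsilon>
  proof -
    have "(\<integral>\<^sup>+x. ennreal (f \<epsilon> (?r' x)) \<partial>gauss) = (\<integral>\<^sup>+x. liminf (\<lambda>n. ennreal (f \<epsilon> (?r n x))) \<partial>gauss)"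
    proof (rule nn_integral_cong_AE)
      show "AE x in gauss. ennreal (f \<epsilon> (?r' x)) = liminf (\<lambda>n. ennreal (f \<epsilon> (?r n x)))"
        using conv AE_subdens_pos[OF D']
      proof eventually_elim
        case (elim x)
        then have "(\<lambda>n. f \<epsilon> (?r n x)) \<longlonglongrightarrow> f \<epsilon> (?r' x)"
          unfolding f_def by (intro tendsto_intros) auto
        then show ?case by (intro lim_imp_Liminf[symmetric] tendsto_ennrealI) auto
      qed
    qed
    also have "\<dots> \<le> liminf (\<lambda>n. \<integral>\<^sup>+x. ennreal (f \<epsilon> (?r n x)) \<partial>gauss)"
      by (rule nn_integral_liminf) measurable
    also have "\<dots> \<le> liminf (\<lambda>n. ennreal (m + e n + \<epsilon> - (1 + ln \<epsilon>)))"
    proof (intro Liminf_mono always_eventually allI)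
      fix n
      have intf: "integrable gauss (\<lambda>x. f \<epsilon> (?r n x))"
        unfolding f_def using int[of n] subdens_integrable(1)[OF S[of n] D[of n]] by simp
      have "AE x in gauss. 0 \<le> f \<epsilon> (?r n x)"
        using AE_subdens_pos[OF D[of n]] by eventually_elim (rule f0[OF \<epsilon>])
      then have "(\<integral>\<^sup>+x. ennreal (f \<epsilon> (?r n x)) \<partial>gauss) = ennreal (\<integral>x. f \<epsilon> (?r n x) \<partial>gauss)"
        by (rule nn_integral_eq_integral[OF intf])
      also have "(\<integral>x. f \<epsilon> (?r n x) \<partial>gauss) = J i1 (S n) (D n) + \<epsilon> * (\<integral>x. ?r n x \<partial>gauss) - (1 + ln \<epsilon>)"
        unfolding f_def J_def using int[of n] subdens_integrable(1)[OF S[of n] D[of n]] by (simp add: measure_gauss_UNIV)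
      also have "\<dots> \<le> m + e n + \<epsilon> - (1 + ln \<epsilon>)"
      proof -
        have "\<epsilon> * (\<integral>x. ?r n x \<partial>gauss) \<le> \<epsilon> * 1"
          using \<epsilon> by (intro mult_left_mono subdens_integrable(2)[OF S D]) auto
        then show ?thesis using le[of n] by linarith
      qed
      finally show "(\<integral>\<^sup>+x. ennreal (f \<epsilon> (?r n x)) \<partial>gauss) \<le> ennreal (m + e n + \<epsilon> - (1 + ln \<epsilon>))"
        by (simp add: ennreal_leI)
    qed
    also have "\<dots> = ennreal (m + 0 + \<epsilon> - (1 + ln \<epsilon>))"
      by (intro lim_imp_Liminf tendsto_ennrealI tendsto_intros e) auto
    finally show ?thesis by simp
  qed
  have intf': "integrable gauss (\<lambda>x. f \<epsilon> (?r' x))" and f'_le: "(\<integral>x. f \<epsilon> (?r' x) \<partial>gauss) \<le> m + \<epsilon> - (1 + ln \<epsilon>)"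
    if \<epsilon>: "0 < \<epsilon>" for \<epsilon>
  proof -
    have nn: "AE x in gauss. 0 \<le> f \<epsilon> (?r' x)"
      using AE_subdens_pos[OF D'] by eventually_elim (rule f0[OF \<epsilon>])
    show i: "integrable gauss (\<lambda>x. f \<epsilon> (?r' x))"
      by (rule integrableI_nonneg) (use nn bound[OF \<epsilon>] in \<open>auto intro: le_less_trans\<close>)
    have "ennreal (\<integral>x. f \<epsilon> (?r' x) \<partial>gauss) \<le> ennreal (m + \<epsilon> - (1 + ln \<epsilon>))"
      using nn_integral_eq_integral[OF i nn] bound[OF \<epsilon>] by simp
    moreover have "0 \<le> m + \<epsilon> - (1 + ln \<epsilon>)" using m ln_le_minus_one[OF \<epsilon>] by simp
    ultimately show "(\<integral>x. f \<epsilon> (?r' x) \<partial>gauss) \<le> m + \<epsilon> - (1 + ln \<epsilon>)" by (simp add: ennreal_le_iff)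
  qed
  note intr' = subdens_integrable[OF S' D']
  have "integrable gauss (\<lambda>x. ?r' x - 1 - f 1 (?r' x))"
    using intf'[of 1] intr'(1) by (intro Bochner_Integration.integrable_diff) auto
  then have int': "integrable gauss (\<lambda>x. ln (?r' x))" by (simp add: f_def)
  then show "admissible i1 S' D'" using S' D' by (simp add: admissible_def)
  show "J i1 S' D' \<le> m"
  proof (rule field_le_epsilon)
    fix \<epsilon> :: real assume \<epsilon>: "0 < \<epsilon>"
    have "(\<integral>x. f \<epsilon> (?r' x) \<partial>gauss) = J i1 S' D' + \<epsilon> * (\<integral>x. ?r' x \<partial>gauss) - (1 + ln \<epsilon>)"
      unfolding f_def J_def using int' intr'(1) by (simp add: measure_gauss_UNIV)
    moreover have "0 \<le> \<epsilon> * (\<integral>x. ?r' x \<partial>gauss)"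
      using \<epsilon> subdens_nonneg[OF D'] by (intro mult_nonneg_nonneg integral_nonneg) auto
    ultimately show "J i1 S' D' \<le> m + \<epsilon>" using f'_le[OF \<epsilon>] by simp
  qed
qed

lemma exists_admissible: "\<exists>S D. admissible i1 S D"
proof -
  obtain T where T: "T \<in> T_star i1" "KL (distr gauss borel T) (target V) \<noteq> \<infinity>"
    using exists_finite_KL by blast
  obtain S where S: "star_family i1 S" "T = starmap i1 S" using T(1) T_star_iff by blast
  have "KL (distr gauss borel (starmap i1 S)) (target V) \<noteq> \<infinity>" using T(2) S(2) by simp
  from exact_subderivative[OF S(1) this] show ?thesis using S(1) unfolding admissible_def by metis
qed

lemma gap_half:
  "gap i1 (1/2) S0 D0 S1 D1 x = (\<Sum>i\<in>UNIV. \<alpha> / 8 * (S1 i (x $ i1) (x $ i) - S0 i (x $ i1) (x $ i))\<^sup>2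
     + ln_gap (1/2) (D0 i (x $ i1) (x $ i)) (D1 i (x $ i1) (x $ i)))"
  by (simp add: gap_def norm_vec_square sum_distrib_left sum.distrib)

text \<open>The midpoint of two admissible pairs is admissible, so its value is at least
  \<open>m\<close>, while the average of the two values is at most \<open>m + e\<close>; the
  concavity surplus has to fit in between.\<close>

lemma integral_gap_le:
  assumes A: "admissible i1 S0 D0" "admissible i1 S1 D1"
    and lower: "\<And>S D. admissible i1 S D \<Longrightarrow> m \<le> J i1 S D"
    and le: "J i1 S0 D0 \<le> m + e" "J i1 S1 D1 \<le> m + e"
  shows "integrable gauss (gap i1 (1/2) S0 D0 S1 D1)" "(\<integral>x. gap i1 (1/2) S0 D0 S1 D1 x \<partial>gauss) \<le> e"
proof -
  have S: "star_family i1 S0" "star_family i1 S1" and D: "subderivative i1 S0 D0" "subderivative i1 S1 D1"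
    and int: "integrable gauss (\<lambda>x. ln (subdens i1 S0 D0 x))" "integrable gauss (\<lambda>x. ln (subdens i1 S1 D1 x))"
    using A by (auto simp: admissible_def)
  have t: "0 \<le> (1/2::real)" "(1/2::real) \<le> 1" by auto
  note c = ln_subdens_concave[OF S D t int]
  have aux: "m \<le> - X \<Longrightarrow> (1 - 1/2) * E0 + 1/2 * E1 + G \<le> X \<Longrightarrow> - E0 \<le> m + e \<Longrightarrow> - E1 \<le> m + e \<Longrightarrow> G \<le> e"
    for X E0 E1 G :: real by simp
  show "integrable gauss (gap i1 (1/2) S0 D0 S1 D1)" by (rule c(2))
  have "m \<le> J i1 (\<lambda>i p u. (1 - 1/2) * S0 i p u + 1/2 * S1 i p u) (\<lambda>i p u. (1 - 1/2) * D0 i p u + 1/2 * D1 i p u)"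
    by (rule lower) (unfold admissible_def, intro conjI star_family_convex[OF S t] subderivative_convex[OF D S t] c(1))
  then show "(\<integral>x. gap i1 (1/2) S0 D0 S1 D1 x \<partial>gauss) \<le> e"
    using c(4) le unfolding J_def by (rule aux)
qed

text \<open>Midpoint strong convexity makes a sufficiently fast minimizing sequence converge almost everywhere,
  together with its subderivatives.\<close>
lemma exists_J_minimizer:
  "\<exists>S D. admissible i1 S D \<and> (\<forall>S' D'. admissible i1 S' D' \<longrightarrow> J i1 S D \<le> J i1 S' D')"
proof -
  define R where "R = {J i1 S D | S D. admissible i1 S D}"
  define m where "m = Inf R"
  have R_ne: "R \<noteq> {}" using exists_admissible unfolding R_def by blast
  have R_nonneg: "0 \<le> y" if "y \<in> R" for y using that J_nonneg unfolding R_def by auto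
  then have bdd: "bdd_below R" by (intro bdd_belowI[of _ 0])
  have lower: "m \<le> J i1 S D" if "admissible i1 S D" for S D
    unfolding m_def by (rule cInf_lower[OF _ bdd]) (use that in \<open>auto simp: R_def\<close>)
  have m0: "0 \<le> m" unfolding m_def by (rule cInf_greatest[OF R_ne R_nonneg])
  \<comment> \<open>The rate 1/4 bounds the gap integrals by \<open>(1/4) ^ n\<close>, so even
    \<open>2 ^ n\<close> times the gaps has a summable sequence of integrals; almost everywhere the
    gaps are then at most a constant times \<open>(1/2) ^ n\<close>.\<close>
  have "\<exists>S D. admissible i1 S D \<and> J i1 S D \<le> m + (1/4) ^ n" for n :: nat
  proof -
    have "Inf R < m + (1/4) ^ n" by (simp add: m_def)
    then obtain y where "y \<in> R" "y < m + (1/4) ^ n" using cInf_lessD[OF R_ne] by blast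
    then show ?thesis unfolding R_def by (auto intro: less_imp_le)
  qed
  then obtain S D where A: "\<And>n. admissible i1 (S n) (D n)" and J_le: "\<And>n. J i1 (S n) (D n) \<le> m + (1/4) ^ n"
    by metis
  have Sf: "star_family i1 (S n)" and Df: "subderivative i1 (S n) (D n)" for n
    using A by (auto simp: admissible_def)
  have Sm: "case_prod (S n i) \<in> borel_measurable (borel \<Otimes>\<^sub>M borel)" for n i using Sf by (simp add: star_family_def)
  have Dm: "case_prod (D n i) \<in> borel_measurable (borel \<Otimes>\<^sub>M borel)" for n i using Df by (simp add: subderivative_def)
  define G where "G n = gap i1 (1/2) (S n) (D n) (S (Suc n)) (D (Suc n))" for n
  have [measurable]: "G n \<in> borel_measurable borel" for n
    unfolding G_def by (rule gap_borel[OF Sf Sf Df Df])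
  define g where "g n i p u = \<alpha> / 8 * (S (Suc n) i p u - S n i p u)\<^sup>2 + ln_gap (1/2) (D n i p u) (D (Suc n) i p u)" for n i p u
  have G_g: "G n x = (\<Sum>i\<in>UNIV. g n i (x $ i1) (x $ i))" for n x
    unfolding G_def g_def by (rule gap_half)
  have g_pos: "\<alpha> / 8 * (S (Suc n) i p u - S n i p u)\<^sup>2 \<le> g n i p u" "0 \<le> g n i p u"
     "ln_gap (1/2) (D n i p u) (D (Suc n) i p u) \<le> g n i p u"
    if "\<forall>n. 0 < D n i p u" for n i p u
  proof -
    have 1: "0 \<le> ln_gap (1/2) (D n i p u) (D (Suc n) i p u)" using that by (intro ln_gap_nonneg) auto
    have 2: "0 \<le> \<alpha> / 8 * (S (Suc n) i p u - S n i p u)\<^sup>2" using alpha_pos by simp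
    show "\<alpha> / 8 * (S (Suc n) i p u - S n i p u)\<^sup>2 \<le> g n i p u" "0 \<le> g n i p u"
     "ln_gap (1/2) (D n i p u) (D (Suc n) i p u) \<le> g n i p u" unfolding g_def using 1 2 by linarith+
  qed
  have D_pos: "AE x::real^'n in gauss. \<forall>n i. 0 < D n i (x $ i1) (x $ i)"
    using AE_subderivative_pos[OF Df] by (subst AE_all_countable) blast
  have G0: "AE x in gauss. \<forall>n. 0 \<le> G n x"
    using D_pos by eventually_elim (auto simp: G_g intro!: sum_nonneg g_pos(2))
  have int_G: "integrable gauss (G n)" "(\<integral>x. G n x \<partial>gauss) \<le> (1/4) ^ n" for n
  proof -
    have "J i1 (S (Suc n)) (D (Suc n)) \<le> m + (1/4) ^ n"
    proof -
      have "(1/4::real) ^ Suc n \<le> (1/4) ^ n" by (rule power_decreasing) auto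
      then show ?thesis using J_le[of "Suc n"] by linarith
    qed
    from integral_gap_le[OF A A lower J_le this]
    show "integrable gauss (G n)" "(\<integral>x. G n x \<partial>gauss) \<le> (1/4) ^ n" by (auto simp: G_def)
  qed
  have "(\<integral>\<^sup>+x. (\<Sum>n. ennreal (2 ^ n * G n x)) \<partial>gauss) = (\<Sum>n. \<integral>\<^sup>+x. ennreal (2 ^ n * G n x) \<partial>gauss)"
    by (rule nn_integral_suminf) measurable
  also have "\<dots> \<le> (\<Sum>n. ennreal ((1/2) ^ n))"
  proof (rule suminf_le)
    fix n
    have "(\<integral>\<^sup>+x. ennreal (2 ^ n * G n x) \<partial>gauss) = ennreal (\<integral>x. 2 ^ n * G n x \<partial>gauss)"
    proof (rule nn_integral_eq_integral)
      show "AE x in gauss. 0 \<le> 2 ^ n * G n x" using G0 by eventually_elim simp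
    qed (use int_G in simp)
    also have "(\<integral>x. 2 ^ n * G n x \<partial>gauss) \<le> 2 ^ n * (1/4) ^ n"
      using int_G(2)[of n] by simp
    also have "(2::real) ^ n * (1/4) ^ n = (1/2) ^ n" by (simp add: power_mult_distrib[symmetric])
    finally show "(\<integral>\<^sup>+x. ennreal (2 ^ n * G n x) \<partial>gauss) \<le> ennreal ((1/2) ^ n)" by (simp add: ennreal_leI)
  qed auto
  also have "\<dots> = ennreal (\<Sum>n. (1/2) ^ n)" by (rule suminf_ennreal2) (auto intro: summable_geometric)
  also have "\<dots> < \<infinity>" by simp
  finally have "(\<integral>\<^sup>+x. (\<Sum>n. ennreal (2 ^ n * G n x)) \<partial>gauss) \<noteq> \<infinity>" by simp
  then have fin: "AE x in gauss. (\<Sum>n. ennreal (2 ^ n * G n x)) \<noteq> \<infinity>"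
    by (intro nn_integral_PInf_AE) measurable
  \<comment> \<open>The bound ranges over natural numbers so that \<open>Q\<close> is a countable
    combination of measurable conditions. It concerns one coordinate together with
    \<open>x $ i1\<close>, which allows the passage from \<open>gauss\<close> to sections.\<close>
  define Q where "Q i p u \<longleftrightarrow> (\<forall>n. 0 < D n i p u) \<and> (\<exists>C::nat. \<forall>n. 2 ^ n * g n i p u \<le> real C)" for i p u
  have Q_AE: "AE x in gauss. \<forall>i. Q i (x $ i1) (x $ i)"
    using D_pos fin
  proof eventually_elim
    case (elim x)
    show ?case
    proof
      fix i
      have pos: "\<forall>n. 0 < D n i (x $ i1) (x $ i)" for i using elim(1) by blast
      let ?s = "\<Sum>n. ennreal (2 ^ n * G n x)"
      obtain C :: nat where C: "enn2real ?s \<le> real C" using real_arch_simple by blast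
      have "2 ^ n * g n i (x $ i1) (x $ i) \<le> real C" for n
      proof -
        have "g n i (x $ i1) (x $ i) \<le> G n x"
          unfolding G_g using pos by (intro member_le_sum) (auto intro: g_pos(2))
        moreover have "ennreal (2 ^ n * G n x) \<le> ?s"
          using sum_le_suminf[of "\<lambda>n. ennreal (2 ^ n * G n x)" "{n}"] by simp
        then have "2 ^ n * G n x \<le> enn2real ?s"
          using elim(2) by (metis enn2real_nonneg ennreal_enn2real ennreal_le_iff infinity_ennreal_def less_top)
        ultimately show ?thesis using C
          by (meson mult_left_mono order_trans zero_le_numeral zero_le_power)
      qed
      then show "Q i (x $ i1) (x $ i)" unfolding Q_def using pos by blast
    qed
  qed
  have Q_AE': "AE p in stdn. AE u in stdn. Q i p u" for i
  proof (subst AE_gauss_coord_iff[symmetric])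
    have [measurable]: "(\<lambda>x. S n i (fst x) (snd x)) \<in> borel_measurable (borel \<Otimes>\<^sub>M borel)"
      "(\<lambda>x. D n i (fst x) (snd x)) \<in> borel_measurable (borel \<Otimes>\<^sub>M borel)" for n
      using Sm[of n i] Dm[of n i] by (simp_all add: case_prod_unfold)
    show "Measurable.pred (borel \<Otimes>\<^sub>M borel) (\<lambda>(p, u). Q i p u)"
      unfolding Q_def g_def ln_gap_def case_prod_unfold by measurable
    show "\<forall>p q u. Q i p u = Q i q u" if "i = i1"
    proof (intro allI)
      fix p q u
      have "S n i1 p = S n i1 q" "D n i1 p = D n i1 q" for n
        using Sf Df unfolding star_family_def subderivative_def by blast+
      then show "Q i p u = Q i q u" unfolding that Q_def g_def by metis
    qed
    show "AE x::real^'n in gauss. Q i (x $ i1) (x $ i)" using Q_AE by eventually_elim blast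
  qed
  have Q_conv: "convergent (\<lambda>n. S n i p u) \<and> (\<exists>l>0. (\<lambda>n. D n i p u) \<longlonglongrightarrow> l)" if Q: "Q i p u" for i p u
  proof
    have pos: "\<forall>n. 0 < D n i p u" using Q by (simp add: Q_def)
    obtain C :: nat where "\<And>n. 2 ^ n * g n i p u \<le> real C" using Q unfolding Q_def by blast
    then have C: "g n i p u \<le> real C / 2 ^ n" for n by (simp add: field_simps)
    show "convergent (\<lambda>n. S n i p u)"
    proof (rule convergent_of_fast_increments)
      show "eventually (\<lambda>n. (S (Suc n) i p u - S n i p u)\<^sup>2 \<le> (8 / \<alpha> * real C) / 2 ^ n) sequentially"
      proof (intro always_eventually allI)
        fix n
        have "\<alpha> / 8 * (S (Suc n) i p u - S n i p u)\<^sup>2 \<le> real C / 2 ^ n"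
          using g_pos(1)[OF pos] C by (rule order_trans)
        then show "(S (Suc n) i p u - S n i p u)\<^sup>2 \<le> (8 / \<alpha> * real C) / 2 ^ n"
          using alpha_pos by (simp add: field_simps)
      qed
    qed
    \<comment> \<open>Convergence is proved for the logarithms because a finite limit of these makes
      the limit of the derivatives positive.\<close>
    have "convergent (\<lambda>n. ln (D n i p u))"
    proof (rule convergent_of_fast_increments)
      have "(\<lambda>n. real C * (1/2) ^ n) \<longlonglongrightarrow> real C * 0"
        by (intro tendsto_intros LIMSEQ_realpow_zero) auto
      then have "eventually (\<lambda>n. real C * (1/2) ^ n < 1) sequentially"
        by (rule order_tendstoD) simp
      then show "eventually (\<lambda>n. (ln (D (Suc n) i p u) - ln (D n i p u))\<^sup>2 \<le> (32 * real C) / 2 ^ n) sequentially"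
      proof eventually_elim
        case (elim n)
        have le: "ln_gap (1/2) (D n i p u) (D (Suc n) i p u) \<le> real C / 2 ^ n"
          using g_pos(3)[OF pos] C by (rule order_trans)
        have "real C * (1/2) ^ n = real C / 2 ^ n" by (simp add: power_divide)
        with le elim have "ln_gap (1/2) (D n i p u) (D (Suc n) i p u) \<le> 1" by linarith
        then have "(ln (D n i p u) - ln (D (Suc n) i p u))\<^sup>2 \<le> 32 * ln_gap (1/2) (D n i p u) (D (Suc n) i p u)"
          using pos by (intro ln_gap_half_bound) auto
        then show ?case using le by (simp add: power2_commute)
      qed
    qed
    then obtain l where "(\<lambda>n. ln (D n i p u)) \<longlonglongrightarrow> l" by (auto simp: convergent_def)
    then have "(\<lambda>n. exp (ln (D n i p u))) \<longlonglongrightarrow> exp l" by (rule tendsto_exp)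
    then have "(\<lambda>n. D n i p u) \<longlonglongrightarrow> exp l" using pos by simp
    then show "\<exists>l>0. (\<lambda>n. D n i p u) \<longlonglongrightarrow> l" by (intro exI[of _ "exp l"]) simp
  qed
  obtain S' D' E where S': "star_family i1 S'" and D': "subderivative i1 S' D'"
    and E: "\<And>i. E i \<in> sets borel" "\<And>i. AE p in stdn. p \<in> E i"
    and lim: "\<And>i p u. p \<in> E i \<Longrightarrow> Q i p u \<Longrightarrow> (\<lambda>n. S n i p u) \<longlonglongrightarrow> S' i p u"
      "\<And>i p u. p \<in> E i \<Longrightarrow> Q i p u \<Longrightarrow> (\<lambda>n. D n i p u) \<longlonglongrightarrow> D' i p u"
    using subderivative_limit[of i1 S D Q, OF Sf Df Q_conv Q_AE'] by metis
  have "AE x::real^'n in gauss. x $ i1 \<in> E i" for i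
  proof -
    have "AE p in distr gauss borel (\<lambda>x::real^'n. x $ i1). p \<in> E i"
      using E(2)[of i] by (simp only: distr_gauss_coord)
    then show ?thesis using E(1)[of i] by (subst (asm) AE_distr_iff) auto
  qed
  then have "AE x::real^'n in gauss. \<forall>i. x $ i1 \<in> E i" by (subst AE_all_countable) blast
  then have conv: "AE x in gauss. (\<lambda>n. subdens i1 (S n) (D n) x) \<longlonglongrightarrow> subdens i1 S' D' x"
    using Q_AE
  proof eventually_elim
    case (elim x)
    then show ?case by (intro subdens_tendsto lim) auto
  qed
  have e: "(\<lambda>n. (1/4::real) ^ n) \<longlonglongrightarrow> 0" by (rule LIMSEQ_realpow_zero) auto
  have "admissible i1 S' D'" "J i1 S' D' \<le> m"
    by (rule J_lower_semicontinuous[OF A S' D' conv J_le e m0])+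
  then show ?thesis using lower by (meson order_trans)
qed

text \<open>The map of a pair minimizing \<open>J\<close> has least entropy: its entropy is at most
  its \<open>J\<close>, and the entropy of any competitor, if finite, is \<open>J\<close> of an
  exact pair. Over \<open>C_star\<close>, a measure of infinite entropy is no competitor, and any
  other is absolutely continuous, hence the law of a star map.\<close>

lemma KL_minimizer:
  "\<exists>Ts\<in>T_star i1.
            (\<forall>T\<in>T_star i1. KL (distr gauss borel Ts) (target V) \<le> KL (distr gauss borel T) (target V))
          \<and> (\<forall>T\<in>T_star i1. KL (distr gauss borel T) (target V) = KL (distr gauss borel Ts) (target V)
                \<longrightarrow> (AE x in gauss. T x = Ts x))
          \<and> distr gauss borel Ts \<in> C_star i1
          \<and> (\<forall>\<mu>\<in>C_star i1. KL (distr gauss borel Ts) (target V) \<le> KL \<mu> (target V))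
          \<and> (\<forall>\<mu>\<in>C_star i1. KL \<mu> (target V) = KL (distr gauss borel Ts) (target V)
                \<longrightarrow> \<mu> = distr gauss borel Ts)"
proof -
  let ?K = "\<lambda>T. KL (distr gauss borel T) (target V)"
  obtain S D where A: "admissible i1 S D" and min: "\<And>S' D'. admissible i1 S' D' \<Longrightarrow> J i1 S D \<le> J i1 S' D'"
    using exists_J_minimizer by blast
  define Ts where "Ts = starmap i1 S"
  have Ts: "Ts \<in> T_star i1" using A unfolding Ts_def admissible_def T_star_iff by blast
  have Ts_le: "?K Ts \<le> ereal (J i1 S D)"
    unfolding Ts_def J_def using A by (intro KL_le_subdens) (auto simp: admissible_def)
  have J_le: "ereal (J i1 S D) \<le> ?K T" if T: "T \<in> T_star i1" for T
  proof (cases "?K T = \<infinity>")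
    case False
    obtain S' where S': "star_family i1 S'" "T = starmap i1 S'" using T T_star_iff by blast
    have fin: "?K (starmap i1 S') \<noteq> \<infinity>" using False S' by simp
    obtain D' where D': "subderivative i1 S' D'" "integrable gauss (\<lambda>x. ln (subdens i1 S' D' x))"
      "?K (starmap i1 S') = ereal (J i1 S' D')"
      unfolding J_def by (rule exact_subderivative[OF S'(1) fin])
    have "J i1 S D \<le> J i1 S' D'" using S' D' by (intro min) (simp add: admissible_def)
    then show ?thesis using D'(3) S'(2) by simp
  qed simp
  have Ts_eq: "?K Ts = ereal (J i1 S D)" using Ts_le J_le[OF Ts] by (rule antisym)
  have uniq: "AE x in gauss. T x = Ts x" if T: "T \<in> T_star i1" and eq: "?K T = ?K Ts" for T
  proof -
    let ?M = "\<lambda>x. (1 - 1/2) *\<^sub>R T x + (1/2) *\<^sub>R Ts x"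
    obtain S' where S': "star_family i1 S'" "T = starmap i1 S'" using T T_star_iff by blast
    have M: "?M \<in> T_star i1"
    proof -
      have "star_family i1 (\<lambda>i p u. (1 - 1/2) * S' i p u + 1/2 * S i p u)"
        using A S'(1) by (intro star_family_convex) (auto simp: admissible_def)
      moreover have "?M = starmap i1 (\<lambda>i p u. (1 - 1/2) * S' i p u + 1/2 * S i p u)"
        unfolding S'(2) Ts_def by (rule ext) (rule starmap_convex[symmetric])
      ultimately show ?thesis using T_star_iff by blast
    qed
    \<comment> \<open>Two minimizers at positive distance would have a midpoint of strictly smaller
      entropy.\<close>
    have "ereal (J i1 S D) \<le> ?K ?M" by (rule J_le[OF M])
    also have "\<dots> \<le> ereal (1 - 1/2) * ?K T + ereal (1/2) * ?K Ts - ereal (\<alpha> / 2 * (1/2) * (1 - 1/2)) * enn2ereal (L2dist_sq T Ts)"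
      by (rule KL_convex[OF T Ts]) auto
    also have "\<dots> = ereal (J i1 S D) - ereal (\<alpha> / 8) * enn2ereal (L2dist_sq T Ts)"
      unfolding eq Ts_eq by (simp add: field_simps)
    finally have le: "ereal (J i1 S D) \<le> ereal (J i1 S D) - ereal (\<alpha> / 8) * enn2ereal (L2dist_sq T Ts)" .
    have L0: "L2dist_sq T Ts = 0"
    proof (cases "L2dist_sq T Ts")
      case (real r)
      then have "\<alpha> / 8 * r \<le> 0" using le by (simp add: enn2ereal_ennreal)
      then have "r = 0" using real alpha_pos by (simp add: mult_le_0_iff)
      then show ?thesis using real by simp
    next
      \<comment> \<open>An infinite distance would make the right side of \<open>le\<close> minus
        infinity.\<close>
      case top
      then show ?thesis using le alpha_pos by simp
    qed
    have [measurable]: "T \<in> borel_measurable borel" "Ts \<in> borel_measurable borel"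
      using T Ts by (auto simp: T_star_def star_sep_def)
    have "AE x in gauss. ennreal ((norm (Ts x - T x))\<^sup>2) = 0"
      using L0 unfolding L2dist_sq_def by (subst (asm) nn_integral_0_iff_AE) auto
    then show ?thesis by eventually_elim (simp add: ennreal_eq_0_iff)
  qed
  have from_C: "\<exists>T\<in>T_star i1. distr gauss borel T = \<mu>" if \<mu>: "\<mu> \<in> C_star i1" "KL \<mu> (target V) \<noteq> \<infinity>" for \<mu>
  proof -
    obtain \<mu>1 K where k: "star_kernel i1 \<mu> \<mu>1 K" and p: "sets \<mu> = sets borel" "prob_space \<mu>"
      using \<mu>(1) unfolding C_star_iff by blast
    obtain S' where "star_family i1 S'" "distr gauss borel (starmap i1 S') = \<mu>"
      by (rule exists_starmap_distr[OF p k KL_finite_absolutely_continuous[OF \<mu>(2)]])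
    then show ?thesis using T_star_iff by blast
  qed
  show ?thesis
  proof (intro bexI[of _ Ts] conjI ballI impI Ts)
    show "?K Ts \<le> ?K T" if "T \<in> T_star i1" for T using J_le[OF that] Ts_eq by simp
    show "AE x in gauss. T x = Ts x" if "T \<in> T_star i1" "?K T = ?K Ts" for T
      using that by (rule uniq)
    show "distr gauss borel Ts \<in> C_star i1"
      unfolding Ts_def using A by (intro distr_starmap_in_C_star) (simp add: admissible_def)
    show "?K Ts \<le> KL \<mu> (target V)" if \<mu>: "\<mu> \<in> C_star i1" for \<mu>
    proof (cases "KL \<mu> (target V) = \<infinity>")
      case False
      then obtain T where "T \<in> T_star i1" "distr gauss borel T = \<mu>" using from_C[OF \<mu>] by blast
      then show ?thesis using J_le[of T] Ts_eq by simp
    qed simp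
    show "\<mu> = distr gauss borel Ts" if \<mu>: "\<mu> \<in> C_star i1" and eq: "KL \<mu> (target V) = ?K Ts" for \<mu>
    proof -
      have "KL \<mu> (target V) \<noteq> \<infinity>" using eq Ts_eq by simp
      then obtain T where T: "T \<in> T_star i1" "distr gauss borel T = \<mu>" using from_C[OF \<mu>] by blast
      then have "AE x in gauss. T x = Ts x" using eq by (intro uniq) simp_all
      then have "distr gauss borel T = distr gauss borel Ts"
        using T(1) Ts by (intro distr_cong_AE) (auto simp: T_star_def star_sep_def)
      then show ?thesis using T(2) by simp
    qed
  qed
qed

end

theorem mainTheorem14:
  fixes V :: "real ^ 'n \<Rightarrow> real"
    and gradV :: "real ^ 'n \<Rightarrow> real ^ 'n"
    and HessV :: "real ^ 'n \<Rightarrow> real ^ 'n ^ 'n"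
    and \<alpha> :: real
    and i1 :: 'n
    and \<T> :: "(real ^ 'n \<Rightarrow> real ^ 'n) set"
  assumes dim: "CARD('n) \<ge> 2"
    and growth: "\<forall>c2>0. \<exists>c1>0. \<forall>z. \<bar>V z\<bar> \<le> c1 * exp (c2 * (norm z)\<^sup>2)"
    and grad: "\<And>z. (V has_derivative (\<lambda>h. gradV z \<bullet> h)) (at z)"
    and hess: "\<And>z. (gradV has_derivative (\<lambda>h. HessV z *v h)) (at z)"
    and hess_cont: "continuous_on UNIV HessV"
    and alpha_pos: "\<alpha> > 0"
    and strong_conv: "\<And>z h. h \<bullet> (HessV z *v h) \<ge> \<alpha> * (norm h)\<^sup>2"
    and T_sub: "\<T> \<subseteq> T_star i1"
    and T_convex: "\<And>T0 T1 t. T0 \<in> \<T> \<Longrightarrow> T1 \<in> \<T> \<Longrightarrow> 0 \<le> t \<Longrightarrow> t \<le> 1 \<Longrightarrow>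
                     (\<lambda>x. (1 - t) *\<^sub>R T0 x + t *\<^sub>R T1 x) \<in> \<T>"
  shows "(\<forall>T0\<in>\<T>. \<forall>T1\<in>\<T>. \<forall>t\<in>{0..1::real}.
            KL (distr gauss borel (\<lambda>x. (1 - t) *\<^sub>R T0 x + t *\<^sub>R T1 x)) (target V)
            \<le> ereal (1 - t) * KL (distr gauss borel T0) (target V)
               + ereal t * KL (distr gauss borel T1) (target V)
               - ereal (\<alpha> / 2 * t * (1 - t)) * enn2ereal (L2dist_sq T0 T1))
       \<and> (\<exists>Ts\<in>T_star i1.
            (\<forall>T\<in>T_star i1. KL (distr gauss borel Ts) (target V) \<le> KL (distr gauss borel T) (target V))
          \<and> (\<forall>T\<in>T_star i1. KL (distr gauss borel T) (target V) = KL (distr gauss borel Ts) (target V)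
                \<longrightarrow> (AE x in gauss. T x = Ts x))
          \<and> distr gauss borel Ts \<in> C_star i1
          \<and> (\<forall>\<mu>\<in>C_star i1. KL (distr gauss borel Ts) (target V) \<le> KL \<mu> (target V))
          \<and> (\<forall>\<mu>\<in>C_star i1. KL \<mu> (target V) = KL (distr gauss borel Ts) (target V)
                \<longrightarrow> \<mu> = distr gauss borel Ts))"
proof -
  obtain c where c: "\<And>z. c + \<alpha> / 4 * (norm z)\<^sup>2 \<le> V z"
  proof
    fix z :: "real^'n"
    have "V z \<ge> V 0 + gradV 0 \<bullet> (z - 0) + \<alpha> / 2 * (norm (z - 0))\<^sup>2"
      by (rule strong_convexity_of_hessian(2)[OF grad hess strong_conv])
    moreover have "gradV 0 \<bullet> z \<ge> - (norm (gradV 0) * norm z)"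
      using Cauchy_Schwarz_ineq2[of "gradV 0" z] by simp
    moreover have "norm (gradV 0) * norm z \<le> (norm (gradV 0))\<^sup>2 / \<alpha> + \<alpha> / 4 * (norm z)\<^sup>2"
    proof -
      \<comment> \<open>Young's inequality by completing the square: it trades the linear term for
        half of the quadratic one.\<close>
      have "0 \<le> (2 * norm (gradV 0) - \<alpha> * norm z)\<^sup>2 / (4 * \<alpha>)" using alpha_pos by simp
      also have "\<dots> = (norm (gradV 0))\<^sup>2 / \<alpha> + \<alpha> / 4 * (norm z)\<^sup>2 - norm (gradV 0) * norm z"
        using alpha_pos by (simp add: power2_eq_square field_simps)
      finally show ?thesis by simp
    qed
    ultimately show "V 0 - (norm (gradV 0))\<^sup>2 / \<alpha> + \<alpha> / 4 * (norm z)\<^sup>2 \<le> V z" by simp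
  qed
  have cont: "continuous_on UNIV V"
    using grad has_derivative_continuous by (intro continuous_at_imp_continuous_on) blast
  interpret strong_potential V \<alpha>
  proof
    show "V ((1 - t) *\<^sub>R a + t *\<^sub>R b) \<le> (1 - t) * V a + t * V b - \<alpha> / 2 * t * (1 - t) * (norm (b - a))\<^sup>2"
      if "0 \<le> t" "t \<le> 1" for a b t
      by (rule strong_convexity_of_hessian(1)[OF grad hess strong_conv that])
  qed (use growth alpha_pos cont c in auto)
  show ?thesis
  proof (intro conjI KL_minimizer ballI)
    fix T0 T1 and t :: real assume "T0 \<in> \<T>" "T1 \<in> \<T>" "t \<in> {0..1}"
    then show "KL (distr gauss borel (\<lambda>x. (1 - t) *\<^sub>R T0 x + t *\<^sub>R T1 x)) (target V)
            \<le> ereal (1 - t) * KL (distr gauss borel T0) (target V)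
               + ereal t * KL (distr gauss borel T1) (target V)
               - ereal (\<alpha> / 2 * t * (1 - t)) * enn2ereal (L2dist_sq T0 T1)"
      using T_sub by (intro KL_convex) auto
  qed
qed

end
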